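(* Let $H$ be a hieroglyph, i.e. a graph with a single vertex and finitely many loops, together with an oriented cyclic order of the loop ends at the vertex; equivalently, a cyclic word of length $2n$ over an alphabet of $n$ letters in which every letter occurs exactly twice, considered up to renaming of letters and cyclic permutation. The following conditions are equivalent: (A) $H$ is realizable on the torus. (B) $H$ does not contain any of the hieroglyphs $(ababcdcd)$, $(abcdabcd)$, $(abacdcbd)$, $(abcadbdc)$. (C) The graph of loops of $H$ is the union of a set of isolated vertices and a complete bipartite or complete tripartite graph. (D) $H$ can be reduced to one of the hieroglyphs $()$, $(abab)$, $(abcabc)$.
   Context: A hieroglyph is written as a cyclic word listing the letters of the loop ends in the order met when going around the vertex; $()$ denotes the hieroglyph with no loops. A hieroglyph is realizable (embeddable) on the torus if its loops can be drawn without self-intersections and without mutual intersections (except at the vertex) on the torus so that, going around the vertex on the torus, the outgoing segments are met in the prescribed cyclic order. A hieroglyph $H$ contains a hieroglyph $K$ if $K$ is obtained from $H$ by deleting some loops (i.e. deleting both occurrences of some letters from the cyclic word). The graph of loops of a hieroglyph has the loops as vertices, two vertices being joined by an edge iff the two loops cross, i.e. together they form the hieroglyph $(abab)$ (their letters alternate in the cyclic word). A graph is $k$-partite if its vertex set can be partitioned into $k$ sets (not necessarily nonempty), called parts, with no edges inside a part; it is complete $k$-partite if moreover any two vertices in different parts are adjacent. A reduction of a hieroglyph is a composition of finitely many of the operations: ($\alpha$) deleting an isolated loop, i.e. a loop whose two letters are consecutive in the cyclic word $(aa\dots)$; ($\beta$) replacing two parallel loops $a,b$, i.e. loops whose letters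 occupy adjacent positions twice without alternating $(ab\dots ba\dots)$, by a single loop. *)

theory Defs
  imports "HOL-Analysis.Analysis"
begin

definition hieroglyph :: "'a list \<Rightarrow> bool" where
  "hieroglyph w \<longleftrightarrow> (\<forall>a\<in>set w. count_list w a = 2)"

definition same_hieroglyph :: "'a list \<Rightarrow> 'b list \<Rightarrow> bool" where
  "same_hieroglyph u w \<longleftrightarrow> (\<exists>f n. inj_on f (set u) \<and> w = rotate n (map f u))"

definition contains_hieroglyph :: "'a list \<Rightarrow> 'b list \<Rightarrow> bool" where
  "contains_hieroglyph w k \<longleftrightarrow>
     (\<exists>S\<subseteq>set w. same_hieroglyph (filter (\<lambda>x. x \<notin> S) w) k)"

definition torus :: "(complex \<times> complex) set" where
  "torus = sphere 0 1 \<times> sphere 0 1"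

text \<open>
  The cyclic order of the loop ends at the vertex \<open>v\<close> is read off in a disc neighbourhood of \<open>v\<close>
  in the torus: \<open>h\<close> is a homeomorphism from the closed unit disc onto such a neighbourhood that
  sends the centre to \<open>v\<close>, and in this disc the loops are exactly the radii with directions
  \<open>\<theta> 0 < \<theta> 1 < \<dots>\<close>, the radius with direction \<open>\<theta> i\<close> belonging to the loop \<open>w ! i\<close>.
  The disc may have either orientation; this is immaterial, since the torus has an
  orientation-reversing homeomorphism.
\<close>
definition realizable_on_torus :: "'a list \<Rightarrow> bool" where
  "realizable_on_torus w \<longleftrightarrow>
     (\<exists>(v :: complex \<times> complex) (\<gamma> :: 'a \<Rightarrow> real \<Rightarrow> complex \<times> complex)
        (D :: (complex \<times> complex) set) (h :: complex \<Rightarrow> complex \<times> complex)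
        (h' :: complex \<times> complex \<Rightarrow> complex) (\<theta> :: nat \<Rightarrow> real).
        v \<in> torus
      \<and> (\<forall>a\<in>set w. simple_path (\<gamma> a) \<and> path_image (\<gamma> a) \<subseteq> torus
                    \<and> pathstart (\<gamma> a) = v \<and> pathfinish (\<gamma> a) = v)
      \<and> (\<forall>a\<in>set w. \<forall>b\<in>set w. a \<noteq> b \<longrightarrow> path_image (\<gamma> a) \<inter> path_image (\<gamma> b) = {v})
      \<and> D \<subseteq> torus \<and> homeomorphism (cball 0 1) D h h'
      \<and> openin (top_of_set torus) (h ` ball 0 1) \<and> h 0 = v
      \<and> strict_mono_on {..<length w} \<theta> \<and> \<theta> ` {..<length w} \<subseteq> {0..<2 * pi}
      \<and> (\<forall>a\<in>set w. path_image (\<gamma> a) \<inter> D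
            = h ` (\<Union>i\<in>{i. i < length w \<and> w ! i = a}. closed_segment 0 (cis (\<theta> i)))))"

text \<open>
  The graph of loops of \<open>w\<close> has vertex set \<open>set w\<close> and the following adjacency relation.
\<close>
definition loops_cross :: "'a list \<Rightarrow> 'a \<Rightarrow> 'a \<Rightarrow> bool" where
  "loops_cross w a b \<longleftrightarrow>
     a \<in> set w \<and> b \<in> set w \<and> a \<noteq> b \<and>
     same_hieroglyph (filter (\<lambda>x. x \<in> {a, b}) w) [0, 1, 0, 1 :: nat]"

definition complete_partite :: "nat \<Rightarrow> 'a set \<Rightarrow> ('a \<Rightarrow> 'a \<Rightarrow> bool) \<Rightarrow> bool" where
  "complete_partite k V E \<longleftrightarrow>
     (\<exists>P :: nat \<Rightarrow> 'a set.
        (\<Union>i<k. P i) = V \<and> disjoint_family_on P {..<k}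
      \<and> (\<forall>i<k. \<forall>x\<in>P i. \<forall>y\<in>P i. \<not> E x y)
      \<and> (\<forall>i<k. \<forall>j<k. i \<noteq> j \<longrightarrow> (\<forall>x\<in>P i. \<forall>y\<in>P j. E x y)))"

definition isolated_plus_complete_partite :: "nat \<Rightarrow> 'a set \<Rightarrow> ('a \<Rightarrow> 'a \<Rightarrow> bool) \<Rightarrow> bool" where
  "isolated_plus_complete_partite k V E \<longleftrightarrow>
     (\<exists>I W. V = I \<union> W \<and> I \<inter> W = {}
          \<and> (\<forall>x\<in>I. \<forall>y\<in>V. \<not> E x y \<and> \<not> E y x)
          \<and> complete_partite k W E)"

inductive reduction_step :: "'a list \<Rightarrow> 'a list \<Rightarrow> bool" where
  isolated: "rotate n w = [a, a] @ u \<Longrightarrow> reduction_step w u"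
| parallel: "rotate n w = [a, b] @ u @ [b, a] @ u' \<Longrightarrow> reduction_step w ([a] @ u @ [a] @ u')"

definition reduces_to :: "'a list \<Rightarrow> 'b list \<Rightarrow> bool" where
  "reduces_to w k \<longleftrightarrow> (\<exists>u. reduction_step\<^sup>*\<^sup>* w u \<and> same_hieroglyph u k)"

end

theory Submission
  imports Defs
begin

text \<open>
  All conditions are compared with the existence of a labelling of the loops by the elements of the
  group \<open>Z/2 \<times> Z/2\<close> such that two loops cross iff their labels are nonzero and distinct.

  If the hieroglyph is realized on the torus, label each loop by its homology class modulo 2. Two loops
  that meet only in the vertex cross there iff their intersection number is odd, and this number is the
  determinant of the two classes. The parity statement for merely continuous loops is obtained from a
  section of the line bundle of degree one, evaluated on differences of points of the two lifted loops.

  Conversely, a labelled hieroglyph has innermost isolated loops, whose removal leaves a cyclic word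
  \<open>A B C A\<^sup>r B\<^sup>r C\<^sup>r\<close>, where \<open>r\<close> is reversal. Such a word is drawn in a hexagon with opposite sides
  identified, and isolated loops are added near the vertex. The word reduces to one of the three minimal
  hieroglyphs by merging the parallel loops of each block.

  The forbidden hieroglyphs are the unique ones whose graphs of loops are \<open>2 K\<^sub>2\<close>, \<open>K\<^sub>4\<close>, the path on four vertices and
  the triangle with a pendant edge; non-adjacency is transitive on non-isolated vertices exactly if the
  first, third and fourth do not occur, and \<open>K\<^sub>4\<close> bounds the number of classes.
\<close>

section \<open>Crossing loops\<close>

text \<open>The labels are what remains of a drawing when only intersection parities are kept. A
  bipartite graph counts as tripartite with an empty part, so three nonzero classes serve for both
  cases of (C). Labels need not be unique: if all nonzero labels that occur agree, an isolated loop
  may carry that label too. The obstacle is the passage from drawings to labels. The loops are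
  merely continuous and may approach the vertex in an oscillating way, so intersections cannot be
  counted by transversality. Counting is replaced by a function on the square of parameters of two
  loops: it vanishes at corners only, so the change of its logarithm along the boundary can be
  computed in two ways, from the opposite sides and from the corners. Only parity matters, hence the
  local degree of the section at a lattice point is never determined; that it is odd comes from the
  section being an odd function. In the converse direction a hexagon is natural since it has one
  pair of opposite sides for each of the three nonzero classes.\<close>

lemma hieroglyph_rotate: "hieroglyph (rotate n w) \<longleftrightarrow> hieroglyph w"
proof -
  have "count_list (rotate1 v) a = count_list v a" for v :: "'a list" and a by (cases v) auto
  then have "count_list (rotate n w) a = count_list w a" for a by (induction n) auto
  then show ?thesis by (simp add: hieroglyph_def)
qed

lemma filter_rotate: "\<exists>m. filter P (rotate n w) = rotate m (filter P w)"
proof (induction n)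
  case 0
  show ?case by (intro exI[of _ 0]) simp
next
  case (Suc n)
  then obtain m where m: "filter P (rotate n w) = rotate m (filter P w)" by blast
  have "filter P (rotate1 v) \<in> {filter P v, rotate1 (filter P v)}" for v by (cases v) auto
  from this[of "rotate n w"] show ?case unfolding m
    by (auto intro: exI[of _ m] exI[of _ "Suc m"])
qed

lemma rotate_inverse: "\<exists>k. rotate k (rotate n w) = w"
proof (cases "w = []")
  case False
  have "rotate (length w - n mod length w) (rotate n w) = rotate (length w - n mod length w + n mod length w) w"
    by (metis rotate_conv_mod rotate_rotate)
  also have "\<dots> = w" using False by (simp add: less_imp_le)
  finally show ?thesis by blast
qed simp

lemma same_hieroglyph_rotate: "same_hieroglyph (rotate m u) k \<longleftrightarrow> same_hieroglyph u k"
proof -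
  have 1: "same_hieroglyph u k" if "same_hieroglyph (rotate m u) k" for u and m
  proof -
    from that obtain f n where "inj_on f (set u)" "k = rotate n (map f (rotate m u))"
      by (auto simp: same_hieroglyph_def)
    then show ?thesis unfolding same_hieroglyph_def
      by (intro exI[of _ f] exI[of _ "n + m"]) (simp add: rotate_map rotate_rotate)
  qed
  obtain j where "rotate j (rotate m u) = u" using rotate_inverse by blast
  then show ?thesis using 1[of m u] 1[of j "rotate m u"] by auto
qed

lemma same_hieroglyph_of_rotate:
  assumes "rotate m v = u" "inj_on f (set u)" "map f u = k"
  shows "same_hieroglyph v k"
  unfolding same_hieroglyph_def using assms by (intro exI[of _ f] exI[of _ m]) (auto simp: rotate_map)

lemma loops_cross_rotate: "loops_cross (rotate n w) a b \<longleftrightarrow> loops_cross w a b"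
proof -
  obtain m where "filter (\<lambda>x. x \<in> {a, b}) (rotate n w) = rotate m (filter (\<lambda>x. x \<in> {a, b}) w)"
    using filter_rotate by blast
  then show ?thesis unfolding loops_cross_def by (simp only: same_hieroglyph_rotate set_rotate)
qed

lemma loops_cross_commute: "loops_cross w a b \<longleftrightarrow> loops_cross w b a"
  unfolding loops_cross_def insert_commute[of a b] by auto

text \<open>Equal lengths force \<open>u\<close> to have four letters, and only four rotations of
  the pattern then have to be compared. This replaces equality up to renaming and rotation by an
  explicit list of words.\<close>

lemma same_hieroglyph_abab_iff:
  assumes "set u = {a, b}"
  shows "same_hieroglyph u [0, 1, 0, 1 :: nat] \<longleftrightarrow> a \<noteq> b \<and> u \<in> {[a, b, a, b], [b, a, b, a]}"
proof
  assume "same_hieroglyph u [0, 1, 0, 1 :: nat]"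
  then obtain f n where f: "inj_on f (set u)" "[0, 1, 0, 1 :: nat] = rotate n (map f u)"
    by (auto simp: same_hieroglyph_def)
  have "length [0, 1, 0, 1 :: nat] = length (rotate n (map f u))" by (rule arg_cong[OF f(2)])
  then have len: "length u = 4" by simp
  then obtain p q r s where u: "u = [p, q, r, s]" by (auto simp: length_Suc_conv numeral_eq_Suc)
  define m where "m = n mod 4"
  have "[0, 1, 0, 1 :: nat] = rotate m (map f u)" using f(2) len unfolding m_def by (metis length_map rotate_conv_mod)
  moreover have "m = 0 \<or> m = Suc 0 \<or> m = Suc (Suc 0) \<or> m = Suc (Suc (Suc 0))" unfolding m_def by linarith
  ultimately have "f p = f r \<and> f q = f s \<and> f p \<noteq> f q" unfolding u by (elim disjE) simp_all
  moreover have "p \<in> set u" "q \<in> set u" "r \<in> set u" "s \<in> set u" by (simp_all add: u)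
  ultimately have "p = r" "q = s" "p \<noteq> q" using f(1) by (metis inj_onD)+
  moreover from this have "{p, q} = {a, b}" using u assms by auto
  ultimately show "a \<noteq> b \<and> u \<in> {[a, b, a, b], [b, a, b, a]}" using u by (auto simp: doubleton_eq_iff)
next
  assume "a \<noteq> b \<and> u \<in> {[a, b, a, b], [b, a, b, a]}"
  then show "same_hieroglyph u [0, 1, 0, 1 :: nat]"
    unfolding same_hieroglyph_def
    by (auto intro!: exI[of _ "\<lambda>x. if x = hd u then 0 else 1"] exI[of _ 0] simp: inj_on_def)
qed

lemma loops_cross_iff:
  "loops_cross w a b \<longleftrightarrow> a \<in> set w \<and> b \<in> set w \<and> a \<noteq> b \<and>
     filter (\<lambda>x. x \<in> {a, b}) w \<in> {[a, b, a, b], [b, a, b, a]}"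
proof (cases "a \<in> set w \<and> b \<in> set w")
  case True
  then have "set (filter (\<lambda>x. x \<in> {a, b}) w) = {a, b}" by auto
  from same_hieroglyph_abab_iff[OF this] show ?thesis unfolding loops_cross_def by blast
qed (auto simp: loops_cross_def)

text \<open>Crossing is decided by the subword on the two letters, so inserting or deleting other
  letters does not affect it. Comparisons of a word with a shorter one rest on this.\<close>

lemma loops_cross_cong:
  assumes "filter (\<lambda>x. x \<in> {a, b}) v = filter (\<lambda>x. x \<in> {a, b}) w"
  shows "loops_cross v a b \<longleftrightarrow> loops_cross w a b"
proof -
  have "set (filter (\<lambda>x. x \<in> {a, b}) v) = set (filter (\<lambda>x. x \<in> {a, b}) w)" using assms by simp
  then have "a \<in> set v \<longleftrightarrow> a \<in> set w" "b \<in> set v \<longleftrightarrow> b \<in> set w" by auto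
  then show ?thesis unfolding loops_cross_def assms by simp
qed

lemma loops_cross_map:
  assumes "inj_on f (set u)" "x \<in> set u" "y \<in> set u"
  shows "loops_cross (map f u) (f x) (f y) \<longleftrightarrow> loops_cross u x y"
proof -
  have eq: "f z = f t \<longleftrightarrow> z = t" if "z \<in> set u" "t \<in> set u" for z t using assms(1) that by (auto dest: inj_onD)
  have "filter (\<lambda>z. z \<in> {f x, f y}) (map f u) = map f (filter (\<lambda>z. f z \<in> {f x, f y}) u)"
    by (simp add: filter_map o_def)
  also have "filter (\<lambda>z. f z \<in> {f x, f y}) u = filter (\<lambda>z. z \<in> {x, y}) u"
    using assms eq by (intro filter_cong) auto
  finally have F: "filter (\<lambda>z. z \<in> {f x, f y}) (map f u) = map f (filter (\<lambda>z. z \<in> {x, y}) u)" .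
  have inj: "map f v = map f v' \<longleftrightarrow> v = v'" if "set v \<subseteq> set u" "set v' \<subseteq> set u" for v v'
    using inj_on_map_eq_map[of f v v'] inj_on_subset[OF assms(1)] that by simp
  have "set (filter (\<lambda>z. z \<in> {x, y}) u) \<subseteq> set u" by auto
  then have "map f (filter (\<lambda>z. z \<in> {x, y}) u) = [f x, f y, f x, f y] \<longleftrightarrow> filter (\<lambda>z. z \<in> {x, y}) u = [x, y, x, y]"
    "map f (filter (\<lambda>z. z \<in> {x, y}) u) = [f y, f x, f y, f x] \<longleftrightarrow> filter (\<lambda>z. z \<in> {x, y}) u = [y, x, y, x]"
    using inj[of "filter (\<lambda>z. z \<in> {x, y}) u" "[x, y, x, y]"] inj[of "filter (\<lambda>z. z \<in> {x, y}) u" "[y, x, y, x]"] assms(2,3)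
    by auto
  then show ?thesis unfolding loops_cross_iff F using assms eq by auto
qed

text \<open>
  The labels are the four homology classes modulo 2 on the torus (0 is the trivial class):
  two classes have odd intersection number iff they are nonzero and distinct.
\<close>

definition crossing_labels :: "'a list \<Rightarrow> ('a \<Rightarrow> nat) \<Rightarrow> bool" where
  "crossing_labels w l \<longleftrightarrow> (\<forall>a\<in>set w. l a < 4) \<and>
     (\<forall>a\<in>set w. \<forall>b\<in>set w. loops_cross w a b \<longleftrightarrow> l a \<noteq> 0 \<and> l b \<noteq> 0 \<and> l a \<noteq> l b)"

lemma crossing_labels_rotate: "crossing_labels (rotate n w) l \<longleftrightarrow> crossing_labels w l"
  by (simp add: crossing_labels_def loops_cross_rotate)

text \<open>Part \<open>i\<close> corresponds to the label \<open>i + 1\<close> and the set of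
  isolated loops to the label 0. Labels always yield three, possibly empty, parts; conversely any
  number of parts up to three can be labelled, which treats both cases of (C) at once.\<close>

lemma crossing_labels_complete_partite:
  "(\<exists>l. crossing_labels w l) \<longleftrightarrow>
     isolated_plus_complete_partite 2 (set w) (loops_cross w) \<or> isolated_plus_complete_partite 3 (set w) (loops_cross w)"
proof
  assume "\<exists>l. crossing_labels w l"
  then obtain l where "crossing_labels w l" by blast
  then have l: "\<And>a. a \<in> set w \<Longrightarrow> l a < 4"
    "\<And>a b. a \<in> set w \<Longrightarrow> b \<in> set w \<Longrightarrow> loops_cross w a b \<longleftrightarrow> l a \<noteq> 0 \<and> l b \<noteq> 0 \<and> l a \<noteq> l b"
    by (auto simp: crossing_labels_def)
  let ?P = "\<lambda>i. {x \<in> set w. l x = Suc i}"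
  have "complete_partite 3 {x \<in> set w. l x \<noteq> 0} (loops_cross w)"
    unfolding complete_partite_def
  proof (intro exI[of _ ?P] conjI)
    have "\<exists>i<3. l x = Suc i" if "x \<in> set w" "l x \<noteq> 0" for x
      using l(1)[OF that(1)] that(2) by (intro exI[of _ "l x - 1"]) auto
    then show "(\<Union>i<3. ?P i) = {x \<in> set w. l x \<noteq> 0}" by auto
    show "disjoint_family_on ?P {..<3}" by (auto simp: disjoint_family_on_def)
  qed (use l in auto)
  then have "isolated_plus_complete_partite 3 (set w) (loops_cross w)"
    unfolding isolated_plus_complete_partite_def
    by (intro exI[of _ "{x \<in> set w. l x = 0}"] exI[of _ "{x \<in> set w. l x \<noteq> 0}"]) (use l(2) in auto)
  then show "isolated_plus_complete_partite 2 (set w) (loops_cross w) \<or> isolated_plus_complete_partite 3 (set w) (loops_cross w)" ..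
next
  assume "isolated_plus_complete_partite 2 (set w) (loops_cross w) \<or> isolated_plus_complete_partite 3 (set w) (loops_cross w)"
  then obtain k :: nat where k: "k \<le> 3" "isolated_plus_complete_partite k (set w) (loops_cross w)"
  proof (elim disjE)
    assume "isolated_plus_complete_partite 2 (set w) (loops_cross w)"
    then show thesis by (intro that[of 2]) auto
  next
    assume "isolated_plus_complete_partite 3 (set w) (loops_cross w)"
    then show thesis by (intro that[of 3]) auto
  qed
  from k(2) obtain I W where IW: "set w = I \<union> W" "I \<inter> W = {}" "\<forall>x\<in>I. \<forall>y\<in>set w. \<not> loops_cross w x y \<and> \<not> loops_cross w y x"
    and "complete_partite k W (loops_cross w)"
    unfolding isolated_plus_complete_partite_def by metis
  then obtain P where P: "(\<Union>i<k. P i) = W" "disjoint_family_on P {..<k}"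
      "\<forall>i<k. \<forall>x\<in>P i. \<forall>y\<in>P i. \<not> loops_cross w x y"
      "\<forall>i<k. \<forall>j<k. i \<noteq> j \<longrightarrow> (\<forall>x\<in>P i. \<forall>y\<in>P j. loops_cross w x y)"
    unfolding complete_partite_def by metis
  have "\<exists>i. x \<in> W \<longrightarrow> i < k \<and> x \<in> P i" for x using P(1) by blast
  then obtain p where p: "\<And>x. x \<in> W \<Longrightarrow> p x < k \<and> x \<in> P (p x)" by metis
  define l where "l x = (if x \<in> W then Suc (p x) else 0)" for x
  have "loops_cross w a b \<longleftrightarrow> l a \<noteq> 0 \<and> l b \<noteq> 0 \<and> l a \<noteq> l b" if ab: "a \<in> set w" "b \<in> set w" for a b
  proof (cases "a \<in> W \<and> b \<in> W")
    case True
    then show ?thesis using P(3,4) p[of a] p[of b] by (cases "p a = p b") (auto simp: l_def)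
  next
    case False
    then have "a \<in> I \<or> b \<in> I" using ab IW(1) by blast
    then show ?thesis using False IW(3) ab by (auto simp: l_def)
  qed
  moreover have "l a < 4" for a using p[of a] k(1) by (auto simp: l_def)
  ultimately show "\<exists>l. crossing_labels w l" unfolding crossing_labels_def by blast
qed

section \<open>Labels under deletion, renaming and reduction\<close>

lemma crossing_labels_filter:
  assumes "crossing_labels w l" and u: "u = filter (\<lambda>x. x \<notin> S) w"
  shows "crossing_labels u l"
proof -
  have "loops_cross u a b \<longleftrightarrow> loops_cross w a b" if "a \<in> set u" "b \<in> set u" for a b
    by (rule loops_cross_cong) (use that in \<open>auto simp: u intro!: filter_cong\<close>)
  then show ?thesis using assms(1) unfolding crossing_labels_def u by simp
qed

lemma crossing_labels_same_hieroglyph: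
  assumes "same_hieroglyph u k"
  shows "(\<exists>l. crossing_labels u l) \<longleftrightarrow> (\<exists>l. crossing_labels k l)"
proof -
  obtain f n where f: "inj_on f (set u)" "k = rotate n (map f u)" using assms by (auto simp: same_hieroglyph_def)
  have k: "crossing_labels k l \<longleftrightarrow> crossing_labels (map f u) l" for l unfolding f(2) by (rule crossing_labels_rotate)
  show ?thesis
  proof
    assume "\<exists>l. crossing_labels u l"
    then obtain l where l: "crossing_labels u l" by blast
    have "crossing_labels (map f u) (\<lambda>y. l (the_inv_into (set u) f y))"
      using l f(1) by (auto simp: crossing_labels_def loops_cross_map the_inv_into_f_f)
    then show "\<exists>l. crossing_labels k l" unfolding k by blast
  next
    assume "\<exists>l. crossing_labels k l"
    then obtain l where "crossing_labels (map f u) l" unfolding k by blast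
    then have "crossing_labels u (l \<circ> f)" using f(1) by (auto simp: crossing_labels_def loops_cross_map)
    then show "\<exists>l. crossing_labels u l" by blast
  qed
qed

text \<open>Labels restrict to the contained word, where non-crossing letters with nonzero labels
  must have equal labels. Each pattern has no isolated letter, so all labels are nonzero: in the
  first, third and fourth word two crossing letters are joined by a chain of non-crossing pairs and
  would get the same label; in the second, four distinct values in {1, 2, 3} would be
  needed.\<close>

lemma crossing_labels_not_contains:
  assumes "crossing_labels w l"
    and "K \<in> {[0,1,0,1,2,3,2,3], [0,1,2,3,0,1,2,3], [0,1,0,2,3,2,1,3], [0,1,2,0,3,1,3,2 :: nat]}"
  shows "\<not> contains_hieroglyph w K"
proof
  assume "contains_hieroglyph w K"
  then obtain S where "same_hieroglyph (filter (\<lambda>x. x \<notin> S) w) K" unfolding contains_hieroglyph_def by blast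
  with crossing_labels_filter[OF assms(1) refl] obtain l where l: "crossing_labels K l"
    using crossing_labels_same_hieroglyph by blast
  then have lt: "\<And>a. a \<in> set K \<Longrightarrow> l a < 4"
    and cr: "\<And>a b. a \<in> set K \<Longrightarrow> b \<in> set K \<Longrightarrow> loops_cross K a b \<longleftrightarrow> l a \<noteq> 0 \<and> l b \<noteq> 0 \<and> l a \<noteq> l b"
    by (auto simp: crossing_labels_def)
  have K: "0 \<in> set K" "1 \<in> set K" "2 \<in> set K" "3 \<in> set K" using assms(2) by auto
  note c = cr[OF K(1,2)] cr[OF K(1,3)] cr[OF K(1,4)] cr[OF K(2,3)] cr[OF K(2,4)] cr[OF K(3,4)]
  note b = lt[OF K(1)] lt[OF K(2)] lt[OF K(3)] lt[OF K(4)]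
  from assms(2) consider "K = [0,1,0,1,2,3,2,3]" | "K = [0,1,2,3,0,1,2,3]" | "K = [0,1,0,2,3,2,1,3]" | "K = [0,1,2,0,3,1,3,2]"
    by blast
  then show False
  proof cases
    case 1 then show False using c b by (simp add: loops_cross_iff)
  next
    case 2 then show False using c b by (simp add: loops_cross_iff)
  next
    case 3 then show False using c b by (simp add: loops_cross_iff)
  next
    case 4 then show False using c b by (simp add: loops_cross_iff)
  qed
qed

text \<open>A letter occurring in \<open>X\<close> or \<open>Y\<close> occurs twice in total, and
  its restricted word with \<open>a\<close> only depends on the distribution 0+2, 1+1 or 2+0 of its
  occurrences; only 1+1 alternates with \<open>a\<close>.\<close>

lemma loops_cross_split:
  assumes H: "hieroglyph (a # X @ a # Y)" and b: "b \<noteq> a"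
  shows "loops_cross (a # X @ a # Y) a b \<longleftrightarrow> b \<in> set X \<and> b \<in> set Y"
proof -
  have "count_list (a # X @ a # Y) a = 2" using H by (auto simp: hieroglyph_def)
  then have a: "a \<notin> set X" "a \<notin> set Y" by (auto simp: count_list_0_iff)
  have F: "filter (\<lambda>x. x \<in> {a, b}) Z = replicate (count_list Z b) b" if "a \<notin> set Z" for Z
    using that by (induction Z) auto
  show ?thesis
  proof (cases "b \<in> set X \<or> b \<in> set Y")
    case True
    then have "count_list (a # X @ a # Y) b = 2" using H by (auto simp: hieroglyph_def)
    then have two: "count_list X b + count_list Y b = 2" using b by simp
    then consider "count_list X b = 0" "count_list Y b = 2" | "count_list X b = 1" "count_list Y b = 1"
      | "count_list X b = 2" "count_list Y b = 0" by linarith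
    then show ?thesis
    proof cases
      case 1
      then have "b \<notin> set X" by (simp add: count_list_0_iff)
      then show ?thesis using 1 a F b by (simp add: loops_cross_iff numeral_eq_Suc)
    next
      case 2
      then have "b \<in> set X" "b \<in> set Y" by (metis count_list_0_iff zero_neq_one)+
      then show ?thesis using 2 a F b by (simp add: loops_cross_iff)
    next
      case 3
      then have "b \<notin> set Y" by (simp add: count_list_0_iff)
      then show ?thesis using 3 a F b by (simp add: loops_cross_iff numeral_eq_Suc)
    qed
  next
    case False
    then show ?thesis using b by (auto simp: loops_cross_iff)
  qed
qed

lemma hieroglyph_isolated:
  assumes "hieroglyph ([a, a] @ u)"
  shows "hieroglyph u" "a \<notin> set u"
proof -
  show "a \<notin> set u" using assms by (auto simp: hieroglyph_def count_list_0_iff)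
  then show "hieroglyph u" using assms by (auto simp: hieroglyph_def split: if_splits)
qed

lemma crossing_labels_isolated:
  assumes H: "hieroglyph ([a, a] @ u)" and l: "crossing_labels u l"
  shows "crossing_labels ([a, a] @ u) (l(a := 0))"
proof -
  have a: "a \<notin> set u" by (rule hieroglyph_isolated[OF H])
  have "\<not> loops_cross ([a, a] @ u) a b" for b
    using loops_cross_split[of a "[]" u b] H by (cases "b = a") (auto simp: loops_cross_def)
  moreover from this have "\<not> loops_cross ([a, a] @ u) b a" for b by (simp add: loops_cross_commute[of _ b a])
  moreover have "loops_cross ([a, a] @ u) x y \<longleftrightarrow> loops_cross u x y" if "x \<noteq> a" "y \<noteq> a" for x y
    by (rule loops_cross_cong) (use that in auto)
  ultimately show ?thesis using l a unfolding crossing_labels_def by auto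
qed

lemma hieroglyph_parallel:
  assumes H: "hieroglyph ([a, b] @ u @ [b, a] @ u')"
  shows "hieroglyph ([a] @ u @ [a] @ u')" "a \<noteq> b" "a \<notin> set u \<union> set u'" "b \<notin> set u \<union> set u'"
proof -
  let ?w = "[a, b] @ u @ [b, a] @ u'" and ?v = "[a] @ u @ [a] @ u'"
  have c: "count_list ?w a = 2" "count_list ?w b = 2" using H by (auto simp: hieroglyph_def)
  show ab: "a \<noteq> b"
  proof
    assume "a = b"
    then have "count_list ?w a = 4 + count_list u a + count_list u' a" by simp
    with c(1) show False by simp
  qed
  have "count_list u a = 0" "count_list u' a = 0" "count_list u b = 0" "count_list u' b = 0" using c ab by auto
  then show ni: "a \<notin> set u \<union> set u'" "b \<notin> set u \<union> set u'" by (simp_all add: count_list_0_iff)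
  show "hieroglyph ?v" unfolding hieroglyph_def
  proof
    fix x assume x: "x \<in> set ?v"
    then have "x \<in> set ?w" "x \<noteq> b" using ni ab by auto
    then have "count_list ?w x = 2" using H unfolding hieroglyph_def by blast
    then show "count_list ?v x = 2" using \<open>x \<noteq> b\<close> by (auto split: if_splits)
  qed
qed

text \<open>Parallel loops do not cross each other and cross the same other loops, namely those with
  one end in \<open>u\<close> and one in \<open>u'\<close>. Hence the restored loop \<open>b\<close>
  can take over the label of \<open>a\<close>.\<close>

lemma crossing_labels_parallel:
  assumes H: "hieroglyph ([a, b] @ u @ [b, a] @ u')" and l: "crossing_labels ([a] @ u @ [a] @ u') l"
  shows "crossing_labels ([a, b] @ u @ [b, a] @ u') (l(b := l a))"
proof -
  let ?w = "[a, b] @ u @ [b, a] @ u'" and ?v = "[a] @ u @ [a] @ u'"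
  have Hv: "hieroglyph ?v" and ab: "a \<noteq> b" and ni: "a \<notin> set u" "a \<notin> set u'" "b \<notin> set u" "b \<notin> set u'"
    using hieroglyph_parallel[OF H] by auto
  \<comment> \<open>Rotating by one letter brings \<open>b\<close> to the front, so that the word
    splits at \<open>b\<close> as it splits at \<open>a\<close>.\<close>
  have Hb: "hieroglyph (b # u @ b # (a # u' @ [a]))"
    using H hieroglyph_rotate[of 1 ?w] by simp
  have ca: "loops_cross ?w a x \<longleftrightarrow> x \<in> set u \<and> x \<in> set u'" if "x \<noteq> a" for x
    using loops_cross_split[of a "b # u @ [b]" u' x] H that ni by auto
  have cb: "loops_cross ?w b x \<longleftrightarrow> x \<in> set u \<and> x \<in> set u'" if "x \<noteq> b" for x
    using loops_cross_split[OF Hb that] loops_cross_rotate[of 1 ?w b x] ni by auto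
  have cv: "loops_cross ?v a x \<longleftrightarrow> x \<in> set u \<and> x \<in> set u'" if "x \<noteq> a" for x
    using loops_cross_split[of a u u' x] Hv that by auto
  have co: "loops_cross ?w x y \<longleftrightarrow> loops_cross ?v x y" if "x \<noteq> b" "y \<noteq> b" for x y
    by (rule loops_cross_cong) (use that in auto)
  have self: "\<not> loops_cross z x x" for z and x :: 'a by (simp add: loops_cross_def)
  have lv: "l x < 4" if "x \<in> set ?v" for x using l that unfolding crossing_labels_def by blast
  have lc: "loops_cross ?v x y \<longleftrightarrow> l x \<noteq> 0 \<and> l y \<noteq> 0 \<and> l x \<noteq> l y" if "x \<in> set ?v" "y \<in> set ?v" for x y
    using l that unfolding crossing_labels_def by blast
  have sv: "x \<in> set ?v" if "x \<in> set ?w" "x \<noteq> b" for x using that by auto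
  let ?l = "l(b := l a)"
  have b_row: "loops_cross ?w b y \<longleftrightarrow> ?l b \<noteq> 0 \<and> ?l y \<noteq> 0 \<and> ?l b \<noteq> ?l y" if y: "y \<in> set ?w" for y
  proof (cases "y = a \<or> y = b")
    case True
    then show ?thesis using cb[of a] ab ni self by auto
  next
    case False
    then have "loops_cross ?w b y \<longleftrightarrow> loops_cross ?v a y" using cb cv by simp
    then show ?thesis using lc[of a y] sv[OF y] False by simp
  qed
  have "loops_cross ?w x y \<longleftrightarrow> ?l x \<noteq> 0 \<and> ?l y \<noteq> 0 \<and> ?l x \<noteq> ?l y" if xy: "x \<in> set ?w" "y \<in> set ?w" for x y
  proof -
    consider "x = b" | "y = b" | "x \<noteq> b" "y \<noteq> b" by blast
    then show ?thesis
    proof cases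
      case 1
      then show ?thesis using b_row[OF xy(2)] by simp
    next
      case 2
      then have "loops_cross ?w x y \<longleftrightarrow> loops_cross ?w b x" using loops_cross_commute[of ?w x b] by simp
      then show ?thesis unfolding b_row[OF xy(1)] using 2 by metis
    next
      case 3
      then show ?thesis using co[of x y] lc[of x y] sv xy by simp
    qed
  qed
  moreover have "?l x < 4" if "x \<in> set ?w" for x using lv[of x] lv[of a] sv[OF that] by simp
  ultimately show "crossing_labels ?w ?l" unfolding crossing_labels_def by blast
qed

text \<open>Labels are pulled back against the direction of the reduction, so that labels of a
  minimal hieroglyph induce labels of every hieroglyph reducing to it.\<close>

lemma reduction_step_crossing_labels:
  assumes "reduction_step w u" "hieroglyph w"
  shows "hieroglyph u \<and> ((\<exists>l. crossing_labels u l) \<longrightarrow> (\<exists>l. crossing_labels w l))"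
  using assms
proof (induction rule: reduction_step.induct)
  case (isolated n w a u)
  then have H: "hieroglyph ([a, a] @ u)" using hieroglyph_rotate[of n w] by simp
  have "crossing_labels w l \<longleftrightarrow> crossing_labels ([a, a] @ u) l" for l
    using crossing_labels_rotate[of n w l] isolated(1) by simp
  then show ?case using hieroglyph_isolated[OF H] crossing_labels_isolated[OF H] by blast
next
  case (parallel n w a b u u')
  then have H: "hieroglyph ([a, b] @ u @ [b, a] @ u')" using hieroglyph_rotate[of n w] by simp
  have "crossing_labels w l \<longleftrightarrow> crossing_labels ([a, b] @ u @ [b, a] @ u') l" for l
    using crossing_labels_rotate[of n w l] parallel(1) by simp
  then show ?case using hieroglyph_parallel(1)[OF H] crossing_labels_parallel[OF H] by blast
qed

section \<open>Positions of loop ends\<close>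

definition first_pos :: "'a list \<Rightarrow> 'a \<Rightarrow> nat" where
  "first_pos w a = Min {i. i < length w \<and> w ! i = a}"

definition last_pos :: "'a list \<Rightarrow> 'a \<Rightarrow> nat" where
  "last_pos w a = Max {i. i < length w \<and> w ! i = a}"

lemma positions:
  assumes H: "hieroglyph w" and a: "a \<in> set w"
  shows "{i. i < length w \<and> w ! i = a} = {first_pos w a, last_pos w a}" "first_pos w a < last_pos w a"
    "last_pos w a < length w" "w ! first_pos w a = a" "w ! last_pos w a = a"
proof -
  let ?I = "{i. i < length w \<and> w ! i = a}"
  have "?I = {i. i < length w \<and> a = w ! i}" by auto
  moreover have "count_list w a = 2" using H a by (simp add: hieroglyph_def)
  ultimately have "card ?I = 2" by (simp only: count_list_eq_length_filter length_filter_conv_card)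
  then obtain x y where xy: "?I = {x, y}" "x \<noteq> y" by (auto simp: card_2_iff)
  have f: "first_pos w a = min x y" and l: "last_pos w a = max x y"
    unfolding first_pos_def last_pos_def xy(1) using xy(2) by auto
  have "{min x y, max x y} = {x, y}" by (auto simp: min_def max_def)
  then show I: "?I = {first_pos w a, last_pos w a}" unfolding f l xy(1) ..
  show "first_pos w a < last_pos w a" unfolding f l using xy(2) by auto
  have "first_pos w a \<in> ?I" "last_pos w a \<in> ?I" unfolding I by auto
  then show "last_pos w a < length w" "w ! first_pos w a = a" "w ! last_pos w a = a" by auto
qed

lemma positions_distinct:
  assumes "hieroglyph w" "a \<in> set w" "b \<in> set w" "a \<noteq> b"
  shows "first_pos w a \<noteq> first_pos w b" "first_pos w a \<noteq> last_pos w b" "last_pos w a \<noteq> first_pos w b" "last_pos w a \<noteq> last_pos w b"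
  using positions(4,5)[OF assms(1,2)] positions(4,5)[OF assms(1,3)] assms(4) by metis+

text \<open>Turns a chain of inequalities between positions into an explicit subword: the list
  \<open>I\<close> is the chain.\<close>

lemma filter_eq_map_nth:
  assumes "sorted_wrt (<) I" "set I = {i. i < length w \<and> P (w ! i)}"
  shows "filter P w = map ((!) w) I"
proof -
  have "filter P w = map ((!) w) (filter (\<lambda>i. P (w ! i)) [0..<length w])"
    by (subst (1) map_nth[of w, symmetric]) (simp add: filter_map o_def)
  moreover have "filter (\<lambda>i. P (w ! i)) [0..<length w] = I"
  proof (rule sorted_distinct_set_unique)
    show "sorted I" "distinct I" using assms(1) by (auto simp: strict_sorted_iff)
    show "set (filter (\<lambda>i. P (w ! i)) [0..<length w]) = set I" unfolding assms(2) by auto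
  qed (simp_all add: sorted_wrt_filter)
  ultimately show ?thesis by simp
qed

text \<open>Crossing becomes the interleaving of two intervals of positions, so that questions about
  chord diagrams turn into linear arithmetic.\<close>

lemma loops_cross_positions:
  assumes H: "hieroglyph w" and a: "a \<in> set w" and b: "b \<in> set w" and ab: "a \<noteq> b"
  defines "p \<equiv> first_pos w" and "q \<equiv> last_pos w"
  shows "loops_cross w a b \<longleftrightarrow> p a < p b \<and> p b < q a \<and> q a < q b \<or> p b < p a \<and> p a < q b \<and> q b < q a"
proof -
  note A = positions[OF H a, folded p_def q_def] and B = positions[OF H b, folded p_def q_def]
  note D = positions_distinct[OF H a b ab, folded p_def q_def]
  have "{i. i < length w \<and> w ! i \<in> {a, b}} = {i. i < length w \<and> w ! i = a} \<union> {i. i < length w \<and> w ! i = b}" by auto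
  then have I: "{i. i < length w \<and> w ! i \<in> {a, b}} = {p a, q a, p b, q b}" unfolding A(1) B(1) by auto
  have F: "filter (\<lambda>x. x \<in> {a, b}) w = map ((!) w) L" if "sorted_wrt (<) L" "set L = {p a, q a, p b, q b}" for L
    by (rule filter_eq_map_nth[OF that(1)]) (simp only: that(2) I)
  have C: "loops_cross w a b \<longleftrightarrow> filter (\<lambda>x. x \<in> {a, b}) w \<in> {[a, b, a, b], [b, a, b, a]}"
    using a b ab by (simp add: loops_cross_iff)
  note V = A(4,5) B(4,5)
  consider "p a < p b" "p b < q a" "q a < q b" | "p a < p b" "p b < q b" "q b < q a" | "p a < q a" "q a < p b" "p b < q b"
    | "p b < p a" "p a < q b" "q b < q a" | "p b < p a" "p a < q a" "q a < q b" | "p b < q b" "q b < p a" "p a < q a"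
    using A(2) B(2) D by linarith
  then show ?thesis
  proof cases
    case 1
    then have "filter (\<lambda>x. x \<in> {a, b}) w = [a, b, a, b]" using F[of "[p a, p b, q a, q b]"] V by auto
    then show ?thesis using C 1 by simp
  next
    case 2
    then have "filter (\<lambda>x. x \<in> {a, b}) w = [a, b, b, a]" using F[of "[p a, p b, q b, q a]"] V by auto
    then show ?thesis using C 2 ab by simp
  next
    case 3
    then have "filter (\<lambda>x. x \<in> {a, b}) w = [a, a, b, b]" using F[of "[p a, q a, p b, q b]"] V by auto
    then show ?thesis using C 3 ab by simp
  next
    case 4
    then have "filter (\<lambda>x. x \<in> {a, b}) w = [b, a, b, a]" using F[of "[p b, p a, q b, q a]"] V by auto
    then show ?thesis using C 4 by simp
  next
    case 5
    then have "filter (\<lambda>x. x \<in> {a, b}) w = [b, a, a, b]" using F[of "[p b, p a, q a, q b]"] V by auto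
    then show ?thesis using C 5 ab by simp
  next
    case 6
    then have "filter (\<lambda>x. x \<in> {a, b}) w = [b, b, a, a]" using F[of "[p b, q b, p a, q a]"] V by auto
    then show ?thesis using C 6 ab by simp
  qed
qed

lemma contains_of_filter:
  assumes "same_hieroglyph (filter (\<lambda>x. x \<in> Z) w) K"
  shows "contains_hieroglyph w K"
proof -
  have "filter (\<lambda>x. x \<notin> set w - Z) w = filter (\<lambda>x. x \<in> Z) w" by (rule filter_cong) auto
  with assms show ?thesis unfolding contains_hieroglyph_def by (intro exI[of _ "set w - Z"]) auto
qed

lemma contains_rotate:
  assumes "contains_hieroglyph (rotate n w) K"
  shows "contains_hieroglyph w K"
proof -
  obtain S where S: "S \<subseteq> set w" "same_hieroglyph (filter (\<lambda>x. x \<notin> S) (rotate n w)) K"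
    using assms by (auto simp: contains_hieroglyph_def)
  obtain m where "filter (\<lambda>x. x \<notin> S) (rotate n w) = rotate m (filter (\<lambda>x. x \<notin> S) w)" using filter_rotate by blast
  with S show ?thesis unfolding contains_hieroglyph_def by (metis same_hieroglyph_rotate)
qed

lemma rotate_to_front:
  assumes "b \<in> set w"
  obtains n u where "rotate n w = b # u"
proof -
  obtain P Q where w: "w = P @ b # Q" using split_list[OF assms] by blast
  then have "rotate (length P) w = b # (Q @ P)" by (simp add: rotate_append)
  then show thesis by (rule that)
qed

lemma first_pos_hd:
  assumes "hieroglyph (b # u)"
  shows "first_pos (b # u) b = 0"
proof -
  have b: "b \<in> set (b # u)" by simp
  have "0 \<in> {i. i < length (b # u) \<and> (b # u) ! i = b}" by simp
  then have "0 = first_pos (b # u) b \<or> 0 = last_pos (b # u) b" unfolding positions(1)[OF assms b] by blast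
  then show ?thesis using positions(2)[OF assms b] by (metis not_less_zero)
qed

text \<open>A chain \<open>I\<close> of the positions of four letters exhibits the subword on these
  letters; the renaming \<open>f\<close> and the rotation by \<open>n\<close> align it with the
  given pattern.\<close>

lemma contains_of_positions:
  fixes K :: "nat list"
  assumes H: "hieroglyph w" and Z: "Z \<subseteq> set w" and I: "sorted_wrt (<) I" "set I = first_pos w ` Z \<union> last_pos w ` Z"
    and f: "inj_on f Z" "rotate n (map (\<lambda>i. f (w ! i)) I) = K"
  shows "contains_hieroglyph w K"
proof (rule contains_of_filter)
  have "{i. i < length w \<and> w ! i \<in> Z} = (\<Union>a\<in>Z. {i. i < length w \<and> w ! i = a})" by auto
  also have "\<dots> = (\<Union>a\<in>Z. {first_pos w a, last_pos w a})"
    using positions(1)[OF H] Z by (intro SUP_cong) auto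
  also have "\<dots> = set I" unfolding I(2) by auto
  finally have F: "filter (\<lambda>x. x \<in> Z) w = map ((!) w) I" using filter_eq_map_nth[OF I(1), of w "\<lambda>x. x \<in> Z"] by simp
  have "set (map ((!) w) I) \<subseteq> Z" unfolding F[symmetric] by auto
  then have "inj_on f (set (map ((!) w) I))" using f(1) by (rule inj_on_subset[rotated])
  then show "same_hieroglyph (filter (\<lambda>x. x \<in> Z) w) K" unfolding F same_hieroglyph_def
    using f(2) by (intro exI[of _ f] exI[of _ n]) (simp add: o_def)
qed

section \<open>Forbidden hieroglyphs\<close>

text \<open>Placing the first end of \<open>b\<close> at position 0 fixes where the circle is cut
  open, and the assumed order of \<open>c\<close> and \<open>d\<close> breaks their symmetry; this
  keeps the number of linear orders small.\<close>

lemma contains_two_edges: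
  assumes H: "hieroglyph w" and mem: "a \<in> set w" "b \<in> set w" "c \<in> set w" "d \<in> set w"
    and dist: "distinct [a, b, c, d]" and hd: "first_pos w b = 0" and wl: "first_pos w c < first_pos w d"
    and cr: "loops_cross w a b" "\<not> loops_cross w a c" "\<not> loops_cross w a d" "\<not> loops_cross w b c" "\<not> loops_cross w b d" "loops_cross w c d"
  shows "contains_hieroglyph w [0,1,0,1,2,3,2,3 :: nat]"
proof -
  define p q where "p = first_pos w" and "q = last_pos w"
  note cross = loops_cross_positions[OF H, folded p_def q_def]
  have d: "a \<noteq> b" "a \<noteq> c" "a \<noteq> d" "b \<noteq> c" "b \<noteq> d" "c \<noteq> d" using dist by auto
  note x = cr[unfolded cross[OF mem(1,2) d(1)] cross[OF mem(1,3) d(2)] cross[OF mem(1,4) d(3)]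
      cross[OF mem(2,3) d(4)] cross[OF mem(2,4) d(5)] cross[OF mem(3,4) d(6)]]
  note pq = positions(2)[OF H mem(1), folded p_def q_def] positions(2)[OF H mem(2), folded p_def q_def]
    positions(2)[OF H mem(3), folded p_def q_def] positions(2)[OF H mem(4), folded p_def q_def]
  note ne = positions_distinct[OF H mem(1,2) d(1), folded p_def q_def] positions_distinct[OF H mem(1,3) d(2), folded p_def q_def]
    positions_distinct[OF H mem(1,4) d(3), folded p_def q_def] positions_distinct[OF H mem(2,3) d(4), folded p_def q_def]
    positions_distinct[OF H mem(2,4) d(5), folded p_def q_def] positions_distinct[OF H mem(3,4) d(6), folded p_def q_def]
  have "p b = 0" using hd by (simp add: p_def)
  then have bf: "p b < p a" "p b < p c" "p b < p d" using ne by simp_all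
  note v = positions(4,5)[OF H mem(1), folded p_def q_def] positions(4,5)[OF H mem(2), folded p_def q_def]
    positions(4,5)[OF H mem(3), folded p_def q_def] positions(4,5)[OF H mem(4), folded p_def q_def]
  note cont = contains_of_positions[OF H, of "{a, b, c, d}", folded p_def q_def]
  have wl: "p c < p d" using wl by (simp add: p_def)
  have x1: "p a < q b \<and> q b < q a" using x(1) bf pq ne(1-4) by linarith
  have x2: "q a < p c \<or> q c < p a \<or> p a < p c \<and> q c < q a \<or> p c < p a \<and> q a < q c" using x(2) bf pq ne(5-8) by linarith
  have x3: "q a < p d \<or> q d < p a \<or> p a < p d \<and> q d < q a \<or> p d < p a \<and> q a < q d" using x(3) bf pq ne(9-12) by linarith
  have x4: "q b < p c \<or> q c < q b" using x(4) bf pq ne(13-16) by linarith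
  have x5: "q b < p d \<or> q d < q b" using x(5) bf pq ne(17-20) by linarith
  have x6: "p c < p d \<and> p d < q c \<and> q c < q d \<or> p d < p c \<and> p c < q d \<and> q d < q c" using x(6) bf pq ne(21-24) by linarith
  \<comment> \<open>The ends of \<open>a\<close> and \<open>b\<close> cut the circle into four arcs,
    the one after \<open>q a\<close> closing up at position 0. Since \<open>c\<close> crosses
    neither loop, both its ends lie in one arc; \<open>d\<close> crosses \<open>c\<close> but
    neither \<open>a\<close> nor \<open>b\<close>, so it lies in the same arc.\<close>
  consider "q a < p c"
    | "q b < p c" "q c < q a"
    | "p a < p c" "q c < q b"
    | "q c < p a"
    using x1 x2 x4 pq by linarith
  then show ?thesis
  proof cases
    case 1
    then have ch: "p b < p a \<and> p a < q b \<and> q b < q a \<and> q a < p c \<and> p c < p d \<and> p d < q c \<and> q c < q d" using x1 x2 x3 x4 x5 x6 bf pq wl by linarith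
    show ?thesis
      by (rule cont[of "[p b, p a, q b, q a, p c, p d, q c, q d]" "\<lambda>z. if z = b then 0 else if z = a then 1 else if z = c then 2 else 3" "0"])
        (use ch v d mem in \<open>auto simp: inj_on_def\<close>)
  next
    case 2
    then have ch: "p b < p a \<and> p a < q b \<and> q b < p c \<and> p c < p d \<and> p d < q c \<and> q c < q d \<and> q d < q a" using x1 x2 x3 x4 x5 x6 bf pq wl by linarith
    show ?thesis
      by (rule cont[of "[p b, p a, q b, p c, p d, q c, q d, q a]" "\<lambda>z. if z = c then 0 else if z = d then 1 else if z = a then 2 else 3" "Suc (Suc (Suc (0)))"])
        (use ch v d mem in \<open>auto simp: inj_on_def\<close>)
  next
    case 3
    then have ch: "p b < p a \<and> p a < p c \<and> p c < p d \<and> p d < q c \<and> q c < q d \<and> q d < q b \<and> q b < q a" using x1 x2 x3 x4 x5 x6 bf pq wl by linarith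
    show ?thesis
      by (rule cont[of "[p b, p a, p c, p d, q c, q d, q b, q a]" "\<lambda>z. if z = c then 0 else if z = d then 1 else if z = b then 2 else 3" "Suc (Suc (0))"])
        (use ch v d mem in \<open>auto simp: inj_on_def\<close>)
  next
    case 4
    then have ch: "p b < p c \<and> p c < p d \<and> p d < q c \<and> q c < q d \<and> q d < p a \<and> p a < q b \<and> q b < q a" using x1 x2 x3 x4 x5 x6 bf pq wl by linarith
    show ?thesis
      by (rule cont[of "[p b, p c, p d, q c, q d, p a, q b, q a]" "\<lambda>z. if z = c then 0 else if z = d then 1 else if z = a then 2 else 3" "Suc (0)"])
        (use ch v d mem in \<open>auto simp: inj_on_def\<close>)
  qed
qed

text \<open>Pairwise crossing loops have all first ends before all last ends, and both in the same
  order. The word is thus a square \<open>X X\<close>, where \<open>X\<close> is one of the six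
  orders of the four letters beginning with \<open>b\<close>.\<close>

lemma contains_K4:
  assumes H: "hieroglyph w" and mem: "a \<in> set w" "b \<in> set w" "c \<in> set w" "d \<in> set w"
    and dist: "distinct [a, b, c, d]" and hd: "first_pos w b = 0"
    and cr: "loops_cross w a b" "loops_cross w a c" "loops_cross w a d" "loops_cross w b c" "loops_cross w b d" "loops_cross w c d"
  shows "contains_hieroglyph w [0,1,2,3,0,1,2,3 :: nat]"
proof -
  define p q where "p = first_pos w" and "q = last_pos w"
  note cross = loops_cross_positions[OF H, folded p_def q_def]
  have d: "a \<noteq> b" "a \<noteq> c" "a \<noteq> d" "b \<noteq> c" "b \<noteq> d" "c \<noteq> d" using dist by auto
  note x = cr[unfolded cross[OF mem(1,2) d(1)] cross[OF mem(1,3) d(2)] cross[OF mem(1,4) d(3)]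
      cross[OF mem(2,3) d(4)] cross[OF mem(2,4) d(5)] cross[OF mem(3,4) d(6)]]
  note pq = positions(2)[OF H mem(1), folded p_def q_def] positions(2)[OF H mem(2), folded p_def q_def]
    positions(2)[OF H mem(3), folded p_def q_def] positions(2)[OF H mem(4), folded p_def q_def]
  note ne = positions_distinct[OF H mem(1,2) d(1), folded p_def q_def] positions_distinct[OF H mem(1,3) d(2), folded p_def q_def]
    positions_distinct[OF H mem(1,4) d(3), folded p_def q_def] positions_distinct[OF H mem(2,3) d(4), folded p_def q_def]
    positions_distinct[OF H mem(2,4) d(5), folded p_def q_def] positions_distinct[OF H mem(3,4) d(6), folded p_def q_def]
  have "p b = 0" using hd by (simp add: p_def)
  then have bf: "p b < p a" "p b < p c" "p b < p d" using ne by simp_all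
  note v = positions(4,5)[OF H mem(1), folded p_def q_def] positions(4,5)[OF H mem(2), folded p_def q_def]
    positions(4,5)[OF H mem(3), folded p_def q_def] positions(4,5)[OF H mem(4), folded p_def q_def]
  note cont = contains_of_positions[OF H, of "{a, b, c, d}", folded p_def q_def]
  have x1: "p a < q b \<and> q b < q a" using x(1) bf pq ne(1-4) by linarith
  have x2: "p a < p c \<and> p c < q a \<and> q a < q c \<or> p c < p a \<and> p a < q c \<and> q c < q a" using x(2) bf pq ne(5-8) by linarith
  have x3: "p a < p d \<and> p d < q a \<and> q a < q d \<or> p d < p a \<and> p a < q d \<and> q d < q a" using x(3) bf pq ne(9-12) by linarith
  have x4: "p c < q b \<and> q b < q c" using x(4) bf pq ne(13-16) by linarith
  have x5: "p d < q b \<and> q b < q d" using x(5) bf pq ne(17-20) by linarith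
  have x6: "p c < p d \<and> p d < q c \<and> q c < q d \<or> p d < p c \<and> p c < q d \<and> q d < q c" using x(6) bf pq ne(21-24) by linarith
  consider "p a < p c" "p c < p d"
    | "p a < p d" "p d < p c"
    | "p c < p a" "p a < p d"
    | "p c < p d" "p d < p a"
    | "p d < p a" "p a < p c"
    | "p d < p c" "p c < p a"
    using ne(9) ne(5) ne(21) by linarith
  then show ?thesis
  proof cases
    case 1
    then have ch: "p b < p a \<and> p a < p c \<and> p c < p d \<and> p d < q b \<and> q b < q a \<and> q a < q c \<and> q c < q d" using x1 x2 x3 x4 x5 x6 bf pq by linarith
    show ?thesis
      by (rule cont[of "[p b, p a, p c, p d, q b, q a, q c, q d]" "\<lambda>z. if z = b then 0 else if z = a then 1 else if z = c then 2 else 3" "0"])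
        (use ch v d mem in \<open>auto simp: inj_on_def\<close>)
  next
    case 2
    then have ch: "p b < p a \<and> p a < p d \<and> p d < p c \<and> p c < q b \<and> q b < q a \<and> q a < q d \<and> q d < q c" using x1 x2 x3 x4 x5 x6 bf pq by linarith
    show ?thesis
      by (rule cont[of "[p b, p a, p d, p c, q b, q a, q d, q c]" "\<lambda>z. if z = b then 0 else if z = a then 1 else if z = d then 2 else 3" "0"])
        (use ch v d mem in \<open>auto simp: inj_on_def\<close>)
  next
    case 3
    then have ch: "p b < p c \<and> p c < p a \<and> p a < p d \<and> p d < q b \<and> q b < q c \<and> q c < q a \<and> q a < q d" using x1 x2 x3 x4 x5 x6 bf pq by linarith
    show ?thesis
      by (rule cont[of "[p b, p c, p a, p d, q b, q c, q a, q d]" "\<lambda>z. if z = b then 0 else if z = c then 1 else if z = a then 2 else 3" "0"])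
        (use ch v d mem in \<open>auto simp: inj_on_def\<close>)
  next
    case 4
    then have ch: "p b < p c \<and> p c < p d \<and> p d < p a \<and> p a < q b \<and> q b < q c \<and> q c < q d \<and> q d < q a" using x1 x2 x3 x4 x5 x6 bf pq by linarith
    show ?thesis
      by (rule cont[of "[p b, p c, p d, p a, q b, q c, q d, q a]" "\<lambda>z. if z = b then 0 else if z = c then 1 else if z = d then 2 else 3" "0"])
        (use ch v d mem in \<open>auto simp: inj_on_def\<close>)
  next
    case 5
    then have ch: "p b < p d \<and> p d < p a \<and> p a < p c \<and> p c < q b \<and> q b < q d \<and> q d < q a \<and> q a < q c" using x1 x2 x3 x4 x5 x6 bf pq by linarith
    show ?thesis
      by (rule cont[of "[p b, p d, p a, p c, q b, q d, q a, q c]" "\<lambda>z. if z = b then 0 else if z = d then 1 else if z = a then 2 else 3" "0"])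
        (use ch v d mem in \<open>auto simp: inj_on_def\<close>)
  next
    case 6
    then have ch: "p b < p d \<and> p d < p c \<and> p c < p a \<and> p a < q b \<and> q b < q d \<and> q d < q c \<and> q c < q a" using x1 x2 x3 x4 x5 x6 bf pq by linarith
    show ?thesis
      by (rule cont[of "[p b, p d, p c, p a, q b, q d, q c, q a]" "\<lambda>z. if z = b then 0 else if z = d then 1 else if z = c then 2 else 3" "0"])
        (use ch v d mem in \<open>auto simp: inj_on_def\<close>)
  qed
qed

text \<open>The graph is the path \<open>a\<close>, \<open>b\<close>, \<open>d\<close>,
  \<open>c\<close>. With the first end of \<open>b\<close> at position 0, four linear orders remain;
  they all are rotations and renamings of one cyclic word.\<close>

lemma contains_path:
  assumes H: "hieroglyph w" and mem: "a \<in> set w" "b \<in> set w" "c \<in> set w" "d \<in> set w"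
    and dist: "distinct [a, b, c, d]" and hd: "first_pos w b = 0"
    and cr: "loops_cross w a b" "\<not> loops_cross w a c" "\<not> loops_cross w a d" "\<not> loops_cross w b c" "loops_cross w b d" "loops_cross w c d"
  shows "contains_hieroglyph w [0,1,0,2,3,2,1,3 :: nat]"
proof -
  define p q where "p = first_pos w" and "q = last_pos w"
  note cross = loops_cross_positions[OF H, folded p_def q_def]
  have d: "a \<noteq> b" "a \<noteq> c" "a \<noteq> d" "b \<noteq> c" "b \<noteq> d" "c \<noteq> d" using dist by auto
  note x = cr[unfolded cross[OF mem(1,2) d(1)] cross[OF mem(1,3) d(2)] cross[OF mem(1,4) d(3)]
      cross[OF mem(2,3) d(4)] cross[OF mem(2,4) d(5)] cross[OF mem(3,4) d(6)]]
  note pq = positions(2)[OF H mem(1), folded p_def q_def] positions(2)[OF H mem(2), folded p_def q_def]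
    positions(2)[OF H mem(3), folded p_def q_def] positions(2)[OF H mem(4), folded p_def q_def]
  note ne = positions_distinct[OF H mem(1,2) d(1), folded p_def q_def] positions_distinct[OF H mem(1,3) d(2), folded p_def q_def]
    positions_distinct[OF H mem(1,4) d(3), folded p_def q_def] positions_distinct[OF H mem(2,3) d(4), folded p_def q_def]
    positions_distinct[OF H mem(2,4) d(5), folded p_def q_def] positions_distinct[OF H mem(3,4) d(6), folded p_def q_def]
  have "p b = 0" using hd by (simp add: p_def)
  then have bf: "p b < p a" "p b < p c" "p b < p d" using ne by simp_all
  note v = positions(4,5)[OF H mem(1), folded p_def q_def] positions(4,5)[OF H mem(2), folded p_def q_def]
    positions(4,5)[OF H mem(3), folded p_def q_def] positions(4,5)[OF H mem(4), folded p_def q_def]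
  note cont = contains_of_positions[OF H, of "{a, b, c, d}", folded p_def q_def]
  have x1: "p a < q b \<and> q b < q a" using x(1) bf pq ne(1-4) by linarith
  have x2: "q a < p c \<or> q c < p a \<or> p a < p c \<and> q c < q a \<or> p c < p a \<and> q a < q c" using x(2) bf pq ne(5-8) by linarith
  have x3: "q a < p d \<or> q d < p a \<or> p a < p d \<and> q d < q a \<or> p d < p a \<and> q a < q d" using x(3) bf pq ne(9-12) by linarith
  have x4: "q b < p c \<or> q c < q b" using x(4) bf pq ne(13-16) by linarith
  have x5: "p d < q b \<and> q b < q d" using x(5) bf pq ne(17-20) by linarith
  have x6: "p c < p d \<and> p d < q c \<and> q c < q d \<or> p d < p c \<and> p c < q d \<and> q d < q c" using x(6) bf pq ne(21-24) by linarith
  consider "p b < p a" "p a < p c" "p c < p d" "p d < q c" "q c < q b" "q b < q d" "q d < q a"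
    | "p b < p a" "p a < p d" "p d < q b" "q b < p c" "p c < q d" "q d < q c" "q c < q a"
    | "p b < p c" "p c < p d" "p d < q c" "q c < p a" "p a < q b" "q b < q a" "q a < q d"
    | "p b < p d" "p d < p a" "p a < q b" "q b < q a" "q a < p c" "p c < q d" "q d < q c"
    using x1 x2 x3 x4 x5 x6 bf pq by linarith
  then show ?thesis
  proof cases
    case 1
    show ?thesis
      by (rule cont[of "[p b, p a, p c, p d, q c, q b, q d, q a]" "\<lambda>z. if z = a then 0 else if z = b then 1 else if z = c then 2 else 3" "Suc (Suc (Suc (Suc (Suc (Suc (Suc (0)))))))"])
        (use 1 v d mem in \<open>auto simp: inj_on_def\<close>)
  next
    case 2
    show ?thesis
      by (rule cont[of "[p b, p a, p d, q b, p c, q d, q c, q a]" "\<lambda>z. if z = c then 0 else if z = d then 1 else if z = a then 2 else 3" "Suc (Suc (Suc (Suc (0))))"])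
        (use 2 v d mem in \<open>auto simp: inj_on_def\<close>)
  next
    case 3
    show ?thesis
      by (rule cont[of "[p b, p c, p d, q c, p a, q b, q a, q d]" "\<lambda>z. if z = c then 0 else if z = d then 1 else if z = a then 2 else 3" "Suc (0)"])
        (use 3 v d mem in \<open>auto simp: inj_on_def\<close>)
  next
    case 4
    show ?thesis
      by (rule cont[of "[p b, p d, p a, q b, q a, p c, q d, q c]" "\<lambda>z. if z = a then 0 else if z = b then 1 else if z = c then 2 else 3" "Suc (Suc (0))"])
        (use 4 v d mem in \<open>auto simp: inj_on_def\<close>)
  qed
qed

text \<open>The graph is the triangle \<open>a\<close>, \<open>b\<close>, \<open>c\<close> with
  \<open>d\<close> attached to \<open>b\<close>. Cutting at an end of \<open>b\<close> leaves four
  linear orders, which are paired by exchanging \<open>a\<close> and \<open>c\<close>; all give the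
  same cyclic word.\<close>

lemma contains_paw:
  assumes H: "hieroglyph w" and mem: "a \<in> set w" "b \<in> set w" "c \<in> set w" "d \<in> set w"
    and dist: "distinct [a, b, c, d]" and hd: "first_pos w b = 0"
    and cr: "loops_cross w a b" "loops_cross w a c" "\<not> loops_cross w a d" "loops_cross w b c" "loops_cross w b d" "\<not> loops_cross w c d"
  shows "contains_hieroglyph w [0,1,2,0,3,1,3,2 :: nat]"
proof -
  define p q where "p = first_pos w" and "q = last_pos w"
  note cross = loops_cross_positions[OF H, folded p_def q_def]
  have d: "a \<noteq> b" "a \<noteq> c" "a \<noteq> d" "b \<noteq> c" "b \<noteq> d" "c \<noteq> d" using dist by auto
  note x = cr[unfolded cross[OF mem(1,2) d(1)] cross[OF mem(1,3) d(2)] cross[OF mem(1,4) d(3)]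
      cross[OF mem(2,3) d(4)] cross[OF mem(2,4) d(5)] cross[OF mem(3,4) d(6)]]
  note pq = positions(2)[OF H mem(1), folded p_def q_def] positions(2)[OF H mem(2), folded p_def q_def]
    positions(2)[OF H mem(3), folded p_def q_def] positions(2)[OF H mem(4), folded p_def q_def]
  note ne = positions_distinct[OF H mem(1,2) d(1), folded p_def q_def] positions_distinct[OF H mem(1,3) d(2), folded p_def q_def]
    positions_distinct[OF H mem(1,4) d(3), folded p_def q_def] positions_distinct[OF H mem(2,3) d(4), folded p_def q_def]
    positions_distinct[OF H mem(2,4) d(5), folded p_def q_def] positions_distinct[OF H mem(3,4) d(6), folded p_def q_def]
  have "p b = 0" using hd by (simp add: p_def)
  then have bf: "p b < p a" "p b < p c" "p b < p d" using ne by simp_all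
  note v = positions(4,5)[OF H mem(1), folded p_def q_def] positions(4,5)[OF H mem(2), folded p_def q_def]
    positions(4,5)[OF H mem(3), folded p_def q_def] positions(4,5)[OF H mem(4), folded p_def q_def]
  note cont = contains_of_positions[OF H, of "{a, b, c, d}", folded p_def q_def]
  have x1: "p a < q b \<and> q b < q a" using x(1) bf pq ne(1-4) by linarith
  have x2: "p a < p c \<and> p c < q a \<and> q a < q c \<or> p c < p a \<and> p a < q c \<and> q c < q a" using x(2) bf pq ne(5-8) by linarith
  have x3: "q a < p d \<or> q d < p a \<or> p a < p d \<and> q d < q a \<or> p d < p a \<and> q a < q d" using x(3) bf pq ne(9-12) by linarith
  have x4: "p c < q b \<and> q b < q c" using x(4) bf pq ne(13-16) by linarith
  have x5: "p d < q b \<and> q b < q d" using x(5) bf pq ne(17-20) by linarith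
  have x6: "q c < p d \<or> q d < p c \<or> p c < p d \<and> q d < q c \<or> p d < p c \<and> q c < q d" using x(6) bf pq ne(21-24) by linarith
  consider "p b < p a" "p a < p c" "p c < p d" "p d < q b" "q b < q d" "q d < q a" "q a < q c"
    | "p b < p c" "p c < p a" "p a < p d" "p d < q b" "q b < q d" "q d < q c" "q c < q a"
    | "p b < p d" "p d < p a" "p a < p c" "p c < q b" "q b < q a" "q a < q c" "q c < q d"
    | "p b < p d" "p d < p c" "p c < p a" "p a < q b" "q b < q c" "q c < q a" "q a < q d"
    using x1 x2 x3 x4 x5 x6 bf pq by linarith
  then show ?thesis
  proof cases
    case 1
    show ?thesis
      by (rule cont[of "[p b, p a, p c, p d, q b, q d, q a, q c]" "\<lambda>z. if z = c then 0 else if z = b then 1 else if z = a then 2 else 3" "Suc (Suc (Suc (Suc (Suc (Suc (Suc (0)))))))"])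
        (use 1 v d mem in \<open>auto simp: inj_on_def\<close>)
  next
    case 2
    show ?thesis
      by (rule cont[of "[p b, p c, p a, p d, q b, q d, q c, q a]" "\<lambda>z. if z = a then 0 else if z = b then 1 else if z = c then 2 else 3" "Suc (Suc (Suc (Suc (Suc (Suc (Suc (0)))))))"])
        (use 2 v d mem in \<open>auto simp: inj_on_def\<close>)
  next
    case 3
    show ?thesis
      by (rule cont[of "[p b, p d, p a, p c, q b, q a, q c, q d]" "\<lambda>z. if z = c then 0 else if z = b then 1 else if z = a then 2 else 3" "Suc (Suc (Suc (0)))"])
        (use 3 v d mem in \<open>auto simp: inj_on_def\<close>)
  next
    case 4
    show ?thesis
      by (rule cont[of "[p b, p d, p c, p a, q b, q c, q a, q d]" "\<lambda>z. if z = a then 0 else if z = b then 1 else if z = c then 2 else 3" "Suc (Suc (Suc (0)))"])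
        (use 4 v d mem in \<open>auto simp: inj_on_def\<close>)
  qed
qed

lemma loops_cross_imp_mem: "loops_cross w a b \<Longrightarrow> a \<in> set w \<and> b \<in> set w \<and> a \<noteq> b"
  by (simp add: loops_cross_def)

lemma hieroglyph_rotate_to_front:
  assumes "hieroglyph w" "b \<in> set w"
  obtains n where "hieroglyph (rotate n w)" "first_pos (rotate n w) b = 0"
proof -
  obtain n u where n: "rotate n w = b # u" using rotate_to_front[OF assms(2)] .
  have "hieroglyph (rotate n w)" using assms(1) by (simp add: hieroglyph_rotate)
  moreover from this have "first_pos (rotate n w) b = 0" unfolding n by (rule first_pos_hd)
  ultimately show thesis by (rule that)
qed

text \<open>Each of these four graphs determines its hieroglyph. A rotation supplies the
  normalization that \<open>b\<close> starts at position 0, and for two disjoint edges a swap of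
  \<open>c\<close> and \<open>d\<close> supplies the order of their first ends.\<close>

lemma induced_pattern_contained:
  assumes H: "hieroglyph w" and mem: "a \<in> set w" "b \<in> set w" "c \<in> set w" "d \<in> set w" and dist: "distinct [a, b, c, d]"
  shows "loops_cross w a b \<Longrightarrow> \<not> loops_cross w a c \<Longrightarrow> \<not> loops_cross w a d \<Longrightarrow> \<not> loops_cross w b c \<Longrightarrow>
      \<not> loops_cross w b d \<Longrightarrow> loops_cross w c d \<Longrightarrow> contains_hieroglyph w [0,1,0,1,2,3,2,3 :: nat]"
    and "loops_cross w a b \<Longrightarrow> loops_cross w a c \<Longrightarrow> loops_cross w a d \<Longrightarrow> loops_cross w b c \<Longrightarrow>
      loops_cross w b d \<Longrightarrow> loops_cross w c d \<Longrightarrow> contains_hieroglyph w [0,1,2,3,0,1,2,3 :: nat]"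
    and "loops_cross w a b \<Longrightarrow> \<not> loops_cross w a c \<Longrightarrow> \<not> loops_cross w a d \<Longrightarrow> \<not> loops_cross w b c \<Longrightarrow>
      loops_cross w b d \<Longrightarrow> loops_cross w c d \<Longrightarrow> contains_hieroglyph w [0,1,0,2,3,2,1,3 :: nat]"
    and "loops_cross w a b \<Longrightarrow> loops_cross w a c \<Longrightarrow> \<not> loops_cross w a d \<Longrightarrow> loops_cross w b c \<Longrightarrow>
      loops_cross w b d \<Longrightarrow> \<not> loops_cross w c d \<Longrightarrow> contains_hieroglyph w [0,1,2,0,3,1,3,2 :: nat]"
proof -
  obtain n where n: "hieroglyph (rotate n w)" "first_pos (rotate n w) b = 0"
    by (rule hieroglyph_rotate_to_front[OF H mem(2)])
  let ?v = "rotate n w"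
  have m: "a \<in> set ?v" "b \<in> set ?v" "c \<in> set ?v" "d \<in> set ?v" using mem by simp_all
  note cr = loops_cross_rotate[of n w]
  have dist': "distinct [a, b, d, c]" using dist by auto
  show "contains_hieroglyph w [0,1,0,1,2,3,2,3 :: nat]" if "loops_cross w a b" "\<not> loops_cross w a c" "\<not> loops_cross w a d"
    "\<not> loops_cross w b c" "\<not> loops_cross w b d" "loops_cross w c d"
  proof (rule contains_rotate[of n])
    have "first_pos ?v c \<noteq> first_pos ?v d" using positions_distinct(1)[OF n(1) m(3,4)] dist by simp
    then consider "first_pos ?v c < first_pos ?v d" | "first_pos ?v d < first_pos ?v c" by linarith
    then show "contains_hieroglyph ?v [0,1,0,1,2,3,2,3 :: nat]"
    proof cases
      case 1
      then show ?thesis using contains_two_edges[OF n(1) m dist n(2)] that cr by simp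
    next
      case 2
      then show ?thesis using contains_two_edges[OF n(1) m(1,2,4,3) dist' n(2)] that cr loops_cross_commute[of w c d] by simp
    qed
  qed
  show "contains_hieroglyph w [0,1,2,3,0,1,2,3 :: nat]" if "loops_cross w a b" "loops_cross w a c" "loops_cross w a d"
    "loops_cross w b c" "loops_cross w b d" "loops_cross w c d"
    by (rule contains_rotate[of n], rule contains_K4[OF n(1) m dist n(2)]) (simp_all add: that cr)
  show "contains_hieroglyph w [0,1,0,2,3,2,1,3 :: nat]" if "loops_cross w a b" "\<not> loops_cross w a c" "\<not> loops_cross w a d"
    "\<not> loops_cross w b c" "loops_cross w b d" "loops_cross w c d"
    by (rule contains_rotate[of n], rule contains_path[OF n(1) m dist n(2)]) (simp_all add: that cr)
  show "contains_hieroglyph w [0,1,2,0,3,1,3,2 :: nat]" if "loops_cross w a b" "loops_cross w a c" "\<not> loops_cross w a d"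
    "loops_cross w b c" "loops_cross w b d" "\<not> loops_cross w c d"
    by (rule contains_rotate[of n], rule contains_paw[OF n(1) m dist n(2)]) (simp_all add: that cr)
qed

section \<open>Labels from excluded patterns\<close>

lemma crossing_labels_exist:
  assumes H: "hieroglyph w"
    and B: "\<And>K. K \<in> {[0,1,0,1,2,3,2,3], [0,1,2,3,0,1,2,3], [0,1,0,2,3,2,1,3], [0,1,2,0,3,1,3,2 :: nat]} \<Longrightarrow>
      \<not> contains_hieroglyph w K"
  shows "\<exists>l. crossing_labels w l"
proof -
  define E where "E = loops_cross w"
  define W where "W = {x. \<exists>y. E x y}"
  have sym: "E x y \<longleftrightarrow> E y x" for x y unfolding E_def by (rule loops_cross_commute)
  have mem: "x \<in> set w \<and> y \<in> set w \<and> x \<noteq> y" if "E x y" for x y using that loops_cross_imp_mem unfolding E_def by fast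
  have Ww: "x \<in> set w" if "x \<in> W" for x using that mem unfolding W_def by blast
  \<comment> \<open>Not crossing is an equivalence relation on the non-isolated loops
    \<open>W\<close>; its classes are the future parts. A violation of transitivity produces a
    forbidden pattern together with a loop \<open>t\<close> crossing \<open>y\<close>.\<close>
  have trans: "\<not> E x z" if W: "x \<in> W" "y \<in> W" "z \<in> W" and xy: "\<not> E x y" and yz: "\<not> E y z" for x y z
  proof
    assume xz: "E x z"
    obtain t where t: "E y t" using W(2) unfolding W_def by blast
    have dist: "distinct [x, z, y, t]" using xz xy yz t mem[OF xz] mem[OF t] sym by auto
    have m: "x \<in> set w" "z \<in> set w" "y \<in> set w" "t \<in> set w" using Ww W mem[OF t] by blast+
    \<comment> \<open>On the edges \<open>x z\<close> and \<open>y t\<close> the two possible edges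
      \<open>x t\<close> and \<open>z t\<close> decide the pattern: a triangle with pendant edge, a
      path in two ways, or two disjoint edges.\<close>
    consider "E x t" "E z t" | "E x t" "\<not> E z t" | "\<not> E x t" "E z t" | "\<not> E x t" "\<not> E z t" by blast
    then show False
    proof cases
      case 1
      have "contains_hieroglyph w [0,1,2,0,3,1,3,2 :: nat]"
        by (rule induced_pattern_contained(4)[OF H m(1,4,2,3)]) (use dist 1 xz xy yz t sym in \<open>auto simp: E_def\<close>)
      then show False using B by blast
    next
      case 2
      have "contains_hieroglyph w [0,1,0,2,3,2,1,3 :: nat]"
        by (rule induced_pattern_contained(3)[OF H m(2,1,3,4)]) (use dist 2 xz xy yz t sym in \<open>auto simp: E_def\<close>)
      then show False using B by blast
    next
      case 3
      have "contains_hieroglyph w [0,1,0,2,3,2,1,3 :: nat]"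
        by (rule induced_pattern_contained(3)[OF H m(1,2,3,4)]) (use dist 3 xz xy yz t sym in \<open>auto simp: E_def\<close>)
      then show False using B by blast
    next
      case 4
      have "contains_hieroglyph w [0,1,0,1,2,3,2,3 :: nat]"
        by (rule induced_pattern_contained(1)[OF H m(1,2,3,4)]) (use dist 4 xz xy yz t sym in \<open>auto simp: E_def\<close>)
      then show False using B by blast
    qed
  qed
  have noK4: False if "E a b" "E a c" "E a d" "E b c" "E b d" "E c d" for a b c d
  proof -
    have "distinct [a, b, c, d]" using that mem by auto
    then have "contains_hieroglyph w [0,1,2,3,0,1,2,3 :: nat]"
      using induced_pattern_contained(2)[OF H, of a b c d] that mem unfolding E_def by blast
    then show False using B by blast
  qed
  show ?thesis
  proof (cases "W = {}")
    case True
    then have "crossing_labels w (\<lambda>_. 0)" unfolding crossing_labels_def W_def E_def by auto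
    then show ?thesis by blast
  next
    case False
    then obtain x1 x2 where x12: "E x1 x2" unfolding W_def by blast
    then have W12: "x1 \<in> W" "x2 \<in> W" unfolding W_def using sym by blast+
    \<comment> \<open>The crossing loops \<open>x1\<close> and \<open>x2\<close> represent two
      classes. Everything that crosses both is put into a third class, which has no crossing inside
      because such a pair would complete four pairwise crossing loops.\<close>
    define l :: "'a \<Rightarrow> nat" where "l x = (if x \<notin> W then 0 else if \<not> E x1 x then 1 else if \<not> E x2 x then 2 else 3)" for x
    have "E a b \<longleftrightarrow> l a \<noteq> 0 \<and> l b \<noteq> 0 \<and> l a \<noteq> l b" for a b
    proof (cases "a \<in> W \<and> b \<in> W")
      case True
      then have ab: "a \<in> W" "b \<in> W" by auto
      have same: "E y a \<longleftrightarrow> E y b" if "\<not> E a b" "y \<in> W" for y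
        using trans[of y a b] trans[of y b a] that ab sym by blast
      have 1: "\<not> E a b" if "\<not> E y a" "\<not> E y b" "y \<in> W" for y using trans[of a y b] that ab sym by blast
      have 3: "\<not> E a b" if "E x1 a" "E x2 a" "E x1 b" "E x2 b" using noK4[of x1 x2 a b] that x12 by blast
      have la: "l a = (if \<not> E x1 a then 1 else if \<not> E x2 a then 2 else 3)"
        and lb: "l b = (if \<not> E x1 b then 1 else if \<not> E x2 b then 2 else 3)" using ab by (simp_all add: l_def)
      show ?thesis
      proof (cases "E a b")
        case True
        then have "\<not> (\<not> E x1 a \<and> \<not> E x1 b)" "\<not> (\<not> E x2 a \<and> \<not> E x2 b)" "\<not> (E x1 a \<and> E x2 a \<and> E x1 b \<and> E x2 b)"
          using 1 3 W12 by blast+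
        then show ?thesis using True unfolding la lb
          by (cases "E x1 a"; cases "E x1 b"; cases "E x2 a"; cases "E x2 b") simp_all
      next
        case False
        then have "E x1 a \<longleftrightarrow> E x1 b" "E x2 a \<longleftrightarrow> E x2 b" using same W12 by blast+
        then show ?thesis using False unfolding la lb by simp
      qed
    next
      case False
      then have "\<not> E a b" unfolding W_def using sym by blast
      then show ?thesis using False by (auto simp: l_def)
    qed
    then have "crossing_labels w l" unfolding crossing_labels_def E_def by (simp add: l_def)
    then show ?thesis by blast
  qed
qed

section \<open>Innermost isolated loops\<close>

text \<open>Descent to an innermost loop: since the first letter \<open>b\<close> crosses nothing,
  the part \<open>U\<close> between its two occurrences is again a hieroglyph without crossings, and
  it is shorter.\<close>

lemma noncrossing_adjacent:
  assumes "hieroglyph X" "X \<noteq> []" "\<And>x y. \<not> loops_cross X x y"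
  shows "\<exists>P b Q. X = P @ [b, b] @ Q"
  using assms
proof (induction "length X" arbitrary: X rule: less_induct)
  case less
  obtain b X' where X: "X = b # X'" using less.prems(2) by (cases X) auto
  have "count_list X b = 2" using less.prems(1) X by (simp add: hieroglyph_def)
  then have "b \<in> set X'" unfolding X by (auto intro: ccontr simp: count_notin)
  then obtain U V where X': "X' = U @ b # V" using split_list by metis
  have H: "hieroglyph (b # U @ b # V)" using less.prems(1) X X' by simp
  have "count_list (b # U @ b # V) b = 2" using H by (simp add: hieroglyph_def)
  then have b: "b \<notin> set U" "b \<notin> set V" by (auto simp: count_list_0_iff)
  have disj: "x \<notin> set V" if "x \<in> set U" for x
    using loops_cross_split[OF H, of x] less.prems(3)[of b x] that b X X' by auto
  show ?case
  proof (cases "U = []")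
    case True
    then show ?thesis using X X' by (intro exI[of _ "[]"]) auto
  next
    case False
    have "hieroglyph U" unfolding hieroglyph_def
    proof
      fix x assume x: "x \<in> set U"
      then have "count_list (b # U @ b # V) x = 2" using H unfolding hieroglyph_def by simp
      then show "count_list U x = 2" using x b disj[OF x] by (auto simp: count_notin split: if_splits)
    qed
    moreover have "\<not> loops_cross U x y" for x y
    proof
      assume c: "loops_cross U x y"
      then have xy: "x \<in> set U" "y \<in> set U" by (auto simp: loops_cross_def)
      have "loops_cross U x y \<longleftrightarrow> loops_cross X x y"
        by (rule loops_cross_cong) (use xy b disj in \<open>auto simp: X X' filter_empty_conv\<close>)
      then show False using c less.prems(3) by blast
    qed
    ultimately obtain P c Q where "U = P @ [c, c] @ Q"
      using less.hyps[of U] False X X' by auto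
    then have "X = (b # P) @ [c, c] @ (Q @ b # V)" using X X' by simp
    then show ?thesis by blast
  qed
qed

text \<open>The isolated letter \<open>a\<close> cuts the word into two hieroglyphs \<open>X\<close>
  and \<open>Y\<close> whose loops do not cross each other. One of them has no crossings at all and
  hence contains an innermost loop, unless it is empty and the two ends of \<open>a\<close> are
  adjacent. The adjacent letter \<open>b\<close> may thus differ from \<open>a\<close>.\<close>

lemma isolated_letter_reduces:
  assumes H: "hieroglyph w" and l: "crossing_labels w l" and a: "a \<in> set w" "\<And>y. \<not> loops_cross w a y"
  shows "\<exists>n b u. rotate n w = [b, b] @ u"
proof -
  have l2: "loops_cross w x y \<longleftrightarrow> l x \<noteq> 0 \<and> l y \<noteq> 0 \<and> l x \<noteq> l y" if "x \<in> set w" "y \<in> set w" for x y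
    using l that unfolding crossing_labels_def by blast
  obtain n u0 where n: "rotate n w = a # u0" using rotate_to_front[OF a(1)] .
  have "hieroglyph (a # u0)" using H hieroglyph_rotate[of n w] n by simp
  then have "count_list (a # u0) a = 2" by (simp add: hieroglyph_def)
  then have "a \<in> set u0" by (auto intro: ccontr simp: count_notin)
  then obtain X Y where u0: "u0 = X @ a # Y" using split_list by metis
  have v: "rotate n w = a # X @ a # Y" using n u0 by simp
  have Hv: "hieroglyph (a # X @ a # Y)" using H hieroglyph_rotate[of n w] v by simp
  have cr: "loops_cross (a # X @ a # Y) x y \<longleftrightarrow> loops_cross w x y" for x y using loops_cross_rotate[of n w x y] v by simp
  have sw: "set w = insert a (set X \<union> set Y)" using v by (metis set_rotate set_append list.set(2) Un_insert_right insert_absorb2 Un_insert_left insertI1)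
  have "count_list (a # X @ a # Y) a = 2" using Hv by (simp add: hieroglyph_def)
  then have aXY: "a \<notin> set X" "a \<notin> set Y" by (auto simp: count_list_0_iff)
  have disj: "x \<notin> set Y" if "x \<in> set X" for x
    using loops_cross_split[OF Hv, of x] a(2)[of x] cr that aXY by auto
  have part: "hieroglyph X" "hieroglyph Y"
  proof -
    have "count_list X x = 2" if "x \<in> set X" for x
    proof -
      have "count_list (a # X @ a # Y) x = 2" using Hv that unfolding hieroglyph_def by simp
      then show ?thesis using that aXY disj[OF that] by (auto simp: count_notin split: if_splits)
    qed
    moreover have "count_list Y x = 2" if "x \<in> set Y" for x
    proof -
      have "x \<notin> set X" using disj that by blast
      moreover have "count_list (a # X @ a # Y) x = 2" using Hv that unfolding hieroglyph_def by simp
      ultimately show ?thesis using that aXY by (auto simp: count_notin split: if_splits)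
    qed
    ultimately show "hieroglyph X" "hieroglyph Y" unfolding hieroglyph_def by blast+
  qed
  have crX: "loops_cross X x y \<longleftrightarrow> loops_cross w x y" if "x \<in> set X" "y \<in> set X" for x y
    unfolding cr[symmetric] by (rule loops_cross_cong) (use that aXY disj in \<open>auto simp: filter_empty_conv\<close>)
  have crY: "loops_cross Y x y \<longleftrightarrow> loops_cross w x y" if "x \<in> set Y" "y \<in> set Y" for x y
    unfolding cr[symmetric] by (rule loops_cross_cong) (use that aXY disj in \<open>auto simp: filter_empty_conv\<close>)
  have crXY: "\<not> loops_cross w x y" if x: "x \<in> set X" and y: "y \<in> set Y" for x y
  proof
    assume "loops_cross w x y"
    then have "filter (\<lambda>z. z \<in> {x, y}) (a # X @ a # Y) \<in> {[x, y, x, y], [y, x, y, x]}"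
      unfolding cr[symmetric] by (simp add: loops_cross_iff)
    moreover have "filter (\<lambda>z. z \<in> {x, y}) (a # X @ a # Y) = filter (\<lambda>z. z \<in> {x, y}) X @ filter (\<lambda>z. z \<in> {x, y}) Y"
      using x y aXY by auto
    moreover have "filter (\<lambda>z. z \<in> {x, y}) X = replicate (count_list X x) x"
    proof -
      have "y \<notin> set X" using disj y by blast
      then show ?thesis by (induction X) auto
    qed
    moreover have "filter (\<lambda>z. z \<in> {x, y}) Y = replicate (count_list Y y) y"
    proof -
      have "x \<notin> set Y" using disj x by blast
      then show ?thesis by (induction Y) auto
    qed
    moreover have "count_list X x = 2" "count_list Y y = 2" "x \<noteq> y"
      using part x y disj unfolding hieroglyph_def by blast+
    ultimately show False by (simp add: numeral_eq_Suc)
  qed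
  \<comment> \<open>With crossings on both sides, a loop \<open>y\<close> would have the same
    nonzero label as both members \<open>x\<close>, \<open>x'\<close> of a crossing pair on the
    other side.\<close>
  have "(\<forall>x y. \<not> loops_cross X x y) \<or> (\<forall>x y. \<not> loops_cross Y x y)"
  proof (rule ccontr)
    assume "\<not> ?thesis"
    then obtain x x' y y' where c: "loops_cross X x x'" "loops_cross Y y y'" by blast
    then have m: "x \<in> set X" "x' \<in> set X" "y \<in> set Y" "y' \<in> set Y" by (auto simp: loops_cross_def)
    then have mw: "x \<in> set w" "x' \<in> set w" "y \<in> set w" "y' \<in> set w" using sw by auto
    have "loops_cross w x x'" "loops_cross w y y'" using c crX crY m by blast+
    moreover have "\<not> loops_cross w x y" "\<not> loops_cross w x' y" using crXY m by blast+
    ultimately show False using l2 mw by metis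
  qed
  then show ?thesis
  proof
    assume nc: "\<forall>x y. \<not> loops_cross X x y"
    show ?thesis
    proof (cases "X = []")
      case True
      then have "rotate n w = [a, a] @ Y" using v by simp
      then show ?thesis by blast
    next
      case False
      then obtain P b Q where "X = P @ [b, b] @ Q" using noncrossing_adjacent[OF part(1)] nc by blast
      then have "rotate n w = (a # P) @ ([b, b] @ Q @ a # Y)" using v by simp
      then have "rotate (length (a # P)) (rotate n w) = ([b, b] @ Q @ a # Y) @ (a # P)" by (simp only: rotate_append)
      then have "rotate (length (a # P) + n) w = [b, b] @ (Q @ a # Y @ a # P)" by (simp add: rotate_rotate)
      then show ?thesis by blast
    qed
  next
    assume nc: "\<forall>x y. \<not> loops_cross Y x y"
    show ?thesis
    proof (cases "Y = []")
      case True
      then have "rotate n w = (a # X) @ [a]" using v by simp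
      then have "rotate (length (a # X)) (rotate n w) = [a] @ (a # X)" by (simp only: rotate_append)
      then have "rotate (length (a # X) + n) w = [a, a] @ X" by (simp add: rotate_rotate)
      then show ?thesis by blast
    next
      case False
      then obtain P b Q where "Y = P @ [b, b] @ Q" using noncrossing_adjacent[OF part(2)] nc by blast
      then have "rotate n w = (a # X @ a # P) @ ([b, b] @ Q)" using v by simp
      then have "rotate (length (a # X @ a # P)) (rotate n w) = ([b, b] @ Q) @ (a # X @ a # P)" by (simp only: rotate_append)
      then have "rotate (length (a # X @ a # P) + n) w = [b, b] @ (Q @ a # X @ a # P)" by (simp add: rotate_rotate)
      then show ?thesis by blast
    qed
  qed
qed

section \<open>Normal form\<close>

lemma sorted_enumeration_by_first_pos:
  assumes H: "hieroglyph w" and S: "S \<subseteq> set w"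
  obtains xs where "set xs = S" "sorted_wrt (\<lambda>x y. first_pos w x < first_pos w y) xs"
proof -
  let ?p = "first_pos w"
  define I where "I = sorted_list_of_set (?p ` S)"
  have fin: "finite (?p ` S)" using S finite_subset by blast
  have inv: "w ! ?p x = x" if "x \<in> S" for x using positions(4)[OF H] S that by blast
  have I: "set I = ?p ` S" "sorted_wrt (<) I" unfolding I_def using fin by (simp_all add: strict_sorted_list_of_set)
  have "set (map ((!) w) I) = S" using I(1) inv by (auto simp: image_image)
  moreover have "sorted_wrt (\<lambda>x y. ?p x < ?p y) (map ((!) w) I)"
    unfolding sorted_wrt_map by (rule sorted_wrt_mono_rel[OF _ I(2)]) (use I(1) inv in auto)
  ultimately show thesis by (rule that)
qed

text \<open>
  The assumption on the labels of the first and last letter says that the word is cut at the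
  boundary of a block; without it, only some rotation has the claimed form.
\<close>

lemma normal_form_of_labels:
  assumes H: "hieroglyph w" and ne: "w \<noteq> []"
    and l: "\<And>x. x \<in> set w \<Longrightarrow> l x \<in> {1, 2, 3 :: nat}"
    and cr: "\<And>x y. x \<in> set w \<Longrightarrow> y \<in> set w \<Longrightarrow> loops_cross w x y \<longleftrightarrow> l x \<noteq> l y"
    and ends: "l (hd w) \<noteq> l (last w)"
  shows "\<exists>A B C. w = A @ B @ C @ rev A @ rev B @ rev C \<and> distinct (A @ B @ C)"
proof -
  define p q where "p = first_pos w" and "q = last_pos w"
  define N where "N = length w"
  define a e where "a = hd w" and "e = last w"
  have N: "0 < N" using ne by (simp add: N_def)
  have ma: "a \<in> set w" and me: "e \<in> set w" using ne by (simp_all add: a_def e_def)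
  note pos = positions[OF H, folded p_def q_def N_def]
  have bound: "p x < q x" "q x < N" if "x \<in> set w" for x using pos(2,3)[OF that] by auto
  have "0 \<in> {i. i < N \<and> w ! i = a}" using N ne by (simp add: a_def hd_conv_nth)
  then have "0 = p a \<or> 0 = q a" unfolding pos(1)[OF ma] by blast
  then have pa: "p a = 0" using bound(1)[OF ma] by (metis not_less_zero)
  have "N - 1 \<in> {i. i < N \<and> w ! i = e}" using N ne by (simp add: e_def last_conv_nth N_def)
  then have "N - 1 = p e \<or> N - 1 = q e" unfolding pos(1)[OF me] by blast
  then have qe: "q e = N - 1" using bound[OF me] by linarith
  note cp = loops_cross_positions[OF H, folded p_def q_def]
  have diff: "p x < p y \<and> p y < q x \<and> q x < q y \<or> p y < p x \<and> p x < q y \<and> q y < q x"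
    if "x \<in> set w" "y \<in> set w" "l x \<noteq> l y" for x y
  proof -
    have "x \<noteq> y" using that by auto
    then show ?thesis using cp[of x y] cr[of x y] that by blast
  qed
  have same: "q x < p y \<or> q y < p x \<or> p x < p y \<and> q y < q x \<or> p y < p x \<and> q x < q y"
    if "x \<in> set w" "y \<in> set w" "l x = l y" "x \<noteq> y" for x y
  proof -
    have "\<not> (p x < p y \<and> p y < q x \<and> q x < q y \<or> p y < p x \<and> p x < q y \<and> q y < q x)"
      using cp[OF that(1,2,4)] cr[OF that(1,2)] that(3) by blast
    moreover note positions_distinct[OF H that(1,2,4), folded p_def q_def] bound[OF that(1)] bound[OF that(2)]
    ultimately show ?thesis by linarith
  qed
  have F1: "p a < p z \<and> p z < q a \<and> q a < q z" if "z \<in> set w" "l z \<noteq> l a" for z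
    using diff[OF ma that(1)] that(2) pa by auto
  have F2: "p x < p e \<and> p e < q x \<and> q x < q e" if "x \<in> set w" "l x \<noteq> l e" for x
    using diff[OF that(1) me] that(2) bound[OF that(1)] qe by auto
  have ae: "l a \<noteq> l e" using ends by (simp add: a_def e_def)
  \<comment> \<open>If the crossing of \<open>x\<close> and \<open>z\<close> had the other order,
    then \<open>x\<close> would not be nested inside \<open>a\<close>, as that gives
    \<open>q z < q x < q a\<close> against \<open>F1\<close>; nor could it lie behind
    \<open>a\<close>, as the last letter \<open>e\<close> meets both loops, so
    \<open>p x < p e < q a\<close>.\<close>
  have F3: "p x < p z \<and> p z < q x \<and> q x < q z" if "x \<in> set w" "l x = l a" "z \<in> set w" "l z \<noteq> l a" for x z
  proof (cases "x = a")
    case True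
    then show ?thesis using F1[OF that(3,4)] by simp
  next
    case False
    have "l x \<noteq> l z" using that by simp
    note this = diff[OF that(1,3) this] F1[OF that(3,4)] F2[OF that(1)] F2[OF ma ae] same[OF ma that(1)] bound[OF that(1)]
    then show ?thesis using ae that(2) False pa by (smt (verit) less_trans less_not_sym not_less_zero)
  qed
  \<comment> \<open>Loops of the class of \<open>a\<close> all enclose the position
    \<open>p e\<close>, so two of them cannot be disjoint and must be nested. For the other classes
    the common position is \<open>q a\<close>.\<close>
  have F4: "q y < q x" if "x \<in> set w" "y \<in> set w" "l x = l a" "l y = l a" "p x < p y" for x y
  proof -
    have "x \<noteq> y" using that(5) by auto
    then show ?thesis using same[OF that(1,2)] F2[OF that(1)] F2[OF that(2)] ae that(3,4,5) bound[OF that(1)] bound[OF that(2)] by auto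
  qed
  have F5: "q y < q x" if "x \<in> set w" "y \<in> set w" "l x = l y" "l x \<noteq> l a" "p x < p y" for x y
  proof -
    have "x \<noteq> y" using that(5) by auto
    then show ?thesis using same[OF that(1,2)] F1[OF that(1)] F1[OF that(2)] that(3,4,5) bound[OF that(1)] bound[OF that(2)] by auto
  qed
  have F6: "p y < p z \<and> q y < q z \<or> p z < p y \<and> q z < q y" if "y \<in> set w" "z \<in> set w" "l y \<noteq> l z" for y z
    using diff[OF that] by blast
  \<comment> \<open>The relative order of two classes does not depend on the representatives: a
    class cannot be interleaved with another one, since nesting inside a class reverses the order of
    last ends while crossing preserves it.\<close>
  have F7: "p y' < p z'" if m: "y \<in> set w" "y' \<in> set w" "z \<in> set w" "z' \<in> set w"
    and lab: "l y = l y'" "l z = l z'" "l y \<noteq> l z" "l y \<noteq> l a" "l z \<noteq> l a" and "p y < p z" for y y' z z'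
  proof (rule ccontr)
    assume "\<not> p y' < p z'"
    have lt: "p y < p z'"
    proof (rule ccontr)
      assume "\<not> p y < p z'"
      then have "p z' < p y" "q z' < q y" using F6[OF m(1,4)] lab by auto
      moreover have "q y < q z" using F6[OF m(1,3)] lab \<open>p y < p z\<close> by auto
      ultimately show False using F5[OF m(4,3)] lab \<open>p y < p z\<close> by auto
    qed
    have "p z' < p y'" "q z' < q y'" using F6[OF m(2,4)] lab \<open>\<not> p y' < p z'\<close> by auto
    moreover have "q y < q z'" using F6[OF m(1,4)] lab lt by auto
    ultimately show False using F5[OF m(1,2)] lab lt by auto
  qed
  \<comment> \<open>The names of the remaining two labels are chosen so that the loops labelled
    \<beta> come first; either of these classes may be empty.\<close>
  obtain \<beta> \<gamma> where bc: "{l a, \<beta>, \<gamma>} = {1, 2, 3}" "l a \<noteq> \<beta>" "l a \<noteq> \<gamma>" "\<beta> \<noteq> \<gamma>"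
    and F8: "\<And>y z. y \<in> set w \<Longrightarrow> z \<in> set w \<Longrightarrow> l y = \<beta> \<Longrightarrow> l z = \<gamma> \<Longrightarrow> p y < p z \<and> q y < q z"
  proof -
    obtain b c where bc: "{l a, b, c} = {1, 2, 3}" "l a \<noteq> b" "l a \<noteq> c" "b \<noteq> c"
    proof -
      consider "l a = 1" | "l a = 2" | "l a = 3" using l[OF ma] by auto
      then show thesis
      proof cases
        case 1 then show thesis by (intro that[of 2 3]) auto
      next
        case 2 then show thesis by (intro that[of 1 3]) auto
      next
        case 3 then show thesis by (intro that[of 1 2]) auto
      qed
    qed
    show thesis
    proof (cases "\<exists>y z. y \<in> set w \<and> z \<in> set w \<and> l y = b \<and> l z = c \<and> p y < p z")
      case True
      then obtain y z where yz: "y \<in> set w" "z \<in> set w" "l y = b" "l z = c" "p y < p z" by blast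
      show thesis
      proof (rule that[OF bc])
        fix y' z' assume *: "y' \<in> set w" "z' \<in> set w" "l y' = b" "l z' = c"
        have "p y' < p z'" using F7[OF yz(1) *(1) yz(2) *(2)] yz * bc by auto
        then show "p y' < p z' \<and> q y' < q z'" using F6[OF *(1,2)] * bc by auto
      qed
    next
      case False
      show thesis
      proof (rule that[of c b])
        fix y z assume *: "y \<in> set w" "z \<in> set w" "l y = c" "l z = b"
        then have "\<not> p z < p y" using False by blast
        then show "p y < p z \<and> q y < q z" using F6[OF *(1,2)] * bc by auto
      qed (use bc in auto)
    qed
  qed
  obtain A where A: "set A = {x \<in> set w. l x = l a}" "sorted_wrt (\<lambda>x y. p x < p y) A"
    by (rule sorted_enumeration_by_first_pos[OF H, of "{x \<in> set w. l x = l a}", folded p_def]) auto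
  obtain B where B: "set B = {x \<in> set w. l x = \<beta>}" "sorted_wrt (\<lambda>x y. p x < p y) B"
    by (rule sorted_enumeration_by_first_pos[OF H, of "{x \<in> set w. l x = \<beta>}", folded p_def]) auto
  obtain C where C: "set C = {x \<in> set w. l x = \<gamma>}" "sorted_wrt (\<lambda>x y. p x < p y) C"
    by (rule sorted_enumeration_by_first_pos[OF H, of "{x \<in> set w. l x = \<gamma>}", folded p_def]) auto
  have qA: "sorted_wrt (\<lambda>x y. q y < q x) A" by (rule sorted_wrt_mono_rel[OF _ A(2)]) (use A(1) F4 in auto)
  have qB: "sorted_wrt (\<lambda>x y. q y < q x) B" by (rule sorted_wrt_mono_rel[OF _ B(2)]) (use B(1) F5 bc in auto)
  have qC: "sorted_wrt (\<lambda>x y. q y < q x) C" by (rule sorted_wrt_mono_rel[OF _ C(2)]) (use C(1) F5 bc in auto)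
  have AB: "p x < p y" "p y < q x" "q x < q y" if "x \<in> set A" "y \<in> set B \<union> set C" for x y
    using F3[of x y] that A(1) B(1) C(1) bc by auto
  have BC: "p y < p z" "q y < q z" if "y \<in> set B" "z \<in> set C" for y z
    using F8[of y z] that B(1) C(1) by auto
  have BB: "p y < q z" if "y \<in> set B \<union> set C" "z \<in> set B \<union> set C" for y z
    using F1[of y] F1[of z] that B(1) C(1) bc by fastforce
  have AA: "p x < q y" if "x \<in> set A" "y \<in> set A" for x y
    using F2[of x] F2[of y] that A(1) ae by fastforce
  have AQ: "p x < q y" if "x \<in> set A" "y \<in> set B \<union> set C" for x y
    using AB(1)[OF that] BB[OF that(2) that(2)] by simp
  \<comment> \<open>The list of positions read off from the claimed form of the word. It is strictly
    increasing and exhausts all positions, so it is \<open>[0..<N]\<close>, and reading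
    \<open>w\<close> along it gives the claim.\<close>
  define E where "E = map p A @ map p B @ map p C @ map q (rev A) @ map q (rev B) @ map q (rev C)"
  have sE: "sorted_wrt (<) E"
    unfolding E_def sorted_wrt_append sorted_wrt_map sorted_wrt_rev
    using A(2) B(2) C(2) qA qB qC AB BC BB AA AQ by auto
  have all: "set A \<union> set B \<union> set C = set w"
  proof -
    have "l x \<in> {l a, \<beta>, \<gamma>}" if "x \<in> set w" for x unfolding bc(1) by (rule l[OF that])
    then show ?thesis using A(1) B(1) C(1) by auto
  qed
  have "set E = p ` set w \<union> q ` set w" unfolding all[symmetric] E_def by auto
  also have "\<dots> = {..<N}"
  proof (intro equalityI subsetI)
    fix i assume i: "i \<in> {..<N}"
    then have m: "w ! i \<in> set w" by (simp add: N_def)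
    have "i \<in> {k. k < N \<and> w ! k = w ! i}" using i by simp
    then show "i \<in> p ` set w \<union> q ` set w" unfolding pos(1)[OF m] using m by blast
  next
    fix i assume "i \<in> p ` set w \<union> q ` set w"
    then show "i \<in> {..<N}" using bound less_trans by blast
  qed
  finally have setE: "set E = {..<N}" .
  have "E = [0..<N]"
  proof (rule sorted_distinct_set_unique)
    show "sorted E" "distinct E" using sE unfolding strict_sorted_iff by blast+
    show "set E = set [0..<N]" unfolding setE by (simp add: atLeast0LessThan)
  qed simp_all
  then have "map ((!) w) E = w" by (simp add: N_def map_nth)
  moreover have "map ((!) w) (map p xs) = xs" "map ((!) w) (map q xs) = xs" if "set xs \<subseteq> set w" for xs
    using that pos(4,5) by (auto intro!: map_idI)
  then have "map ((!) w) E = A @ B @ C @ rev A @ rev B @ rev C"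
    unfolding E_def map_append using A(1) B(1) C(1) by simp
  moreover have "distinct (A @ B @ C)"
  proof -
    have "distinct (map p (A @ B @ C) @ (map q (rev A) @ map q (rev B) @ map q (rev C)))"
      using sE unfolding E_def by (simp add: strict_sorted_iff)
    then show ?thesis by (simp only: distinct_append distinct_map)
  qed
  ultimately show ?thesis by metis
qed

text \<open>The ends of a rotation are cyclically consecutive letters; if these always had equal
  labels, the label would be constant along the word.\<close>

lemma rotate_distinguishing_ends:
  assumes w: "x \<in> set w" "y \<in> set w" "l x \<noteq> l y"
  shows "\<exists>n. l (hd (rotate n w)) \<noteq> l (last (rotate n w))"
proof (rule ccontr)
  assume "\<not> ?thesis"
  then have eq: "l (hd (rotate n w)) = l (last (rotate n w))" for n by blast
  have ne: "w \<noteq> []" using w by auto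
  have const: "l (w ! i) = l (w ! 0)" if "i < length w" for i
    using that
  proof (induction i)
    case (Suc i)
    have "hd (rotate (Suc i) w) = w ! Suc i"
      using Suc.prems ne by (simp add: hd_conv_nth nth_rotate del: rotate_Suc)
    moreover have "last (rotate (Suc i) w) = w ! i"
    proof -
      have "last (rotate (Suc i) w) = w ! ((Suc i + (length w - 1)) mod length w)"
        using ne by (simp add: last_conv_nth nth_rotate del: rotate_Suc)
      also have "Suc i + (length w - 1) = i + length w" using ne by (cases w) auto
      finally show ?thesis using Suc.prems by simp
    qed
    ultimately show ?case using eq[of "Suc i"] Suc by simp
  qed simp
  show False using w const by (metis in_set_conv_nth)
qed

text \<open>Separated from \<open>reduction_step\<close> because drawings are carried back only
  along the deletion of isolated loops; parallel loops are drawn all at once in the normal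
  form.\<close>

definition isolated_step :: "'a list \<Rightarrow> 'a list \<Rightarrow> bool" where
  "isolated_step w u \<longleftrightarrow> (\<exists>n a. rotate n w = [a, a] @ u)"

text \<open>Isolated loops are deleted as long as there are any, the labels of the other loops being
  kept. In the remaining word every loop crosses another one, so the label 0 has disappeared and the
  blocks are the classes of the three nonzero labels.\<close>

lemma reduces_to_normal_form:
  assumes "hieroglyph w" "crossing_labels w l"
  shows "\<exists>u n A B C. isolated_step\<^sup>*\<^sup>* w u \<and> rotate n u = A @ B @ C @ rev A @ rev B @ rev C \<and> distinct (A @ B @ C)"
  using assms
proof (induction "length w" arbitrary: w rule: less_induct)
  case less
  note H = less.prems(1) and l = less.prems(2)
  have cr: "loops_cross w x y \<longleftrightarrow> l x \<noteq> 0 \<and> l y \<noteq> 0 \<and> l x \<noteq> l y" if "x \<in> set w" "y \<in> set w" for x y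
    using l that unfolding crossing_labels_def by blast
  show ?case
  proof (cases "\<exists>a\<in>set w. \<forall>y. \<not> loops_cross w a y")
    case True
    then obtain n b u where n: "rotate n w = [b, b] @ u" using isolated_letter_reduces[OF H l] by blast
    have H': "hieroglyph ([b, b] @ u)" using H hieroglyph_rotate[of n w] n by simp
    have l': "crossing_labels ([b, b] @ u) l" using l crossing_labels_rotate[of n w l] n by simp
    have "filter (\<lambda>x. x \<notin> {b}) ([b, b] @ u) = u" using hieroglyph_isolated(2)[OF H'] by (auto intro!: filter_True)
    then have "crossing_labels u l" using crossing_labels_filter[OF l'] by metis
    moreover have "length u < length w" using arg_cong[OF n, of length] by simp
    ultimately obtain v m A B C where v: "isolated_step\<^sup>*\<^sup>* u v" "rotate m v = A @ B @ C @ rev A @ rev B @ rev C" "distinct (A @ B @ C)"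
      using less.hyps[of u] hieroglyph_isolated(1)[OF H'] by blast
    have "isolated_step w u" using n unfolding isolated_step_def by blast
    then have "isolated_step\<^sup>*\<^sup>* w v" using v(1) by (rule converse_rtranclp_into_rtranclp)
    then show ?thesis using v by blast
  next
    case False
    then have all: "\<exists>y\<in>set w. loops_cross w a y" if "a \<in> set w" for a using that by (meson loops_cross_imp_mem)
    show ?thesis
    proof (cases "w = []")
      case True
      then show ?thesis by (intro exI[of _ w] exI[of _ 0] exI[of _ "[]"]) auto
    next
      case False
      then obtain a where a: "a \<in> set w" by (meson last_in_set)
      then obtain b where b: "b \<in> set w" "loops_cross w a b" using all by blast
      then obtain n where n: "l (hd (rotate n w)) \<noteq> l (last (rotate n w))"
        using rotate_distinguishing_ends[of a w b l] a cr by blast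
      have lab: "l x \<in> {1, 2, 3}" if "x \<in> set (rotate n w)" for x
      proof -
        have "x \<in> set w" using that by simp
        then have "l x \<noteq> 0" "l x < 4" using all cr l unfolding crossing_labels_def by blast+
        then show ?thesis by auto
      qed
      have "\<exists>A B C. rotate n w = A @ B @ C @ rev A @ rev B @ rev C \<and> distinct (A @ B @ C)"
      proof (rule normal_form_of_labels[OF _ _ lab _ n])
        show "hieroglyph (rotate n w)" using H by (simp add: hieroglyph_rotate)
        show "rotate n w \<noteq> []" using False by simp
        fix x y assume xy: "x \<in> set (rotate n w)" "y \<in> set (rotate n w)"
        then show "loops_cross (rotate n w) x y \<longleftrightarrow> l x \<noteq> l y"
          using cr[of x y] lab[of x] lab[of y] by (auto simp: loops_cross_rotate)
      qed
      then show ?thesis by blast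
    qed
  qed
qed

text \<open>The two outermost loops \<open>x\<close>, \<open>y\<close> of a block occur as
  \<open>x y\<close> and \<open>y x\<close>, so they are parallel and merge into \<open>x\<close>;
  repeating this leaves one loop. \<open>take 1 A\<close> includes the case of an empty block, and
  the rotation \<open>m\<close> absorbs the cyclic shift.\<close>

lemma parallel_class_reduces:
  assumes "rotate n w = A @ S @ rev A @ S'"
  shows "\<exists>v m. reduction_step\<^sup>*\<^sup>* w v \<and> rotate m v = take 1 A @ S @ take 1 A @ S'"
  using assms
proof (induction "length A" arbitrary: A n w rule: less_induct)
  case less
  consider "A = []" | x where "A = [x]" | x y A' where "A = x # y # A'" by (cases A rule: remdups_adj.cases) auto
  then show ?case
  proof cases
    case 3
    then have "rotate n w = [x, y] @ (A' @ S @ rev A') @ [y, x] @ S'" using less.prems by simp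
    then have "reduction_step w ([x] @ (A' @ S @ rev A') @ [x] @ S')" by (rule reduction_step.parallel)
    moreover have "rotate 0 ([x] @ (A' @ S @ rev A') @ [x] @ S') = (x # A') @ S @ rev (x # A') @ S'" by simp
    from less.hyps[OF _ this] 3 obtain v m where "reduction_step\<^sup>*\<^sup>* ([x] @ (A' @ S @ rev A') @ [x] @ S') v"
      "rotate m v = take 1 (x # A') @ S @ take 1 (x # A') @ S'" by auto
    ultimately show ?thesis using 3 by (auto intro!: exI[of _ v] exI[of _ m] intro: converse_rtranclp_into_rtranclp)
  qed (use less.prems in auto)
qed

text \<open>Rotation brings the blocks to the front in turn. With at most one loop in each, the word
  is a square \<open>L L\<close> with at most three distinct letters: three or two letters give the
  nonempty minimal words, and a single letter is an isolated loop that is deleted.\<close>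

lemma normal_form_reduces_to:
  assumes nf: "rotate n w = A @ B @ C @ rev A @ rev B @ rev C" and dist: "distinct (A @ B @ C)"
  shows "\<exists>K\<in>{[], [0,1,0,1], [0,1,2,0,1,2 :: nat]}. reduces_to w K"
proof -
  have shift: "\<exists>k. rotate k v = Y @ X" if "rotate m v = X @ Y" for v X Y :: "'a list" and m
    using that by (metis rotate_append rotate_rotate)
  have "rotate n w = A @ (B @ C) @ rev A @ (rev B @ rev C)" using nf by simp
  from parallel_class_reduces[OF this] obtain v1 m1 where
    v1: "reduction_step\<^sup>*\<^sup>* w v1" "rotate m1 v1 = take 1 A @ (B @ C @ take 1 A @ rev B @ rev C)" by auto
  from shift[OF v1(2)] obtain k1 where "rotate k1 v1 = B @ (C @ take 1 A) @ rev B @ (rev C @ take 1 A)" by auto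
  from parallel_class_reduces[OF this] obtain v2 m2 where
    v2: "reduction_step\<^sup>*\<^sup>* v1 v2" "rotate m2 v2 = take 1 B @ (C @ take 1 A @ take 1 B @ rev C @ take 1 A)" by auto
  from shift[OF v2(2)] obtain k2 where "rotate k2 v2 = C @ (take 1 A @ take 1 B) @ rev C @ (take 1 A @ take 1 B)" by auto
  from parallel_class_reduces[OF this] obtain v3 m3 where
    v3: "reduction_step\<^sup>*\<^sup>* v2 v3" "rotate m3 v3 = (take 1 C @ take 1 A @ take 1 B) @ (take 1 C @ take 1 A @ take 1 B)" by auto
  have red: "reduction_step\<^sup>*\<^sup>* w v3" using v1(1) v2(1) v3(1) by (meson rtranclp_trans)
  define L where "L = take 1 C @ take 1 A @ take 1 B"
  have L: "rotate m3 v3 = L @ L" using v3(2) by (simp add: L_def)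
  have dL: "distinct L" using dist unfolding L_def by (cases A; cases B; cases C) auto
  have lL: "length L \<le> 3" unfolding L_def by (cases A; cases B; cases C) auto
  then consider "L = []" | x where "L = [x]" | x y where "L = [x, y]" | x y z where "L = [x, y, z]"
    by (auto simp: numeral_eq_Suc le_Suc_eq length_Suc_conv)
  then show ?thesis
  proof cases
    case 1
    then have "v3 = []" using L by simp
    then have "reduces_to w ([] :: nat list)" using red unfolding reduces_to_def same_hieroglyph_def by auto
    then show ?thesis by blast
  next
    case 2
    then have "rotate m3 v3 = [x, x] @ []" using L by simp
    then have "reduction_step v3 []" by (rule reduction_step.isolated)
    then have "reduction_step\<^sup>*\<^sup>* w []" using red by (meson rtranclp.rtrancl_into_rtrancl)
    then have "reduces_to w ([] :: nat list)" unfolding reduces_to_def same_hieroglyph_def by auto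
    then show ?thesis by blast
  next
    case 3
    have "same_hieroglyph v3 [0,1,0,1 :: nat]"
      by (rule same_hieroglyph_of_rotate[OF L, of "\<lambda>t. if t = x then 0 else 1"]) (use 3 dL in \<open>auto simp: inj_on_def\<close>)
    then have "reduces_to w [0,1,0,1 :: nat]" using red unfolding reduces_to_def by blast
    then show ?thesis by blast
  next
    case 4
    have "same_hieroglyph v3 [0,1,2,0,1,2 :: nat]"
      by (rule same_hieroglyph_of_rotate[OF L, of "\<lambda>t. if t = x then 0 else if t = y then 1 else 2"])
        (use 4 dL in \<open>auto simp: inj_on_def\<close>)
    then have "reduces_to w [0,1,2,0,1,2 :: nat]" using red unfolding reduces_to_def by blast
    then show ?thesis by blast
  qed
qed

lemma crossing_labels_reduces_to:
  assumes "hieroglyph w" "crossing_labels w l"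
  shows "\<exists>K\<in>{[], [0,1,0,1], [0,1,2,0,1,2 :: nat]}. reduces_to w K"
proof -
  obtain u n A B C where u: "isolated_step\<^sup>*\<^sup>* w u" and nf: "rotate n u = A @ B @ C @ rev A @ rev B @ rev C" "distinct (A @ B @ C)"
    using reduces_to_normal_form[OF assms] by blast
  have "isolated_step x y \<Longrightarrow> reduction_step x y" for x y :: "'a list"
    unfolding isolated_step_def by (auto intro: reduction_step.isolated)
  then have "reduction_step\<^sup>*\<^sup>* w u" using u by (metis mono_rtranclp)
  moreover obtain K where "K \<in> {[], [0,1,0,1], [0,1,2,0,1,2 :: nat]}" "reduces_to u K"
    using normal_form_reduces_to[OF nf] by blast
  ultimately show ?thesis unfolding reduces_to_def by (meson rtranclp_trans)
qed

lemma reduces_to_crossing_labels: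
  assumes H: "hieroglyph w" and K: "K \<in> {[], [0,1,0,1], [0,1,2,0,1,2 :: nat]}" and red: "reduces_to w K"
  shows "\<exists>l. crossing_labels w l"
proof -
  obtain u where u: "reduction_step\<^sup>*\<^sup>* w u" "same_hieroglyph u K" using red unfolding reduces_to_def by blast
  \<comment> \<open>In the minimal words any two distinct letters cross, and \<open>Suc\<close>
    gives the letters 0, 1, 2 the distinct nonzero labels 1, 2, 3.\<close>
  have "crossing_labels K Suc" using K by (auto simp: crossing_labels_def loops_cross_iff)
  then have "\<exists>l. crossing_labels u l" using crossing_labels_same_hieroglyph[OF u(2)] by blast
  with u(1) H show ?thesis
  proof (induction rule: converse_rtranclp_induct)
    case (step w v)
    then show ?case using reduction_step_crossing_labels[OF step(1)] by blast
  qed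
qed

section \<open>Intersection parity of loops on the torus\<close>

lemma continuous_Ints_valued_eq:
  fixes f :: "'a::topological_space \<Rightarrow> real"
  assumes "connected S" "continuous_on S f" "\<And>x. x \<in> S \<Longrightarrow> f x \<in> \<int>" "x \<in> S" "y \<in> S"
  shows "f x = f y"
proof -
  have "f constant_on S"
  proof (rule continuous_discrete_range_constant[OF assms(1,2)])
    fix x assume "x \<in> S"
    have "1 \<le> norm (f y - f x)" if "y \<in> S" "f y \<noteq> f x" for y
      using Ints_nonzero_abs_ge1[of "f y - f x"] assms(3) \<open>x \<in> S\<close> that by auto
    then show "\<exists>e>0. \<forall>y. y \<in> S \<and> f y \<noteq> f x \<longrightarrow> e \<le> norm (f y - f x)"
      by (intro exI[of _ 1]) auto
  qed
  with assms(4,5) show ?thesis by (auto simp: constant_on_def)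
qed

text \<open>Two logarithms of one function differ by an integer multiple of
  \<open>2 * pi * \<i>\<close>, which is locally constant. Every comparison of changes of logarithms
  below is an application of this.\<close>

lemma continuous_logs_diff_eq:
  fixes f g :: "'a::topological_space \<Rightarrow> complex"
  assumes S: "connected S" and f: "continuous_on S f" and g: "continuous_on S g"
    and eq: "\<And>x. x \<in> S \<Longrightarrow> exp (f x) = exp (g x)" and x: "x \<in> S" and y: "y \<in> S"
  shows "f x - f y = g x - g y"
proof -
  have *: "\<exists>n::int. f x = g x + of_int (2 * n) * pi * \<i>" if "x \<in> S" for x
    using eq[OF that] by (simp add: exp_eq)
  have I: "(Im (f x) - Im (g x)) / (2 * pi) \<in> \<int>" if "x \<in> S" for x
    using *[OF that] by auto
  have "(Im (f x) - Im (g x)) / (2 * pi) = (Im (f y) - Im (g y)) / (2 * pi)"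
    by (rule continuous_Ints_valued_eq[OF S _ I x y]) (intro continuous_intros f g, simp)
  moreover have "Re (f x) = Re (g x)" "Re (f y) = Re (g y)" using *[OF x] *[OF y] by auto
  ultimately show ?thesis by (simp add: complex_eq_iff)
qed

text \<open>
  A continuous section of the line bundle of degree one on the torus, pulled back to the plane. Its zeros
  are exactly the lattice points, and the gauge is chosen such that it is an odd function; on each
  horizontal strip of width one it is affine in the second coordinate.
\<close>

definition section_piece :: "int \<Rightarrow> real \<times> real \<Rightarrow> complex" where
  "section_piece n p = cis (pi * of_int n * (2 * fst p + 1)) *
     Complex (- sin (pi * fst p)) (2 * (snd p - of_int n) * cos (pi * fst p))"

definition torus_section :: "real \<times> real \<Rightarrow> complex" where
  "torus_section p = section_piece \<lfloor>snd p + 1/2\<rfloor> p"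

text \<open>On the seam both affine factors lie on the unit circle: they are
  \<open>\<i> * cis (pi * fst p)\<close> seen from below and
  \<open>- \<i> * cis (- (pi * fst p))\<close> seen from above. The phase factors in front are made
  to compensate for the quotient.\<close>

lemma section_piece_glue:
  assumes "snd p = of_int n + 1/2"
  shows "section_piece n p = section_piece (n + 1) p"
proof -
  have e: "cis (pi * of_int (n + 1) * (2 * fst p + 1)) =
      cis (pi * of_int n * (2 * fst p + 1)) * cis (pi * (2 * fst p + 1))"
    by (simp add: cis_mult algebra_simps)
  have l: "Complex (- sin (pi * fst p)) (2 * (snd p - of_int n) * cos (pi * fst p)) = \<i> * cis (pi * fst p)"
    using assms by (simp add: complex_eq_iff)
  have r: "Complex (- sin (pi * fst p)) (2 * (snd p - of_int (n + 1)) * cos (pi * fst p)) = - \<i> * cis (- (pi * fst p))"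
    using assms by (simp add: complex_eq_iff algebra_simps)
  have "cis (pi * (2 * fst p + 1)) = - cis (pi * fst p + pi * fst p)"
    by (simp add: complex_eq_iff algebra_simps)
  then have "cis (pi * (2 * fst p + 1)) * (- \<i> * cis (- (pi * fst p))) = \<i> * cis (pi * fst p)"
    by (simp add: cis_mult algebra_simps del: cis_inverse)
  with e l r show ?thesis unfolding section_piece_def by (metis mult.assoc)
qed

lemma torus_section_eq:
  assumes "\<bar>snd p - of_int n\<bar> \<le> 1/2"
  shows "torus_section p = section_piece n p"
proof (cases "snd p = of_int n + 1/2")
  case True
  then have "\<lfloor>snd p + 1/2\<rfloor> = n + 1" by linarith
  then show ?thesis using section_piece_glue[OF True] by (simp only: torus_section_def)
next
  case False
  with assms have "\<lfloor>snd p + 1/2\<rfloor> = n" by linarith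
  then show ?thesis by (simp add: torus_section_def)
qed

lemma continuous_section_piece: "continuous_on A (section_piece n)"
  unfolding section_piece_def Complex_eq by (intro continuous_intros)

lemma continuous_torus_section: "continuous_on UNIV torus_section"
proof -
  have "isCont torus_section p" for p
  proof -
    \<comment> \<open>Halves are rounded up, so \<open>p\<close> may lie on the lower seam of its
      strip but never on the upper one; the neighbourhood \<open>S\<close> therefore crosses the
      lower seam only.\<close>
    define n where "n = \<lfloor>snd p + 1/2\<rfloor>"
    define S where "S = (snd -` {of_int n - 1 <..< of_int n + 1/2} :: (real \<times> real) set)"
    have "open S" unfolding S_def by (rule open_vimage_snd) simp
    have "continuous_on S (\<lambda>x. if snd x \<le> of_int n - 1/2 then section_piece (n-1) x else section_piece n x)"
      by (rule continuous_on_cases_le)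
        (auto intro!: continuous_section_piece continuous_intros simp: section_piece_glue[of _ "n - 1", simplified])
    moreover have "(if snd x \<le> of_int n - 1/2 then section_piece (n-1) x else section_piece n x) = torus_section x"
      if "x \<in> S" for x
      using that torus_section_eq[of x n] torus_section_eq[of x "n-1"] unfolding S_def
      by (auto simp: abs_if split: if_splits)
    ultimately have "continuous_on S torus_section" by (simp cong: continuous_on_cong)
    moreover have "p \<in> S" unfolding S_def n_def by simp linarith
    ultimately show ?thesis using \<open>open S\<close> continuous_on_eq_continuous_at by blast
  qed
  then show ?thesis by (simp add: continuous_at_imp_continuous_on)
qed

lemma torus_section_zero_iff: "torus_section p = 0 \<longleftrightarrow> fst p \<in> \<int> \<and> snd p \<in> \<int>"
proof
  assume "torus_section p = 0"
  then have s: "sin (pi * fst p) = 0" and c: "(snd p - of_int \<lfloor>snd p + 1/2\<rfloor>) * cos (pi * fst p) = 0"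
    by (auto simp: torus_section_def section_piece_def Complex_eq_0)
  from s have "cos (pi * fst p) \<noteq> 0" by (metis sin_zero_abs_cos_one abs_zero zero_neq_one)
  with c have "snd p \<in> \<int>" by (metis Ints_of_int eq_iff_diff_eq_0 mult_eq_0_iff)
  moreover from s obtain i :: int where "pi * fst p = of_int i * pi" by (auto simp: sin_zero_iff_int2)
  then have "fst p \<in> \<int>" by simp
  ultimately show "fst p \<in> \<int> \<and> snd p \<in> \<int>" by simp
next
  assume "fst p \<in> \<int> \<and> snd p \<in> \<int>"
  then obtain i j :: int where "fst p = of_int i" "snd p = of_int j" by (auto elim!: Ints_cases)
  then show "torus_section p = 0"
    using torus_section_eq[of p j] sin_zero_iff_int2[of "pi * real_of_int i"]
    by (auto simp: section_piece_def complex_eq_iff mult.commute)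
qed

lemma torus_section_uminus: "torus_section (- p) = - torus_section p"
proof -
  define n where "n = \<lfloor>snd p + 1/2\<rfloor>"
  have 1: "\<bar>snd p - of_int n\<bar> \<le> 1/2" unfolding n_def by linarith
  then have 2: "\<bar>snd (- p) - of_int (- n)\<bar> \<le> 1/2" by (simp add: abs_if split: if_splits)
  have "cis (pi * of_int (- n) * (2 * fst (- p) + 1)) = cis (pi * of_int n * (2 * fst p + 1) + 2 * pi * of_int (- n))"
    by (rule arg_cong[of _ _ cis]) (simp add: algebra_simps)
  also have "\<dots> = cis (pi * of_int n * (2 * fst p + 1))"
    by (subst cis_mult[symmetric]) (simp only: cis_multiple_2pi Ints_of_int, simp)
  finally show ?thesis
    unfolding torus_section_eq[OF 1] torus_section_eq[OF 2]
    by (simp add: section_piece_def complex_eq_iff algebra_simps)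
qed

text \<open>The quasi-periods have absolute value one. A horizontal period only contributes a sign,
  whereas a vertical one contributes a phase linear in the first coordinate; this asymmetric term
  later produces the determinant of two homology classes.\<close>

lemma torus_section_shift:
  "torus_section (p + (of_int i, of_int j)) =
     exp (\<i> * pi * (of_int (i + j) + 2 * of_int j * of_real (fst p))) * torus_section p"
proof -
  define n where "n = \<lfloor>snd p + 1/2\<rfloor>"
  have 1: "\<bar>snd p - of_int n\<bar> \<le> 1/2" unfolding n_def by linarith
  then have 2: "\<bar>snd (p + (of_int i, of_int j)) - of_int (n + j)\<bar> \<le> 1/2" by simp
  have E: "exp (\<i> * pi * (of_int (i + j) + 2 * of_int j * of_real (fst p))) =
      cis (pi * of_int i) * cis (pi * of_int j * (2 * fst p + 1))"
    by (simp add: cis_conv_exp exp_add[symmetric] algebra_simps)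
  have C: "cis (pi * of_int i) = of_real (cos (pi * of_int i))"
    using sin_zero_iff_int2[of "pi * of_int i"] by (auto simp: complex_eq_iff mult.commute)
  have s: "sin (pi * of_int i) = 0" using sin_zero_iff_int2[of "pi * of_int i"] by (auto simp: mult.commute)
  have R: "Complex (- sin (pi * (fst p + of_int i))) (2 * (snd p + of_int j - of_int (n + j)) * cos (pi * (fst p + of_int i)))
      = cis (pi * of_int i) * Complex (- sin (pi * fst p)) (2 * (snd p - of_int n) * cos (pi * fst p))"
    unfolding C using s by (simp add: complex_eq_iff sin_add cos_add distrib_left)
  have "cis (pi * of_int (n + j) * (2 * (fst p + of_int i) + 1)) =
     cis (pi * of_int n * (2 * fst p + 1) + pi * of_int j * (2 * fst p + 1) + 2 * pi * of_int ((n + j) * i))"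
    by (rule arg_cong[of _ _ cis]) (simp add: algebra_simps)
  also have "\<dots> = cis (pi * of_int n * (2 * fst p + 1)) * cis (pi * of_int j * (2 * fst p + 1))"
    by (subst cis_mult[symmetric])+ (simp only: cis_multiple_2pi Ints_of_int, simp)
  finally have A: "cis (pi * of_int (n + j) * (2 * (fst p + of_int i) + 1)) = \<dots>" .
  show ?thesis
    unfolding torus_section_eq[OF 1] torus_section_eq[OF 2] section_piece_def fst_add snd_add fst_conv snd_conv
    unfolding E R A by (simp only: mult_ac)
qed

section \<open>Logarithms for pairs of points of a disc\<close>

text \<open>Corners are extreme points of the square, and removing extreme points preserves
  convexity. This is used for the unit square without all corners and for a small square without one
  corner.\<close>

lemma convex_square_minus_corners:
  fixes e :: real
  assumes "F \<subseteq> {0, e} \<times> {0, e}"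
  shows "convex ({0..e} \<times> {0..e} - F)"
proof (rule convexI)
  have interp: "x = z \<and> y = z"
    if "z = 0 \<or> z = e" "0 \<le> x" "x \<le> e" "0 \<le> y" "y \<le> e" "0 < u" "0 < v" "u + v = 1" "u * x + v * y = z"
    for x y z u v :: real
  proof (cases "z = 0")
    case True
    with that have "u * x = 0" "v * y = 0" by (simp_all add: add_nonneg_eq_0_iff)
    with that True show ?thesis by simp
  next
    case False
    with that have "z = e" by simp
    moreover have "u * (e - x) + v * (e - y) = (u + v) * e - (u * x + v * y)" by (simp add: algebra_simps)
    ultimately have "u * (e - x) + v * (e - y) = 0" using that by simp
    with that have "u * (e - x) = 0" "v * (e - y) = 0" by (simp_all add: add_nonneg_eq_0_iff)
    with that \<open>z = e\<close> show ?thesis by simp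
  qed
  fix p q :: "real \<times> real" and u v :: real
  assume p: "p \<in> {0..e} \<times> {0..e} - F" and q: "q \<in> {0..e} \<times> {0..e} - F"
    and uv: "0 \<le> u" "0 \<le> v" "u + v = 1"
  let ?z = "u *\<^sub>R p + v *\<^sub>R q"
  have "convex ({0..e} \<times> {0..e})" by (intro convex_Times convex_real_interval)
  then have "?z \<in> {0..e} \<times> {0..e}" using p q uv by (auto simp: convex_def simp del: mem_Times_iff)
  moreover have "?z \<notin> F"
  proof
    assume F: "?z \<in> F"
    consider "u = 0" | "v = 0" | "0 < u" "0 < v" using uv by fastforce
    then show False
    proof cases
      case 3
      have "fst ?z \<in> {0, e}" "snd ?z \<in> {0, e}"
        using subsetD[OF assms F] unfolding mem_Times_iff by blast+
      then have z: "fst ?z = 0 \<or> fst ?z = e" "snd ?z = 0 \<or> snd ?z = e" by blast+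
      have b: "0 \<le> fst p" "fst p \<le> e" "0 \<le> fst q" "fst q \<le> e"
        "0 \<le> snd p" "snd p \<le> e" "0 \<le> snd q" "snd q \<le> e"
        using p q by auto
      have "fst p = fst ?z" by (rule interp[OF z(1) b(1-4) 3 uv(3), THEN conjunct1]) simp
      moreover have "snd p = snd ?z" by (rule interp[OF z(2) b(5-8) 3 uv(3), THEN conjunct1]) simp
      ultimately have "p = ?z" by (rule prod_eqI)
      then show False using F p by simp
    qed (use F p q uv in auto)
  qed
  ultimately show "?z \<in> {0..e} \<times> {0..e} - F" by blast
qed

text \<open>A disc of the torus lifted to the plane: the integrality condition says that
  \<open>k\<close> stays injective modulo the integer lattice.\<close>

definition lifted_disc :: "(complex \<Rightarrow> real \<times> real) \<Rightarrow> bool" where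
  "lifted_disc k \<longleftrightarrow> continuous_on (cball 0 1) k \<and>
     (\<forall>x\<in>cball 0 1. \<forall>y\<in>cball 0 1. fst (k x - k y) \<in> \<int> \<and> snd (k x - k y) \<in> \<int> \<longrightarrow> x = y)"

text \<open>
  A pair \<open>(c, w)\<close> stands for the two distinct points with midpoint \<open>c\<close> and difference \<open>exp w\<close>, so \<open>M\<close>
  is a logarithm on the universal cover of a configuration space of two points of the disc.
\<close>

definition configuration_log :: "(complex \<Rightarrow> real \<times> real) \<Rightarrow> (complex \<times> complex \<Rightarrow> complex) \<Rightarrow> bool" where
  "configuration_log k M \<longleftrightarrow> continuous_on (cball 0 (1/2) \<times> {w. Re w \<le> 0}) M \<and>
     (\<forall>c\<in>cball 0 (1/2). \<forall>w. Re w \<le> 0 \<longrightarrow>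
        exp (M (c, w)) = torus_section (k (c + exp w / 2) - k (c - exp w / 2)))"

lemma disc_centre_plus:
  fixes c w :: complex
  assumes "c \<in> cball 0 (1/2)" "Re w \<le> 0"
  shows "c + exp w / 2 \<in> cball 0 1" "c - exp w / 2 \<in> cball 0 1"
proof -
  have "norm (exp w / 2) \<le> 1/2" using assms(2) by (simp add: norm_divide)
  moreover have "norm c \<le> 1/2" using assms(1) by simp
  ultimately have "norm c + norm (exp w / 2) \<le> 1" by linarith
  then show "c + exp w / 2 \<in> cball 0 1" "c - exp w / 2 \<in> cball 0 1"
    using order_trans[OF norm_triangle_ineq[of c "exp w / 2"]]
      order_trans[OF norm_triangle_ineq4[of c "exp w / 2"]] by simp_all
qed

text \<open>The parameter domain is convex, and the two points with difference \<open>exp w\<close>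
  are distinct, so their lifts do not differ by a lattice vector and the section does not
  vanish.\<close>

lemma configuration_log_exists:
  assumes "lifted_disc k"
  obtains M where "configuration_log k M"
proof -
  let ?W = "cball 0 (1/2) \<times> {w. Re w \<le> 0} :: (complex \<times> complex) set"
  define \<phi> where "\<phi> = (\<lambda>(c,w). torus_section (k (c + exp w / 2) - k (c - exp w / 2)))"
  have contk: "continuous_on (cball 0 1) k" using assms by (simp add: lifted_disc_def)
  have "continuous_on ?W (\<lambda>x. k (fst x + exp (snd x) / 2) - k (fst x - exp (snd x) / 2))"
    by (intro continuous_on_diff continuous_on_compose2[OF contk])
      (auto intro!: continuous_intros disc_centre_plus simp del: mem_cball)
  then have "continuous_on ?W \<phi>" unfolding \<phi>_def case_prod_beta
    by (rule continuous_on_compose2[OF continuous_torus_section]) simp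
  moreover have "convex ?W" by (intro convex_Times convex_halfspace_Re_le) simp
  then have "contractible ?W" by (rule convex_imp_contractible)
  moreover have "\<phi> z \<noteq> 0" if z: "z \<in> ?W" for z
  proof
    assume "\<phi> z = 0"
    moreover have "fst z \<in> cball 0 (1/2)" "Re (snd z) \<le> 0" using z by auto
    ultimately have "fst z + exp (snd z) / 2 = fst z - exp (snd z) / 2"
      using assms disc_centre_plus[of "fst z" "snd z"]
      unfolding \<phi>_def lifted_disc_def torus_section_zero_iff case_prod_beta by blast
    then have "exp (snd z) = 0" by (simp add: field_simps)
    then show False by simp
  qed
  ultimately obtain M where M: "continuous_on ?W M" "\<And>x. x \<in> ?W \<Longrightarrow> \<phi> x = exp (M x)"
    using continuous_logarithm_on_contractible[of ?W \<phi>] by blast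
  from M(2) have "configuration_log k M"
    unfolding configuration_log_def \<phi>_def using M(1) by fastforce
  then show thesis by (rule that)
qed

text \<open>
  Exchanging the two points adds \<open>pi * \<i>\<close> to \<open>w\<close> and changes the sign of the odd function
  \<open>torus_section\<close>, so half a turn contributes an odd multiple of \<open>pi * \<i>\<close>.
\<close>

lemma configuration_log_period:
  assumes M: "configuration_log k M"
  obtains K :: int where "odd K"
    "\<And>c w. c \<in> cball 0 (1/2) \<Longrightarrow> Re w \<le> 0 \<Longrightarrow> M (c, w + 2 * pi * \<i>) = M (c, w) + 2 * pi * \<i> * of_int K"
proof -
  let ?W = "cball 0 (1/2) \<times> {w. Re w \<le> 0} :: (complex \<times> complex) set"
  have cont: "continuous_on ?W M"
    and eM: "\<And>c w. c \<in> cball 0 (1/2) \<Longrightarrow> Re w \<le> 0 \<Longrightarrow>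
        exp (M (c, w)) = torus_section (k (c + exp w / 2) - k (c - exp w / 2))"
    using M by (auto simp: configuration_log_def)
  have "convex ?W" by (intro convex_Times convex_halfspace_Re_le) simp
  then have conn: "connected ?W" by (rule convex_connected)
  have "exp (2 * pi * \<i>) = 1" using exp_two_pi_i by simp
  then have per: "exp (w + 2 * pi * \<i>) = exp w" for w :: complex by (simp add: exp_add)
  have "M (fst z, snd z + 2 * pi * \<i>) - M (fst y, snd y + 2 * pi * \<i>) = M z - M y"
    if "z \<in> ?W" "y \<in> ?W" for y z
  proof (rule continuous_logs_diff_eq[OF conn _ cont _ that])
    show "continuous_on ?W (\<lambda>z. M (fst z, snd z + 2 * pi * \<i>))"
      by (rule continuous_on_compose2[OF cont]) (auto intro!: continuous_intros)
    show "exp (M (fst z, snd z + 2 * pi * \<i>)) = exp (M z)" if "z \<in> ?W" for z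
      using eM[of "fst z" "snd z"] eM[of "fst z" "snd z + 2 * pi * \<i>"] that per[of "snd z"] by auto
  qed
  from this[of "(_, _)" "(0, 0)"]
  have D: "M (c, w + 2 * pi * \<i>) = M (c, w) + (M (0, 2 * pi * \<i>) - M (0,0))"
    if "c \<in> cball 0 (1/2)" "Re w \<le> 0" for c w
    using that by (simp add: algebra_simps)
  have half: "exp (M (0, w + pi * \<i>)) = exp (M (0, w) + pi * \<i>)" if "Re w \<le> 0" for w
  proof -
    have "exp (w + pi * \<i>) = - exp w" by (simp add: exp_add)
    then have "exp (M (0, w + pi * \<i>)) = torus_section (- (k (exp w / 2) - k (- (exp w / 2))))"
      using eM[of 0 "w + pi * \<i>"] that by simp
    also have "\<dots> = - exp (M (0,w))"
      using eM[of 0 w] that by (simp only: torus_section_uminus) simp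
    finally show ?thesis by (simp add: exp_add)
  qed
  \<comment> \<open>Over the half turn from 0 to \<open>pi * \<i>\<close> the logarithm grows by
    \<open>(2 * n + 1) * pi * \<i>\<close>.\<close>
  obtain n :: int where n: "M (0, pi * \<i>) = M (0, 0) + pi * \<i> + of_int (2 * n) * pi * \<i>"
    using half[of 0] by (auto simp: exp_eq)
  \<comment> \<open>The second half turn contributes the same amount as the first, because both
    sides are logarithms of one function on a half plane. A full turn thus gives the odd number
    \<open>K = 2 * n + 1\<close>.\<close>
  have "M (0, pi * \<i> + pi * \<i>) - M (0, 0 + pi * \<i>) = M (0, pi * \<i>) + pi * \<i> - (M (0, 0) + pi * \<i>)"
  proof (rule continuous_logs_diff_eq[where S = "{w. Re w \<le> 0}"])
    show "connected {w. Re w \<le> 0}" by (intro convex_connected convex_halfspace_Re_le)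
    show "continuous_on {w. Re w \<le> 0} (\<lambda>w. M (0, w + pi * \<i>))"
      by (rule continuous_on_compose2[OF cont]) (auto intro!: continuous_intros)
    show "continuous_on {w. Re w \<le> 0} (\<lambda>w. M (0, w) + pi * \<i>)"
      by (intro continuous_intros continuous_on_compose2[OF cont]) auto
  qed (use half in auto)
  with n have "M (0, 2 * pi * \<i>) - M (0, 0) = 2 * pi * \<i> * of_int (2 * n + 1)"
    by (simp add: algebra_simps)
  with D show thesis by (intro that[of "2 * n + 1"]) auto
qed

section \<open>Change of the logarithm at a corner\<close>

text \<open>A difference of points on the two rays is a nonnegative combination of
  \<open>cis \<alpha>\<close> and \<open>- cis \<beta>\<close>. Writing the latter as
  \<open>cis (\<beta> + \<tau>)\<close>, the sign of \<tau> makes the two angles differ by less than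
  \<open>pi\<close>; after rotating back by their bisector \<omega> all differences lie in the right
  half plane, where \<open>Ln\<close> is continuous. Here the order of the two angles
  enters.\<close>

lemma difference_of_rays_log:
  fixes \<alpha> \<beta> :: real
  assumes "0 \<le> \<alpha>" "\<alpha> < 2 * pi" "0 \<le> \<beta>" "\<beta> < 2 * pi" "\<alpha> \<noteq> \<beta>"
  defines "\<tau> \<equiv> (if \<alpha> < \<beta> then - pi else pi)"
  obtains \<omega> where
    "\<And>\<rho> \<sigma>. 0 \<le> \<rho> \<Longrightarrow> 0 \<le> \<sigma> \<Longrightarrow> 0 < \<rho> + \<sigma> \<Longrightarrow>
       0 < Re ((of_real \<rho> * cis \<alpha> - of_real \<sigma> * cis \<beta>) * cis (- \<omega>))"
    "\<And>\<rho>. 0 < \<rho> \<Longrightarrow> Ln (of_real \<rho> * cis \<alpha> * cis (- \<omega>)) + \<i> * \<omega> = of_real (ln \<rho>) + \<i> * \<alpha>"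
    "\<And>\<sigma>. 0 < \<sigma> \<Longrightarrow> Ln (- (of_real \<sigma> * cis \<beta>) * cis (- \<omega>)) + \<i> * \<omega> = of_real (ln \<sigma>) + \<i> * (\<beta> + \<tau>)"
proof -
  define \<delta> where "\<delta> = (\<alpha> - \<beta> - \<tau>) / 2"
  define \<omega> where "\<omega> = (\<alpha> + \<beta> + \<tau>) / 2"
  have \<delta>: "- (pi/2) < \<delta>" "\<delta> < pi/2"
    using assms(1-5) unfolding \<delta>_def \<tau>_def by (cases "\<alpha> < \<beta>"; simp)+
  then have cpos: "0 < cos \<delta>" by (simp add: cos_gt_zero_pi)
  have a: "cis \<alpha> * cis (- \<omega>) = cis \<delta>"
    unfolding cis_mult by (rule arg_cong[of _ _ cis]) (simp add: \<delta>_def \<omega>_def field_simps)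
  have "- cis \<beta> = cis (\<beta> + \<tau>)" unfolding \<tau>_def by (simp add: complex_eq_iff)
  moreover have "cis (\<beta> + \<tau>) * cis (- \<omega>) = cis (- \<delta>)"
    unfolding cis_mult by (rule arg_cong[of _ _ cis]) (simp add: \<delta>_def \<omega>_def field_simps)
  ultimately have b: "- cis \<beta> * cis (- \<omega>) = cis (- \<delta>)" by simp
  have polar: "Ln (of_real r * cis x) = of_real (ln r) + \<i> * x" if "0 < r" "- (pi/2) < x" "x < pi/2" for r x
  proof (rule Ln_unique)
    show "exp (of_real (ln r) + \<i> * of_real x) = of_real r * cis x"
      using that by (simp add: exp_add cis_conv_exp exp_of_real)
  qed (use that in auto)
  show thesis
  proof (rule that[of \<omega>])
    fix \<rho> \<sigma> :: real assume rs: "0 \<le> \<rho>" "0 \<le> \<sigma>" "0 < \<rho> + \<sigma>"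
    have "(of_real \<rho> * cis \<alpha> - of_real \<sigma> * cis \<beta>) * cis (- \<omega>) =
        of_real \<rho> * (cis \<alpha> * cis (- \<omega>)) + of_real \<sigma> * (- cis \<beta> * cis (- \<omega>))"
      by (simp only: left_diff_distrib) simp
    also have "\<dots> = of_real \<rho> * cis \<delta> + of_real \<sigma> * cis (- \<delta>)" by (simp only: a b)
    finally have "Re ((of_real \<rho> * cis \<alpha> - of_real \<sigma> * cis \<beta>) * cis (- \<omega>)) = (\<rho> + \<sigma>) * cos \<delta>"
      by (simp add: algebra_simps)
    then show "0 < Re ((of_real \<rho> * cis \<alpha> - of_real \<sigma> * cis \<beta>) * cis (- \<omega>))"
      using cpos rs by simp
  next
    fix \<rho> :: real assume "0 < \<rho>"
    then have "Ln (of_real \<rho> * cis \<alpha> * cis (- \<omega>)) = of_real (ln \<rho>) + \<i> * \<delta>"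
      using polar[of \<rho> \<delta>] \<delta> by (simp only: mult.assoc a)
    then show "Ln (of_real \<rho> * cis \<alpha> * cis (- \<omega>)) + \<i> * \<omega> = of_real (ln \<rho>) + \<i> * \<alpha>"
      by (simp add: \<delta>_def \<omega>_def field_simps)
  next
    fix \<sigma> :: real assume "0 < \<sigma>"
    have "- (of_real \<sigma> * cis \<beta>) * cis (- \<omega>) = of_real \<sigma> * (- cis \<beta> * cis (- \<omega>))" by simp
    also have "\<dots> = of_real \<sigma> * cis (- \<delta>)" by (simp only: b)
    finally have "Ln (- (of_real \<sigma> * cis \<beta>) * cis (- \<omega>)) = of_real (ln \<sigma>) - \<i> * \<delta>"
      using polar[of \<sigma> "- \<delta>"] \<delta> \<open>0 < \<sigma>\<close> by simp
    then show "Ln (- (of_real \<sigma> * cis \<beta>) * cis (- \<omega>)) + \<i> * \<omega> = of_real (ln \<sigma>) + \<i> * (\<beta> + \<tau>)"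
      by (simp add: \<delta>_def \<omega>_def field_simps)
  qed
qed

text \<open>Both paths run along rays, so \<open>g\<close> differs by a constant from
  \<open>M\<close> plus the exponent of the quasi-period of the shift \<open>(n, j)\<close>. The
  result is arranged so that every \<open>M\<close> term involves a single ray; such terms cancel
  when the four corners are combined. The mutual position of the two rays survives only as
  \<open>K * of_bool (\<alpha> < \<beta>)\<close>.\<close>

lemma corner_log:
  fixes g :: "real \<times> real \<Rightarrow> complex" and n j K :: int
  defines "C e \<equiv> {0..e} \<times> {0..e} - {(0, 0)}"
  assumes k: "lifted_disc k" and M: "configuration_log k M"
    and per: "\<forall>c\<in>cball 0 (1/2). \<forall>w. Re w \<le> 0 \<longrightarrow>
      M (c, w + 2 * pi * \<i>) = M (c, w) + 2 * pi * \<i> * of_int K"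
    and e: "0 < e"
    and \<rho>: "continuous_on {0..e} \<rho>" "\<rho> 0 = 0" "\<And>s. 0 < s \<Longrightarrow> s \<le> e \<Longrightarrow> 0 < \<rho> s \<and> \<rho> s \<le> 1/2"
    and \<sigma>: "continuous_on {0..e} \<sigma>" "\<sigma> 0 = 0" "\<And>s. 0 < s \<Longrightarrow> s \<le> e \<Longrightarrow> 0 < \<sigma> s \<and> \<sigma> s \<le> 1/2"
    and angles: "0 \<le> \<alpha>" "\<alpha> < 2 * pi" "0 \<le> \<beta>" "\<beta> < 2 * pi" "\<alpha> \<noteq> \<beta>"
    and g: "continuous_on (C e) g"
    and eg: "\<And>s t. (s, t) \<in> C e \<Longrightarrow> exp (g (s, t)) =
      torus_section (k (of_real (\<rho> s) * cis \<alpha>) - k (of_real (\<sigma> t) * cis \<beta>) + (of_int n, of_int j))"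
  shows "g (e, 0) - g (0, e) =
      M (of_real (\<rho> e) * cis \<alpha> / 2, of_real (ln (\<rho> e)) + \<i> * \<alpha>)
    - M (of_real (\<sigma> e) * cis \<beta> / 2, of_real (ln (\<sigma> e)) + \<i> * (\<beta> + pi))
    + 2 * pi * \<i> * of_int (K * of_bool (\<alpha> < \<beta>))
    + 2 * pi * \<i> * of_int j * (of_real (fst (k (of_real (\<rho> e) * cis \<alpha>))) + of_real (fst (k (of_real (\<sigma> e) * cis \<beta>))) - 2 * of_real (fst (k 0)))"
proof -
  define x where "x s = of_real (\<rho> s) * cis \<alpha>" for s
  define y where "y t = of_real (\<sigma> t) * cis \<beta>" for t
  let ?W = "cball 0 (1/2) \<times> {w. Re w \<le> 0} :: (complex \<times> complex) set"
  obtain \<omega> where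
    \<omega>1: "\<And>\<rho> \<sigma>. 0 \<le> \<rho> \<Longrightarrow> 0 \<le> \<sigma> \<Longrightarrow> 0 < \<rho> + \<sigma> \<Longrightarrow>
       0 < Re ((of_real \<rho> * cis \<alpha> - of_real \<sigma> * cis \<beta>) * cis (- \<omega>))"
    and \<omega>2: "\<And>\<rho>. 0 < \<rho> \<Longrightarrow> Ln (of_real \<rho> * cis \<alpha> * cis (- \<omega>)) + \<i> * \<omega> = of_real (ln \<rho>) + \<i> * \<alpha>"
    and \<omega>3: "\<And>\<sigma>. 0 < \<sigma> \<Longrightarrow> Ln (- (of_real \<sigma> * cis \<beta>) * cis (- \<omega>)) + \<i> * \<omega> =
        of_real (ln \<sigma>) + \<i> * (\<beta> + (if \<alpha> < \<beta> then - pi else pi))"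
    using difference_of_rays_log[OF angles] by blast
  have contk: "continuous_on (cball 0 1) k" using k by (simp add: lifted_disc_def)
  have contM: "continuous_on ?W M"
    and eM: "\<And>c w. c \<in> cball 0 (1/2) \<Longrightarrow> Re w \<le> 0 \<Longrightarrow>
        exp (M (c, w)) = torus_section (k (c + exp w / 2) - k (c - exp w / 2))"
    using M by (auto simp: configuration_log_def)
  have \<rho>': "0 \<le> \<rho> s" "\<rho> s \<le> 1/2" if "0 \<le> s" "s \<le> e" for s
    using \<rho>(2) \<rho>(3)[of s] that by (cases "s = 0"; simp)+
  have \<sigma>': "0 \<le> \<sigma> s" "\<sigma> s \<le> 1/2" if "0 \<le> s" "s \<le> e" for s
    using \<sigma>(2) \<sigma>(3)[of s] that by (cases "s = 0"; simp)+
  have nx: "norm (x s) \<le> 1/2" if "0 \<le> s" "s \<le> e" for s using \<rho>'[OF that] by (simp add: x_def norm_mult)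
  have ny: "norm (y s) \<le> 1/2" if "0 \<le> s" "s \<le> e" for s using \<sigma>'[OF that] by (simp add: y_def norm_mult)
  have contx: "continuous_on {0..e} x" unfolding x_def by (intro continuous_intros \<rho>)
  have conty: "continuous_on {0..e} y" unfolding y_def by (intro continuous_intros \<sigma>)
  have conn: "connected (C e)" unfolding C_def
    by (intro convex_connected convex_square_minus_corners) auto
  have contxC: "continuous_on (C e) (\<lambda>z. x (fst z))"
    by (rule continuous_on_compose2[OF contx]) (auto simp: C_def intro!: continuous_intros)
  have contyC: "continuous_on (C e) (\<lambda>z. y (snd z))"
    by (rule continuous_on_compose2[OF conty]) (auto simp: C_def intro!: continuous_intros)
  \<comment> \<open>A continuous logarithm of the difference of the two points of the disc, so that
    midpoint and \<open>w\<close> are arguments for \<open>M\<close>.\<close>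
  define w where "w = (\<lambda>z. Ln ((x (fst z) - y (snd z)) * cis (- \<omega>)) + \<i> * \<omega>)"
  have Cz: "0 \<le> fst z" "fst z \<le> e" "0 \<le> snd z" "snd z \<le> e" "0 < fst z \<or> 0 < snd z" if "z \<in> C e" for z
    using that by (auto simp: C_def)
  have Repos: "0 < Re ((x (fst z) - y (snd z)) * cis (- \<omega>))" if "z \<in> C e" for z
    unfolding x_def y_def
  proof (rule \<omega>1)
    note z = Cz[OF that]
    show "0 < \<rho> (fst z) + \<sigma> (snd z)"
      using z(5) \<rho>(3)[of "fst z"] \<sigma>(3)[of "snd z"] \<rho>'[OF z(1,2)] \<sigma>'[OF z(3,4)] z by auto
  qed (use Cz[OF that] \<rho>' \<sigma>' in auto)
  have contw: "continuous_on (C e) w" unfolding w_def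
    by (intro continuous_intros contxC contyC) (metis Repos complex_nonpos_Reals_iff not_less)
  have nz: "(x (fst z) - y (snd z)) * cis (- \<omega>) \<noteq> 0" if "z \<in> C e" for z
    using Repos[OF that] by auto
  have ew: "exp (w z) = x (fst z) - y (snd z)" if "z \<in> C e" for z
  proof -
    have "exp (w z) = (x (fst z) - y (snd z)) * cis (- \<omega>) * cis \<omega>"
      using nz[OF that] by (simp only: w_def exp_add exp_Ln cis_conv_exp[symmetric] not_False_eq_True)
    also have "\<dots> = x (fst z) - y (snd z)" by (simp only: mult.assoc cis_mult) simp
    finally show ?thesis .
  qed
  have inW: "((x (fst z) + y (snd z)) / 2, w z) \<in> ?W" if "z \<in> C e" for z
  proof -
    note n = nx[OF Cz(1,2)[OF that]] ny[OF Cz(3,4)[OF that]]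
    have "norm (x (fst z) + y (snd z)) \<le> 1" using n norm_triangle_ineq[of "x (fst z)" "y (snd z)"] by linarith
    moreover have "exp (Re (w z)) = norm (x (fst z) - y (snd z))" using ew[OF that] by (metis norm_exp_eq_Re)
    then have "exp (Re (w z)) \<le> 1" using n norm_triangle_ineq4[of "x (fst z)" "y (snd z)"] by linarith
    ultimately show ?thesis by (simp add: norm_divide)
  qed
  define G where "G = (\<lambda>z. M ((x (fst z) + y (snd z)) / 2, w z) +
      \<i> * pi * (of_int (n + j) + 2 * of_int j * of_real (fst (k (x (fst z)) - k (y (snd z))))))"
  have "g (e, 0) - g (0, e) = G (e, 0) - G (0, e)"
  proof (rule continuous_logs_diff_eq[OF conn g])
    have kx: "continuous_on (C e) (\<lambda>z. k (x (fst z)))"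
      by (rule continuous_on_compose2[OF contk contxC]) (auto simp: C_def intro!: order_trans[OF nx])
    have ky: "continuous_on (C e) (\<lambda>z. k (y (snd z)))"
      by (rule continuous_on_compose2[OF contk contyC]) (auto simp: C_def intro!: order_trans[OF ny])
    have "continuous_on (C e) (\<lambda>z. M ((x (fst z) + y (snd z)) / 2, w z))"
      by (rule continuous_on_compose2[OF contM]) (use inW in \<open>auto intro!: continuous_intros contxC contyC contw\<close>)
    then show "continuous_on (C e) G" unfolding G_def
      by (intro continuous_intros kx ky)
    show "exp (g z) = exp (G z)" if z: "z \<in> C e" for z
    proof -
      have "exp (M ((x (fst z) + y (snd z)) / 2, w z)) = torus_section (k (x (fst z)) - k (y (snd z)))"
        using eM[of "(x (fst z) + y (snd z)) / 2" "w z"] inW[OF z] ew[OF z] by (simp add: field_simps)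
      moreover have "exp (g z) = torus_section (k (x (fst z)) - k (y (snd z)) + (of_int n, of_int j))"
        using eg[of "fst z" "snd z"] z by (simp add: x_def y_def)
      ultimately show ?thesis unfolding torus_section_shift G_def exp_add by (simp only: mult.commute)
    qed
    show "(e, 0) \<in> C e" "(0, e) \<in> C e" using e by (auto simp: C_def)
  qed
  also have "\<dots> = M (x e / 2, w (e, 0)) - M (y e / 2, w (0, e)) +
      2 * pi * \<i> * of_int j * (of_real (fst (k (x e))) + of_real (fst (k (y e))) - 2 * of_real (fst (k 0)))"
    using \<rho>(2) \<sigma>(2) by (simp add: G_def x_def y_def algebra_simps)
  also have "w (e, 0) = of_real (ln (\<rho> e)) + \<i> * \<alpha>"
    using \<omega>2[of "\<rho> e"] \<rho>(3)[of e] \<sigma>(2) e by (simp add: w_def x_def y_def)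
  also have "w (0, e) = of_real (ln (\<sigma> e)) + \<i> * (\<beta> + (if \<alpha> < \<beta> then - pi else pi))"
    using \<omega>3[of "\<sigma> e"] \<sigma>(3)[of e] \<rho>(2) e by (simp add: w_def x_def y_def)
  \<comment> \<open>To express the term by the ray \<beta> alone, the angle
    \<open>\<beta> - pi\<close> is replaced by \<open>\<beta> + pi\<close>; this full turn costs one
    period of \<open>M\<close>.\<close>
  also have "M (y e / 2, of_real (ln (\<sigma> e)) + \<i> * (\<beta> + (if \<alpha> < \<beta> then - pi else pi))) =
      M (y e / 2, of_real (ln (\<sigma> e)) + \<i> * (\<beta> + pi)) - 2 * pi * \<i> * of_int (K * of_bool (\<alpha> < \<beta>))"
  proof (cases "\<alpha> < \<beta>")
    case True
    have "y e / 2 \<in> cball 0 (1/2)" using ny[of e] e by (simp add: norm_divide)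
    moreover have "Re (of_real (ln (\<sigma> e)) + \<i> * (\<beta> - pi)) \<le> 0" using \<sigma>(3)[of e] e by simp
    ultimately have "M (y e / 2, of_real (ln (\<sigma> e)) + \<i> * (\<beta> - pi) + 2 * pi * \<i>) =
        M (y e / 2, of_real (ln (\<sigma> e)) + \<i> * (\<beta> - pi)) + 2 * pi * \<i> * of_int K" using per by blast
    moreover have "of_real (ln (\<sigma> e)) + \<i> * (\<beta> - pi) + 2 * pi * \<i> = of_real (ln (\<sigma> e)) + \<i> * (\<beta> + pi)"
      by (simp add: algebra_simps)
    ultimately have "M (y e / 2, of_real (ln (\<sigma> e)) + \<i> * (\<beta> + pi)) =
        M (y e / 2, of_real (ln (\<sigma> e)) + \<i> * (\<beta> - pi)) + 2 * pi * \<i> * of_int K" by (simp only:)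
    then show ?thesis using True by simp
  qed simp
  finally show ?thesis by (simp add: x_def y_def)
qed

text \<open>
  The path \<open>a\<close> is the lift to the plane of a closed curve with homology class \<open>(p, q)\<close> which leaves
  the vertex along the ray \<open>\<alpha>1\<close> and returns along the ray \<open>\<alpha>2\<close> of the disc \<open>k\<close>; the distances \<open>\<rho>1\<close>
  and \<open>\<rho>2\<close> from the vertex need not be monotone.
\<close>

definition radial_loop ::
  "(complex \<Rightarrow> real \<times> real) \<Rightarrow> (real \<Rightarrow> real \<times> real) \<Rightarrow> int \<Rightarrow> int \<Rightarrow> real \<Rightarrow>
    (real \<Rightarrow> real) \<Rightarrow> real \<Rightarrow> (real \<Rightarrow> real) \<Rightarrow> real \<Rightarrow> bool" where
  "radial_loop k a p q e \<rho>1 \<alpha>1 \<rho>2 \<alpha>2 \<longleftrightarrow>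
     continuous_on {0..1} a \<and> a 0 = k 0 \<and> a 1 = k 0 + (of_int p, of_int q) \<and>
     0 < e \<and> e < 1/2 \<and>
     continuous_on {0..e} \<rho>1 \<and> continuous_on {0..e} \<rho>2 \<and> \<rho>1 0 = 0 \<and> \<rho>2 0 = 0 \<and>
     (\<forall>s. 0 < s \<and> s \<le> e \<longrightarrow> 0 < \<rho>1 s \<and> \<rho>1 s \<le> 1/2 \<and> 0 < \<rho>2 s \<and> \<rho>2 s \<le> 1/2) \<and>
     (\<forall>s. 0 \<le> s \<and> s \<le> e \<longrightarrow> a s = k (of_real (\<rho>1 s) * cis \<alpha>1) \<and>
        a (1 - s) = k (of_real (\<rho>2 s) * cis \<alpha>2) + (of_int p, of_int q))"

lemma radial_loop_mono:
  assumes "radial_loop k a p q e \<rho>1 \<alpha>1 \<rho>2 \<alpha>2" "0 < e'" "e' \<le> e"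
  shows "radial_loop k a p q e' \<rho>1 \<alpha>1 \<rho>2 \<alpha>2"
proof -
  have "{0..e'} \<subseteq> {0..e}" using assms(3) by auto
  then show ?thesis using assms unfolding radial_loop_def by (auto intro: continuous_on_subset)
qed

text \<open>
  The function \<open>torus_section (a s - b t)\<close> vanishes on the unit square only at the corners, and the
  square without its corners is convex, so there is a logarithm. Opposite sides of the square differ by
  the quasi-periods, which yields the determinant of the homology classes; the four corners
  yield an odd multiple of the linking of the four rays.
\<close>

lemma radial_loops_intersection:
  assumes k: "lifted_disc k"
    and A: "radial_loop k a p q e \<rho>1 \<alpha>1 \<rho>2 \<alpha>2"
    and B: "radial_loop k b r m e \<sigma>1 \<beta>1 \<sigma>2 \<beta>2"
    and meet: "\<And>s t. s \<in> {0..1} \<Longrightarrow> t \<in> {0..1} \<Longrightarrow> fst (a s - b t) \<in> \<int> \<Longrightarrow> snd (a s - b t) \<in> \<int> \<Longrightarrow>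
        s \<in> {0, 1} \<and> t \<in> {0, 1}"
    and ang: "{\<alpha>1, \<alpha>2, \<beta>1, \<beta>2} \<subseteq> {0..<2 * pi}" "{\<alpha>1, \<alpha>2} \<inter> {\<beta>1, \<beta>2} = {}"
  shows "odd (q * r - m * p) \<longleftrightarrow> odd (of_bool (\<alpha>1 < \<beta>1) + of_bool (\<alpha>2 < \<beta>2) - of_bool (\<alpha>1 < \<beta>2) - of_bool (\<alpha>2 < \<beta>1) :: int)"
proof -
  obtain M where M: "configuration_log k M" using configuration_log_exists[OF k] .
  obtain K :: int where "odd K" and per: "\<forall>c\<in>cball 0 (1/2). \<forall>w. Re w \<le> 0 \<longrightarrow>
      M (c, w + 2 * pi * \<i>) = M (c, w) + 2 * pi * \<i> * of_int K"
    using configuration_log_period[OF M] by (metis (no_types, lifting))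
  from A have a: "continuous_on {0..1} a" "a 0 = k 0" "a 1 = k 0 + (of_int p, of_int q)"
    "\<And>s. 0 \<le> s \<Longrightarrow> s \<le> e \<Longrightarrow> a s = k (of_real (\<rho>1 s) * cis \<alpha>1)"
    "\<And>s. 0 \<le> s \<Longrightarrow> s \<le> e \<Longrightarrow> a (1 - s) = k (of_real (\<rho>2 s) * cis \<alpha>2) + (of_int p, of_int q)"
    and \<rho>1: "continuous_on {0..e} \<rho>1" "\<rho>1 0 = 0" "\<And>s. 0 < s \<Longrightarrow> s \<le> e \<Longrightarrow> 0 < \<rho>1 s \<and> \<rho>1 s \<le> 1/2"
    and \<rho>2: "continuous_on {0..e} \<rho>2" "\<rho>2 0 = 0" "\<And>s. 0 < s \<Longrightarrow> s \<le> e \<Longrightarrow> 0 < \<rho>2 s \<and> \<rho>2 s \<le> 1/2"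
    and e: "0 < e" "e < 1/2"
    unfolding radial_loop_def by simp_all
  from B have b: "continuous_on {0..1} b" "b 0 = k 0" "b 1 = k 0 + (of_int r, of_int m)"
    "\<And>s. 0 \<le> s \<Longrightarrow> s \<le> e \<Longrightarrow> b s = k (of_real (\<sigma>1 s) * cis \<beta>1)"
    "\<And>s. 0 \<le> s \<Longrightarrow> s \<le> e \<Longrightarrow> b (1 - s) = k (of_real (\<sigma>2 s) * cis \<beta>2) + (of_int r, of_int m)"
    and \<sigma>1: "continuous_on {0..e} \<sigma>1" "\<sigma>1 0 = 0" "\<And>s. 0 < s \<Longrightarrow> s \<le> e \<Longrightarrow> 0 < \<sigma>1 s \<and> \<sigma>1 s \<le> 1/2"
    and \<sigma>2: "continuous_on {0..e} \<sigma>2" "\<sigma>2 0 = 0" "\<And>s. 0 < s \<Longrightarrow> s \<le> e \<Longrightarrow> 0 < \<sigma>2 s \<and> \<sigma>2 s \<le> 1/2"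
    unfolding radial_loop_def by simp_all
  define U where "U = {0..1::real} \<times> {0..1::real} - {0, 1} \<times> {0, 1}"
  define \<phi> where "\<phi> = (\<lambda>z. torus_section (a (fst z) - b (snd z)))"
  have "continuous_on U (\<lambda>z. a (fst z) - b (snd z))"
    by (intro continuous_intros continuous_on_compose2[OF a(1)] continuous_on_compose2[OF b(1)])
      (auto simp: U_def)
  then have "continuous_on U \<phi>" unfolding \<phi>_def
    by (rule continuous_on_compose2[OF continuous_torus_section]) simp
  moreover have "contractible U" unfolding U_def
    by (intro convex_imp_contractible convex_square_minus_corners) simp
  moreover have "\<phi> z \<noteq> 0" if "z \<in> U" for z
    using meet[of "fst z" "snd z"] that unfolding \<phi>_def torus_section_zero_iff U_def mem_Times_iff Diff_iff by blast
  ultimately obtain g where g: "continuous_on U g" "\<And>z. z \<in> U \<Longrightarrow> \<phi> z = exp (g z)"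
    using continuous_logarithm_on_contractible[of U \<phi>] by blast
  have eg: "exp (g (s, t)) = torus_section (a s - b t)" if "(s, t) \<in> U" for s t
    using g(2)[OF that] by (simp add: \<phi>_def)
  define C where "C = {0..e} \<times> {0..e} - {(0, 0)}"
  have CU: "(s, t) \<in> U" "(1 - s, t) \<in> U" "(s, 1 - t) \<in> U" "(1 - s, 1 - t) \<in> U"
    if "(s, t) \<in> C" for s t
    using that e by (auto simp: C_def U_def)
  have Ce: "0 \<le> s" "s \<le> e" "0 \<le> t" "t \<le> e" if "(s, t) \<in> C" for s t using that by (auto simp: C_def)
  have ang': "0 \<le> \<alpha>1" "\<alpha>1 < 2 * pi" "0 \<le> \<alpha>2" "\<alpha>2 < 2 * pi"
    "0 \<le> \<beta>1" "\<beta>1 < 2 * pi" "0 \<le> \<beta>2" "\<beta>2 < 2 * pi"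
    "\<alpha>1 \<noteq> \<beta>1" "\<alpha>1 \<noteq> \<beta>2" "\<alpha>2 \<noteq> \<beta>1" "\<alpha>2 \<noteq> \<beta>2" using ang by auto
  define x1 x2 y1 y2 o' where "x1 = complex_of_real (fst (k (of_real (\<rho>1 e) * cis \<alpha>1)))"
    and "x2 = complex_of_real (fst (k (of_real (\<rho>2 e) * cis \<alpha>2)))"
    and "y1 = complex_of_real (fst (k (of_real (\<sigma>1 e) * cis \<beta>1)))"
    and "y2 = complex_of_real (fst (k (of_real (\<sigma>2 e) * cis \<beta>2)))"
    and "o' = complex_of_real (fst (k 0))"
  define X1 X2 Y1 Y2 where "X1 = M (of_real (\<rho>1 e) * cis \<alpha>1 / 2, of_real (ln (\<rho>1 e)) + \<i> * \<alpha>1)"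
    and "X2 = M (of_real (\<rho>2 e) * cis \<alpha>2 / 2, of_real (ln (\<rho>2 e)) + \<i> * \<alpha>2)"
    and "Y1 = M (of_real (\<sigma>1 e) * cis \<beta>1 / 2, of_real (ln (\<sigma>1 e)) + \<i> * (\<beta>1 + pi))"
    and "Y2 = M (of_real (\<sigma>2 e) * cis \<beta>2 / 2, of_real (ln (\<sigma>2 e)) + \<i> * (\<beta>2 + pi))"
  have contC: "continuous_on C (\<lambda>z. g (u (fst z), v (snd z)))"
    if "continuous_on {0..e} u" "continuous_on {0..e} v" "\<And>s t. (s, t) \<in> C \<Longrightarrow> (u s, v t) \<in> U" for u v :: "real \<Rightarrow> real"
  proof (rule continuous_on_compose2[OF g(1)])
    show "continuous_on C (\<lambda>z. (u (fst z), v (snd z)))"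
      by (intro continuous_intros continuous_on_compose2[OF that(1)] continuous_on_compose2[OF that(2)])
        (auto simp: C_def)
    show "(\<lambda>z. (u (fst z), v (snd z))) ` C \<subseteq> U" using that(3) by fastforce
  qed
  note corner = corner_log[OF k M per e(1), folded C_def]
  \<comment> \<open>At the corners the germs are compared after a lattice shift: none at (0, 0), the
    class of \<open>a\<close> at (1, 0), minus that of \<open>b\<close> at (0, 1), and their
    difference at (1, 1). Only its second component appears in the formulas.\<close>
  have c00: "g (e, 0) - g (0, e) = X1 - Y1 + 2 * pi * \<i> * of_int (K * of_bool (\<alpha>1 < \<beta>1))
      + 2 * pi * \<i> * of_int 0 * (x1 + y1 - 2 * o')"
  proof -
    have "exp (g (s, t)) = torus_section (k (of_real (\<rho>1 s) * cis \<alpha>1) - k (of_real (\<sigma>1 t) * cis \<beta>1)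
        + (of_int 0, of_int 0))" if "(s, t) \<in> C" for s t
      using eg[OF CU(1)[OF that]] a(4)[OF Ce(1,2)[OF that]] b(4)[OF Ce(3,4)[OF that]] by (simp add: zero_prod_def[symmetric])
    then show ?thesis
      using corner[OF \<rho>1 \<sigma>1 ang'(1,2,5,6,9), of "\<lambda>z. g (fst z, snd z)" 0 0]
        contC[of "\<lambda>s. s" "\<lambda>s. s"] CU(1)
      unfolding X1_def Y1_def x1_def y1_def o'_def by (simp add: continuous_on_id)
  qed
  have c10: "g (1 - e, 0) - g (1, e) = X2 - Y1 + 2 * pi * \<i> * of_int (K * of_bool (\<alpha>2 < \<beta>1))
      + 2 * pi * \<i> * of_int q * (x2 + y1 - 2 * o')"
  proof -
    have "exp (g (1 - s, t)) = torus_section (k (of_real (\<rho>2 s) * cis \<alpha>2) - k (of_real (\<sigma>1 t) * cis \<beta>1)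
        + (of_int p, of_int q))" if "(s, t) \<in> C" for s t
      using eg[OF CU(2)[OF that]] a(5)[OF Ce(1,2)[OF that]] b(4)[OF Ce(3,4)[OF that]] by (simp add: algebra_simps)
    then show ?thesis
      using corner[OF \<rho>2 \<sigma>1 ang'(3,4,5,6,11), of "\<lambda>z. g (1 - fst z, snd z)" p q]
        contC[of "\<lambda>s. 1 - s" "\<lambda>s. s"] CU(2)
      unfolding X2_def Y1_def x2_def y1_def o'_def by (simp add: continuous_on_id continuous_on_op_minus)
  qed
  have c01: "g (e, 1) - g (0, 1 - e) = X1 - Y2 + 2 * pi * \<i> * of_int (K * of_bool (\<alpha>1 < \<beta>2))
      + 2 * pi * \<i> * of_int (- m) * (x1 + y2 - 2 * o')"
  proof -
    have "exp (g (s, 1 - t)) = torus_section (k (of_real (\<rho>1 s) * cis \<alpha>1) - k (of_real (\<sigma>2 t) * cis \<beta>2)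
        + (of_int (- r), of_int (- m)))" if "(s, t) \<in> C" for s t
    proof -
      have "a s - b (1 - t) = k (of_real (\<rho>1 s) * cis \<alpha>1) - k (of_real (\<sigma>2 t) * cis \<beta>2)
        + (of_int (- r), of_int (- m))"
        using a(4)[OF Ce(1,2)[OF that]] b(5)[OF Ce(3,4)[OF that]] by (simp add: prod_eq_iff)
      with eg[OF CU(3)[OF that]] show ?thesis by (simp only:)
    qed
    then show ?thesis
      using corner[OF \<rho>1 \<sigma>2 ang'(1,2,7,8,10), of "\<lambda>z. g (fst z, 1 - snd z)" "- r" "- m"]
        contC[of "\<lambda>s. s" "\<lambda>s. 1 - s"] CU(3)
      unfolding X1_def Y2_def x1_def y2_def o'_def by (simp add: continuous_on_id continuous_on_op_minus)
  qed
  have c11: "g (1 - e, 1) - g (1, 1 - e) = X2 - Y2 + 2 * pi * \<i> * of_int (K * of_bool (\<alpha>2 < \<beta>2))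
      + 2 * pi * \<i> * of_int (q - m) * (x2 + y2 - 2 * o')"
  proof -
    have "exp (g (1 - s, 1 - t)) = torus_section (k (of_real (\<rho>2 s) * cis \<alpha>2) - k (of_real (\<sigma>2 t) * cis \<beta>2)
        + (of_int (p - r), of_int (q - m)))" if "(s, t) \<in> C" for s t
    proof -
      have "a (1 - s) - b (1 - t) = k (of_real (\<rho>2 s) * cis \<alpha>2) - k (of_real (\<sigma>2 t) * cis \<beta>2)
        + (of_int (p - r), of_int (q - m))"
        using a(5)[OF Ce(1,2)[OF that]] b(5)[OF Ce(3,4)[OF that]] by (simp add: prod_eq_iff)
      with eg[OF CU(4)[OF that]] show ?thesis by (simp only:)
    qed
    then show ?thesis
      using corner[OF \<rho>2 \<sigma>2 ang'(3,4,7,8,12), of "\<lambda>z. g (1 - fst z, 1 - snd z)" "p - r" "q - m"]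
        contC[of "\<lambda>s. 1 - s" "\<lambda>s. 1 - s"] CU(4)
      unfolding X2_def Y2_def x2_def y2_def o'_def by (simp add: continuous_on_op_minus)
  qed
  have conn: "connected {0<..<1::real}" by simp
  have inI: "e \<in> {0<..<1}" "1 - e \<in> {0<..<1}" using e by auto
  have side: "continuous_on {0<..<1} (\<lambda>s. g (s, c))" "continuous_on {0<..<1} (\<lambda>s. g (c, s))"
    if "c \<in> {0, 1}" for c
    by (rule continuous_on_compose2[OF g(1)]; use that in \<open>force simp: U_def intro!: continuous_intros\<close>)+
  have UI: "(s, 0) \<in> U" "(s, 1) \<in> U" "(0, s) \<in> U" "(1, s) \<in> U" if "s \<in> {0<..<1}" for s
    using that by (auto simp: U_def)
  have conta: "continuous_on {0<..<1} a" "continuous_on {0<..<1} b"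
    by (rule continuous_on_subset[OF a(1)] continuous_on_subset[OF b(1)]; auto)+
  \<comment> \<open>Replacing \<open>b 0\<close> by \<open>b 1\<close> translates the argument of
    the section by the negative class of \<open>b\<close>, so the logarithms on the top and bottom
    sides differ by the exponent of a quasi-period. The vertical sides are treated alike with the
    class of \<open>a\<close>.\<close>
  have horizontal: "g (e, 1) - g (1 - e, 1) =
      (g (e, 0) + \<i> * pi * (of_int (- r - m) + 2 * of_int (- m) * of_real (fst (a e - k 0)))) -
      (g (1 - e, 0) + \<i> * pi * (of_int (- r - m) + 2 * of_int (- m) * of_real (fst (a (1 - e) - k 0))))"
  proof (rule continuous_logs_diff_eq[OF conn _ _ _ inI])
    fix s :: real assume s: "s \<in> {0<..<1}"
    have "a s - b 1 = (a s - k 0) + (of_int (- r), of_int (- m))" using b(3) by (simp add: prod_eq_iff)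
    then have "exp (g (s, 1)) = torus_section ((a s - k 0) + (of_int (- r), of_int (- m)))"
      using eg[OF UI(2)[OF s]] by (simp only:)
    moreover have "exp (g (s, 0)) = torus_section (a s - k 0)" using eg[OF UI(1)[OF s]] b(2) by simp
    ultimately show "exp (g (s, 1)) =
        exp (g (s, 0) + \<i> * pi * (of_int (- r - m) + 2 * of_int (- m) * of_real (fst (a s - k 0))))"
      unfolding torus_section_shift exp_add by (simp add: mult.commute)
  qed (intro continuous_intros side conta; simp)+
  have vertical: "g (1, e) - g (1, 1 - e) =
      (g (0, e) + \<i> * pi * (of_int (p + q) + 2 * of_int q * of_real (fst (k 0 - b e)))) -
      (g (0, 1 - e) + \<i> * pi * (of_int (p + q) + 2 * of_int q * of_real (fst (k 0 - b (1 - e)))))"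
  proof (rule continuous_logs_diff_eq[OF conn _ _ _ inI])
    fix s :: real assume s: "s \<in> {0<..<1}"
    have "a 1 - b s = (k 0 - b s) + (of_int p, of_int q)" using a(3) by (simp add: prod_eq_iff)
    then have "exp (g (1, s)) = torus_section ((k 0 - b s) + (of_int p, of_int q))"
      using eg[OF UI(4)[OF s]] by (simp only:)
    moreover have "exp (g (0, s)) = torus_section (k 0 - b s)" using eg[OF UI(3)[OF s]] a(2) by simp
    ultimately show "exp (g (1, s)) =
        exp (g (0, s) + \<i> * pi * (of_int (p + q) + 2 * of_int q * of_real (fst (k 0 - b s))))"
      unfolding torus_section_shift exp_add by (simp add: mult.commute)
  qed (intro continuous_intros side conta; simp)+
  have ends: "complex_of_real (fst (a e)) = x1" "complex_of_real (fst (a (1 - e))) = x2 + of_int p"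
    "complex_of_real (fst (b e)) = y1" "complex_of_real (fst (b (1 - e))) = y2 + of_int r"
    using a(4)[of e] a(5)[of e] b(4)[of e] b(5)[of e] e by (simp_all add: x1_def x2_def y1_def y2_def)
  define \<kappa> :: int where
    "\<kappa> = of_bool (\<alpha>1 < \<beta>1) + of_bool (\<alpha>2 < \<beta>2) - of_bool (\<alpha>1 < \<beta>2) - of_bool (\<alpha>2 < \<beta>1)"
  \<comment> \<open>The terms depending on where the sides are cut at distance \<open>e\<close> from
    the corners; sides and corners contribute the same amount.\<close>
  define T where "T = 2 * pi * \<i> * (of_int q * (y2 - y1) + of_int m * (x1 - x2))"
  have "2 * pi * \<i> * of_int (q * r - m * p) =
      (g (1, e) - g (1, 1 - e)) - (g (0, e) - g (0, 1 - e)) -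
      ((g (e, 1) - g (1 - e, 1)) - (g (e, 0) - g (1 - e, 0))) - T"
    unfolding horizontal vertical fst_diff of_real_diff ends T_def by (simp add: algebra_simps)
  \<comment> \<open>The same eight values, regrouped by corners instead of sides. In the alternating
    sum \<open>X1\<close>, \<open>X2\<close>, \<open>Y1\<close>, \<open>Y2\<close> and
    \<open>o'\<close> cancel.\<close>
  also have "\<dots> = (g (e, 0) - g (0, e)) - (g (1 - e, 0) - g (1, e)) - (g (e, 1) - g (0, 1 - e))
      + (g (1 - e, 1) - g (1, 1 - e)) - T"
    by simp
  also have "\<dots> = 2 * pi * \<i> * of_int (K * \<kappa>)"
    unfolding c00 c10 c01 c11 T_def \<kappa>_def of_int_mult of_int_add of_int_diff by (simp add: algebra_simps)
  finally have "2 * pi * \<i> * of_int (q * r - m * p) = 2 * pi * \<i> * of_int (K * \<kappa>)" .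
  then have "of_int (q * r - m * p) = (of_int (K * \<kappa>) :: complex)" by simp
  then have "q * r - m * p = K * \<kappa>" by (simp only: of_int_eq_iff)
  then show ?thesis using \<open>odd K\<close> unfolding \<kappa>_def[symmetric] by simp
qed

section \<open>Lifts to the universal cover\<close>

definition torus_cover :: "real \<times> real \<Rightarrow> complex \<times> complex" where
  "torus_cover p = (cis (2 * pi * fst p), cis (2 * pi * snd p))"

lemma cis_2pi_eq_iff: "cis (2 * pi * x) = cis (2 * pi * y) \<longleftrightarrow> x - y \<in> \<int>"
proof -
  have "cis (2 * pi * x) = cis (2 * pi * y) \<longleftrightarrow> cis (2 * pi * x) / cis (2 * pi * y) = 1" by simp
  also have "\<dots> \<longleftrightarrow> cis (2 * pi * (x - y)) = 1" by (simp add: cis_divide right_diff_distrib)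
  also have "\<dots> \<longleftrightarrow> x - y \<in> \<int>"
  proof
    assume "cis (2 * pi * (x - y)) = 1"
    then have "cos (2 * pi * (x - y)) = 1" by (metis cis.sel(1) one_complex.sel(1))
    then obtain n :: int where "2 * pi * (x - y) = of_int n * 2 * pi" by (auto simp: cos_one_2pi_int)
    then show "x - y \<in> \<int>" by simp
  qed (auto simp: cis_multiple_2pi)
  finally show ?thesis .
qed

lemma torus_cover_eq_iff: "torus_cover p = torus_cover q \<longleftrightarrow> fst (p - q) \<in> \<int> \<and> snd (p - q) \<in> \<int>"
  by (simp add: torus_cover_def cis_2pi_eq_iff)

lemma circle_lift:
  fixes c :: "'a::real_normed_vector \<Rightarrow> complex"
  assumes "continuous_on S c" "contractible S" "c ` S \<subseteq> sphere 0 1"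
  obtains g :: "'a \<Rightarrow> real" where "continuous_on S g" "\<And>x. x \<in> S \<Longrightarrow> c x = cis (2 * pi * g x)"
proof -
  have nz: "c x \<noteq> 0" if "x \<in> S" for x using assms(3) that by fastforce
  obtain l where l: "continuous_on S l" "\<And>x. x \<in> S \<Longrightarrow> c x = exp (l x)"
    using continuous_logarithm_on_contractible[OF assms(1,2) nz] by blast
  show thesis
  proof
    show "continuous_on S (\<lambda>x. Im (l x) / (2 * pi))" by (intro continuous_intros l) simp
    fix x assume x: "x \<in> S"
    then have "norm (exp (l x)) = 1" using l(2) assms(3) by fastforce
    then have "Re (l x) = 0" by simp
    then have "exp (l x) = cis (Im (l x))" by (simp add: exp_eq_polar)
    then show "c x = cis (2 * pi * (Im (l x) / (2 * pi)))" using l(2)[OF x] by simp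
  qed
qed

text \<open>The two circle coordinates are lifted separately; subtracting the lattice vector
  \<open>d\<close> then prescribes the value at \<open>x0\<close>.\<close>

lemma torus_lift:
  fixes c :: "'a::real_normed_vector \<Rightarrow> complex \<times> complex"
  assumes c: "continuous_on S c" and S: "contractible S" and T: "c ` S \<subseteq> torus"
    and p: "x0 \<in> S" "torus_cover p = c x0"
  obtains g where "continuous_on S g" "\<And>x. x \<in> S \<Longrightarrow> c x = torus_cover (g x)" "g x0 = p"
proof -
  have T': "fst (c x) \<in> sphere 0 1" "snd (c x) \<in> sphere 0 1" if "x \<in> S" for x
    using T that by (auto simp: torus_def mem_Times_iff image_subset_iff)
  obtain g1 where g1: "continuous_on S g1" "\<And>x. x \<in> S \<Longrightarrow> fst (c x) = cis (2 * pi * g1 x)"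
    using circle_lift[of S "\<lambda>x. fst (c x)"] continuous_on_fst[OF c] S T'(1) by blast
  obtain g2 where g2: "continuous_on S g2" "\<And>x. x \<in> S \<Longrightarrow> snd (c x) = cis (2 * pi * g2 x)"
    using circle_lift[of S "\<lambda>x. snd (c x)"] continuous_on_snd[OF c] S T'(2) by blast
  have cg: "c x = torus_cover (g1 x, g2 x)" if "x \<in> S" for x
    using g1(2)[OF that] g2(2)[OF that] by (simp add: torus_cover_def prod_eq_iff)
  define d where "d = (g1 x0, g2 x0) - p"
  have d: "fst d \<in> \<int>" "snd d \<in> \<int>"
    using cg[OF p(1)] p(2) torus_cover_eq_iff[of "(g1 x0, g2 x0)" p] by (auto simp: d_def)
  show thesis
  proof
    show "continuous_on S (\<lambda>x. (g1 x, g2 x) - d)" by (intro continuous_intros g1 g2)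
    show "c x = torus_cover ((g1 x, g2 x) - d)" if "x \<in> S" for x
      unfolding cg[OF that] torus_cover_eq_iff using d by simp
  qed (simp add: d_def)
qed

lemma torus_lift_unique:
  assumes S: "connected S" and f: "continuous_on S f" and g: "continuous_on S g"
    and eq: "\<And>x. x \<in> S \<Longrightarrow> torus_cover (f x) = torus_cover (g x)" and x: "x \<in> S" and y: "y \<in> S"
  shows "f x - g x = f y - g y"
proof (rule prod_eqI)
  show "fst (f x - g x) = fst (f y - g y)"
    by (rule continuous_Ints_valued_eq[OF S _ _ x y, of "\<lambda>x. fst (f x - g x)"])
      (use eq in \<open>auto simp: torus_cover_eq_iff intro!: continuous_intros f g\<close>)
  show "snd (f x - g x) = snd (f y - g y)"
    by (rule continuous_Ints_valued_eq[OF S _ _ x y, of "\<lambda>x. snd (f x - g x)"])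
      (use eq in \<open>auto simp: torus_cover_eq_iff intro!: continuous_intros f g\<close>)
qed

section \<open>Germs of loops at the vertex\<close>

text \<open>The smaller disc is open in \<open>D\<close> by the homeomorphism, and it lies in the
  image of the open unit disc, which is open in \<open>T\<close>.\<close>

lemma openin_smaller_disc:
  fixes h :: "complex \<Rightarrow> 'a::topological_space"
  assumes hom: "homeomorphism (cball 0 1) D h h'" and op: "openin (top_of_set T) (h ` ball 0 1)"
    and r: "r \<le> 1"
  shows "openin (top_of_set T) (h ` ball 0 r)"
proof -
  have "openin (top_of_set (cball 0 1 :: complex set)) (ball 0 r)"
    using r by (intro open_subset open_ball) auto
  then have "openin (top_of_set D) (h ` ball 0 r)" by (rule homeomorphism_imp_open_map[OF hom])
  then obtain O' where O': "open O'" "h ` ball 0 r = D \<inter> O'" by (auto simp: openin_open)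
  have D: "h ` cball 0 1 = D" using hom by (simp add: homeomorphism_def)
  have "h ` ball 0 r \<subseteq> h ` ball 0 1" using r by (auto simp: subset_iff)
  moreover have "h ` ball 0 1 \<subseteq> D" using D by (metis ball_subset_cball image_mono)
  ultimately have "h ` ball 0 r = h ` ball 0 1 \<inter> O'" using O'(2) by blast
  then show ?thesis using openin_Int_open[OF op O'(1)] by simp
qed

text \<open>Shortly after the start the path is inside the disc, away from the vertex and on one of
  two rays. Its direction is then continuous with finitely many values on an interval, hence
  constant, while the distance \<rho> may oscillate.\<close>

lemma path_germ_radial:
  fixes h :: "complex \<Rightarrow> 'a::metric_space"
  assumes c: "continuous_on {0..1} c" "c 0 = h 0" "\<And>s::real. 0 < s \<Longrightarrow> s < 1 \<Longrightarrow> c s \<noteq> h 0" "c ` {0..1} \<subseteq> T"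
    and hom: "homeomorphism (cball 0 1) D h h'" and op: "openin (top_of_set T) (h ` ball 0 1)"
    and rad: "c ` {0..1} \<inter> D \<subseteq> h ` (closed_segment 0 (cis \<alpha>) \<union> closed_segment 0 (cis \<beta>))"
  obtains e \<rho> \<omega> where "0 < e" "e < 1/2" "\<omega> \<in> {\<alpha>, \<beta>}" "continuous_on {0..e} \<rho>" "\<rho> 0 = 0"
    "\<And>s. 0 < s \<Longrightarrow> s \<le> e \<Longrightarrow> 0 < \<rho> s \<and> \<rho> s \<le> 1/2"
    "\<And>s. 0 \<le> s \<Longrightarrow> s \<le> e \<Longrightarrow> c s = h (of_real (\<rho> s) * cis \<omega>)"
proof -
  let ?B = "h ` ball 0 (1/2)"
  have D: "h ` cball 0 1 = D" and h'h: "\<And>z. z \<in> cball 0 1 \<Longrightarrow> h' (h z) = z"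
    and conth': "continuous_on D h'" using hom by (auto simp: homeomorphism_def)
  have BD: "?B \<subseteq> D" using D by (auto simp: subset_iff)
  have "openin (top_of_set T) ?B" by (rule openin_smaller_disc[OF hom op]) simp
  then have "openin (top_of_set {0..1}) ({0..1} \<inter> c -` ?B)"
    by (rule continuous_openin_preimage[OF c(1), rotated]) (use c(4) in auto)
  moreover have "0 \<in> {0..1} \<inter> c -` ?B" using c(2) by auto
  ultimately obtain d where d: "d > 0" "\<And>s. s \<in> {0..1} \<Longrightarrow> dist s 0 < d \<Longrightarrow> c s \<in> ?B"
    unfolding openin_euclidean_subtopology_iff by blast
  define e where "e = min (d/2) (1/4)"
  have e: "0 < e" "e < 1/2" "e < d" using d by (auto simp: e_def)
  have inB: "c s \<in> ?B" if "0 \<le> s" "s \<le> e" for s using d(2)[of s] that e by (auto simp: dist_real_def)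
  define x where "x s = h' (c s)" for s
  have x: "norm (x s) < 1/2" "h (x s) = c s" if s: "0 \<le> s" "s \<le> e" for s
  proof -
    obtain z where "z \<in> ball 0 (1/2)" "c s = h z" using inB[OF s] by auto
    then show "norm (x s) < 1/2" "h (x s) = c s" using h'h[of z] by (auto simp: x_def)
  qed
  have x0: "x 0 = 0" using h'h[of 0] c(2) by (simp add: x_def)
  have xnz: "x s \<noteq> 0" if "0 < s" "s \<le> e" for s using x(2)[of s] c(3)[of s] that e by auto
  have contx: "continuous_on {0..e} x" unfolding x_def
  proof (rule continuous_on_compose2[OF conth'])
    show "continuous_on {0..e} c" by (rule continuous_on_subset[OF c(1)]) (use e in auto)
    show "c ` {0..e} \<subseteq> D" using inB BD by auto
  qed
  have dir: "sgn (x s) \<in> {cis \<alpha>, cis \<beta>}" if s: "0 < s" "s \<le> e" for s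
  proof -
    have "c s \<in> c ` {0..1} \<inter> D" using s e inB[of s] BD by auto
    then obtain z \<omega> where z: "c s = h z" "\<omega> \<in> {\<alpha>, \<beta>}" "z \<in> closed_segment 0 (cis \<omega>)" using rad by blast
    then obtain u where u: "z = of_real u * cis \<omega>" "0 \<le> u" "u \<le> 1" by (auto simp: in_segment scaleR_conv_of_real)
    then have "x s = z" unfolding x_def z(1) by (intro h'h) (simp add: norm_mult)
    moreover from this have "u \<noteq> 0" using xnz[OF s] u by auto
    ultimately have "sgn (x s) = cis \<omega>" using u by (simp add: sgn_eq norm_mult)
    then show ?thesis using z by auto
  qed
  have "(\<lambda>s. sgn (x s)) constant_on {0<..e}"
  proof (rule continuous_finite_range_constant)
    show "continuous_on {0<..e} (\<lambda>s. sgn (x s))"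
      by (intro continuous_on_sgn continuous_on_subset[OF contx]) (use xnz in auto)
    show "finite ((\<lambda>s. sgn (x s)) ` {0<..e})"
      by (rule finite_subset[of _ "{cis \<alpha>, cis \<beta>}"]) (use dir in \<open>simp_all add: image_subset_iff\<close>)
  qed (simp add: connected_Ioc)
  then obtain \<omega> where \<omega>: "\<omega> \<in> {\<alpha>, \<beta>}" "\<And>s. 0 < s \<Longrightarrow> s \<le> e \<Longrightarrow> sgn (x s) = cis \<omega>"
    using dir[of e] e unfolding constant_on_def by (metis empty_iff greaterThanAtMost_iff insert_iff order_refl)
  show thesis
  proof (rule that[OF e(1,2) \<omega>(1)])
    show "continuous_on {0..e} (\<lambda>s. norm (x s))" by (intro continuous_intros contx)
    show "norm (x 0) = 0" using x0 by simp
    show "0 < norm (x s) \<and> norm (x s) \<le> 1/2" if "0 < s" "s \<le> e" for s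
      using x(1)[of s] xnz[of s] that by auto
    show "c s = h (of_real (norm (x s)) * cis \<omega>)" if "0 \<le> s" "s \<le> e" for s
    proof -
      have "x s = of_real (norm (x s)) * cis \<omega>"
      proof (cases "s = 0")
        case False
        then have "sgn (x s) = cis \<omega>" "x s \<noteq> 0" using \<omega>(2)[of s] xnz[of s] that by auto
        then show ?thesis by (metis mult.commute nonzero_mult_div_cancel_left norm_eq_zero of_real_eq_0_iff sgn_eq times_divide_eq_right)
      qed (simp add: x0)
      then show ?thesis using x(2)[OF that] by simp
    qed
  qed
qed

text \<open>The path and its reversal each start along a ray. If both used the same ray, the points
  of the other ray would be reached at parameters in \<open>{e..1 - e}\<close> only; the image of
  this interval is closed, so it would contain their limit, the vertex, although a simple loop is
  there only at its ends.\<close>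

lemma loop_germs_radial:
  fixes h :: "complex \<Rightarrow> 'a::metric_space"
  assumes \<gamma>: "simple_path \<gamma>" "pathstart \<gamma> = h 0" "pathfinish \<gamma> = h 0" "path_image \<gamma> \<subseteq> T"
    and hom: "homeomorphism (cball 0 1) D h h'" and op: "openin (top_of_set T) (h ` ball 0 1)"
    and rad: "path_image \<gamma> \<inter> D = h ` (closed_segment 0 (cis \<alpha>) \<union> closed_segment 0 (cis \<beta>))"
    and ne: "cis \<alpha> \<noteq> cis \<beta>"
  obtains e \<rho>1 \<alpha>1 \<rho>2 \<alpha>2 where "0 < e" "e < 1/2" "{\<alpha>1, \<alpha>2} = {\<alpha>, \<beta>}"
    "continuous_on {0..e} \<rho>1" "continuous_on {0..e} \<rho>2" "\<rho>1 0 = 0" "\<rho>2 0 = 0"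
    "\<And>s. 0 < s \<Longrightarrow> s \<le> e \<Longrightarrow> 0 < \<rho>1 s \<and> \<rho>1 s \<le> 1/2 \<and> 0 < \<rho>2 s \<and> \<rho>2 s \<le> 1/2"
    "\<And>s. 0 \<le> s \<Longrightarrow> s \<le> e \<Longrightarrow> \<gamma> s = h (of_real (\<rho>1 s) * cis \<alpha>1) \<and> \<gamma> (1 - s) = h (of_real (\<rho>2 s) * cis \<alpha>2)"
proof -
  have g0: "\<gamma> 0 = h 0" "\<gamma> 1 = h 0" using \<gamma> by (auto simp: pathstart_def pathfinish_def)
  have gnz: "\<gamma> s \<noteq> h 0" if "0 < s" "s < 1" for s
    using \<gamma>(1) g0 that unfolding simple_path_def loop_free_def
    by (metis atLeastAtMost_iff less_eq_real_def order_less_irrefl zero_le_one)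
  have gT: "\<gamma> ` {0..1} \<subseteq> T" using \<gamma>(4) by (simp add: path_image_def)
  have contg: "continuous_on {0..1} \<gamma>" using \<gamma>(1) by (simp add: simple_path_def path_def)
  have D: "h ` cball 0 1 = D" and h'h: "\<And>z. z \<in> cball 0 1 \<Longrightarrow> h' (h z) = z"
    and conth: "continuous_on (cball 0 1) h" using hom by (auto simp: homeomorphism_def)
  obtain e1 \<rho>1 \<alpha>1 where 1: "0 < e1" "e1 < 1/2" "\<alpha>1 \<in> {\<alpha>, \<beta>}" "continuous_on {0..e1} \<rho>1" "\<rho>1 0 = 0"
    "\<And>s. 0 < s \<Longrightarrow> s \<le> e1 \<Longrightarrow> 0 < \<rho>1 s \<and> \<rho>1 s \<le> 1/2"
    "\<And>s. 0 \<le> s \<Longrightarrow> s \<le> e1 \<Longrightarrow> \<gamma> s = h (of_real (\<rho>1 s) * cis \<alpha>1)"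
    by (rule path_germ_radial[OF contg g0(1) gnz gT hom op, of \<alpha> \<beta>]) (use rad in \<open>auto simp: path_image_def\<close>)
  have im: "(\<lambda>s::real. 1 - s) ` {0..1} = {0..1}" by auto
  have rev_im: "(\<lambda>s. \<gamma> (1 - s)) ` {0..1} = \<gamma> ` {0..1}" by (subst im[symmetric]) (simp only: image_image)
  have contr: "continuous_on {0..1} (\<lambda>s. \<gamma> (1 - s))"
    by (rule continuous_on_compose2[OF contg]) (auto intro!: continuous_intros)
  obtain e2 \<rho>2 \<alpha>2 where 2: "0 < e2" "e2 < 1/2" "\<alpha>2 \<in> {\<alpha>, \<beta>}" "continuous_on {0..e2} \<rho>2" "\<rho>2 0 = 0"
    "\<And>s. 0 < s \<Longrightarrow> s \<le> e2 \<Longrightarrow> 0 < \<rho>2 s \<and> \<rho>2 s \<le> 1/2"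
    "\<And>s. 0 \<le> s \<Longrightarrow> s \<le> e2 \<Longrightarrow> \<gamma> (1 - s) = h (of_real (\<rho>2 s) * cis \<alpha>2)"
    by (rule path_germ_radial[OF contr _ _ _ hom op, of \<alpha> \<beta>])
      (use rad rev_im gT g0 gnz in \<open>auto simp: path_image_def\<close>)
  define e where "e = min e1 e2"
  have e: "0 < e" "e < 1/2" "e \<le> e1" "e \<le> e2" using 1 2 by (auto simp: e_def)
  have "\<alpha>1 \<noteq> \<alpha>2"
  proof
    assume same: "\<alpha>1 = \<alpha>2"
    obtain \<omega> where \<omega>: "\<omega> \<in> {\<alpha>, \<beta>}" "cis \<omega> \<noteq> cis \<alpha>1" using 1(3) ne by (metis insertCI)
    have "h (of_real t * cis \<omega>) \<in> \<gamma> ` {e..1 - e}" if t: "0 < t" "t \<le> 1" for t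
    proof -
      have "of_real t * cis \<omega> \<in> closed_segment 0 (cis \<omega>)"
        using t by (auto simp: in_segment scaleR_conv_of_real intro!: exI[of _ t])
      then have "h (of_real t * cis \<omega>) \<in> path_image \<gamma>" using rad \<omega>(1) by blast
      then obtain s where s: "0 \<le> s" "s \<le> 1" "\<gamma> s = h (of_real t * cis \<omega>)" by (auto simp: path_image_def)
      have no: "\<gamma> s \<noteq> h (of_real r * cis \<alpha>1)" if "0 \<le> r" "r \<le> 1" for r
      proof
        assume "\<gamma> s = h (of_real r * cis \<alpha>1)"
        then have "h' (h (of_real r * cis \<alpha>1)) = h' (h (of_real t * cis \<omega>))" using s by simp
        then have eq: "of_real r * cis \<alpha>1 = of_real t * cis \<omega>"
          using that t by (simp add: h'h norm_mult)
        then have "norm (of_real r * cis \<alpha>1) = norm (of_real t * cis \<omega>)" by simp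
        then have "r = t" using that t by (simp add: norm_mult)
        with eq t \<omega>(2) show False by simp
      qed
      have \<rho>: "0 \<le> \<rho>1 u \<and> \<rho>1 u \<le> 1" "0 \<le> \<rho>2 u \<and> \<rho>2 u \<le> 1" if "0 \<le> u" "u \<le> e" for u
        using 1(5) 1(6)[of u] 2(5) 2(6)[of u] that e by (cases "u = 0"; force)+
      have "\<not> s \<le> e"
      proof
        assume "s \<le> e"
        then show False using no[of "\<rho>1 s"] \<rho>(1)[of s] 1(7)[of s] s e by auto
      qed
      moreover have "\<not> s \<ge> 1 - e"
      proof
        assume "s \<ge> 1 - e"
        then show False using no[of "\<rho>2 (1 - s)"] \<rho>(2)[of "1 - s"] 2(7)[of "1 - s"] s e same by auto
      qed
      ultimately show ?thesis using s by (intro image_eqI[of _ _ s]) auto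
    qed
    note near = this
    have "compact (\<gamma> ` {e..1 - e})"
      by (intro compact_continuous_image continuous_on_subset[OF contg]) (use e in auto)
    then have "closed (\<gamma> ` {e..1 - e})" by (rule compact_imp_closed)
    moreover have "h (of_real (inverse (real (Suc n))) * cis \<omega>) \<in> \<gamma> ` {e..1 - e}" for n
      by (rule near) (simp_all add: field_simps)
    moreover have "(\<lambda>n. h (of_real (inverse (real (Suc n))) * cis \<omega>)) \<longlonglongrightarrow> h 0"
    proof (rule continuous_on_tendsto_compose[OF conth])
      have "(\<lambda>n. of_real (inverse (real (Suc n))) * cis \<omega>) \<longlonglongrightarrow> of_real 0 * cis \<omega>"
        by (intro tendsto_intros LIMSEQ_inverse_real_of_nat)
      then show "(\<lambda>n. of_real (inverse (real (Suc n))) * cis \<omega>) \<longlonglongrightarrow> 0" by simp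
      have "norm (of_real (inverse (real (Suc n))) * cis \<omega>) \<le> 1" for n
        by (simp only: norm_mult norm_cis norm_of_real) (simp add: field_simps)
      then show "\<forall>\<^sub>F n in sequentially. of_real (inverse (real (Suc n))) * cis \<omega> \<in> cball 0 1" by simp
    qed simp
    ultimately have "h 0 \<in> \<gamma> ` {e..1 - e}" by (rule closed_sequentially)
    then obtain s where "s \<in> {e..1 - e}" "\<gamma> s = h 0" by auto
    then show False using gnz[of s] e by auto
  qed
  with 1(3) 2(3) have "{\<alpha>1, \<alpha>2} = {\<alpha>, \<beta>}" by auto
  moreover have "{0..e} \<subseteq> {0..e1}" "{0..e} \<subseteq> {0..e2}" using e by auto
  ultimately show thesis
    by (intro that[of e \<alpha>1 \<alpha>2 \<rho>1 \<rho>2] e) (use 1 2 e in \<open>auto intro: continuous_on_subset\<close>)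
qed

lemma cis_inj_on_period:
  assumes "x \<in> {0..<2 * pi}" "y \<in> {0..<2 * pi}" "cis x = cis y"
  shows "x = y"
proof -
  have "x / (2 * pi) - y / (2 * pi) \<in> \<int>"
    using cis_2pi_eq_iff[of "x / (2 * pi)" "y / (2 * pi)"] assms(3) by simp
  moreover have "\<bar>x / (2 * pi) - y / (2 * pi)\<bar> < 1"
  proof -
    have "\<bar>x - y\<bar> < 2 * pi" using assms by auto
    then show ?thesis by (simp add: diff_divide_distrib[symmetric])
  qed
  ultimately have "x / (2 * pi) - y / (2 * pi) = 0" using Ints_nonzero_abs_less1 by blast
  then show ?thesis by simp
qed

lemma torus_cover_surj:
  assumes "v \<in> torus"
  obtains p where "torus_cover p = v"
proof -
  have "fst v \<noteq> 0" "snd v \<noteq> 0" "norm (fst v) = 1" "norm (snd v) = 1"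
    using assms by (auto simp: torus_def)
  then have "torus_cover (Arg (fst v) / (2 * pi), Arg (snd v) / (2 * pi)) = v"
    by (simp add: torus_cover_def cis_Arg sgn_eq prod_eq_iff)
  then show thesis by (rule that)
qed

text \<open>\<open>(p, q)\<close> is the displacement of the lift and represents the homology class
  of the loop. Near its ends the lift agrees with the lifted disc along the rays, up to
  \<open>(p, q)\<close> at the far end, because lifts of one path over an interval differ by a
  constant.\<close>

lemma radial_loop_of_simple_loop:
  fixes \<gamma> :: "real \<Rightarrow> complex \<times> complex"
  assumes \<gamma>: "simple_path \<gamma>" "pathstart \<gamma> = h 0" "pathfinish \<gamma> = h 0" "path_image \<gamma> \<subseteq> torus"
    and hom: "homeomorphism (cball 0 1) D h h'" and op: "openin (top_of_set torus) (h ` ball 0 1)"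
    and rad: "path_image \<gamma> \<inter> D = h ` (closed_segment 0 (cis \<alpha>) \<union> closed_segment 0 (cis \<beta>))"
    and ne: "cis \<alpha> \<noteq> cis \<beta>"
    and k: "continuous_on (cball 0 1) k" "\<And>z. z \<in> cball 0 1 \<Longrightarrow> h z = torus_cover (k z)"
  obtains a p q e \<rho>1 \<alpha>1 \<rho>2 \<alpha>2 where "radial_loop k a p q e \<rho>1 \<alpha>1 \<rho>2 \<alpha>2" "{\<alpha>1, \<alpha>2} = {\<alpha>, \<beta>}"
    "\<And>s. s \<in> {0..1} \<Longrightarrow> torus_cover (a s) = \<gamma> s"
proof -
  obtain e \<rho>1 \<alpha>1 \<rho>2 \<alpha>2 where e: "0 < e" "e < 1/2" and ang: "{\<alpha>1, \<alpha>2} = {\<alpha>, \<beta>}"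
    and \<rho>: "continuous_on {0..e} \<rho>1" "continuous_on {0..e} \<rho>2" "\<rho>1 0 = 0" "\<rho>2 0 = 0"
    and pos: "\<And>s. 0 < s \<Longrightarrow> s \<le> e \<Longrightarrow> 0 < \<rho>1 s \<and> \<rho>1 s \<le> 1/2 \<and> 0 < \<rho>2 s \<and> \<rho>2 s \<le> 1/2"
    and germ: "\<And>s. 0 \<le> s \<Longrightarrow> s \<le> e \<Longrightarrow>
      \<gamma> s = h (of_real (\<rho>1 s) * cis \<alpha>1) \<and> \<gamma> (1 - s) = h (of_real (\<rho>2 s) * cis \<alpha>2)"
    using loop_germs_radial[OF \<gamma> hom op rad ne] by metis
  have contg: "continuous_on {0..1} \<gamma>" using \<gamma>(1) by (simp add: simple_path_def path_def)
  have g01: "\<gamma> 0 = h 0" "\<gamma> 1 = h 0" using \<gamma> by (auto simp: pathstart_def pathfinish_def)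
  have "contractible {0..1::real}" by (intro convex_imp_contractible convex_real_interval)
  then obtain a where a: "continuous_on {0..1} a" "\<And>s. s \<in> {0..1} \<Longrightarrow> \<gamma> s = torus_cover (a s)" "a 0 = k 0"
    using torus_lift[OF contg, of 0 "k 0"] \<gamma>(4) g01 k(2)[of 0] by (auto simp: path_image_def)
  have "torus_cover (a 1) = torus_cover (k 0)" using a(2)[of 1] g01 k(2)[of 0] by simp
  then obtain p q :: int where pq: "fst (a 1 - k 0) = of_int p" "snd (a 1 - k 0) = of_int q"
    unfolding torus_cover_eq_iff by (metis Ints_cases)
  have small: "of_real (\<rho>1 s) * cis \<omega> \<in> cball 0 1" "of_real (\<rho>2 s) * cis \<omega> \<in> cball 0 1"
    if "s \<in> {0..e}" for s \<omega>
    using pos[of s] \<rho>(3,4) that by (cases "s = 0"; auto simp: norm_mult)+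
  have contk: "continuous_on {0..e} (\<lambda>s. k (of_real (\<rho>1 s) * cis \<alpha>1))" "continuous_on {0..e} (\<lambda>s. k (of_real (\<rho>2 s) * cis \<alpha>2))"
    by (intro continuous_on_compose2[OF k(1)] continuous_intros \<rho>; use small in blast)+
  have "a s = k (of_real (\<rho>1 s) * cis \<alpha>1)" if s: "0 \<le> s" "s \<le> e" for s
  proof -
    have "a s - k (of_real (\<rho>1 s) * cis \<alpha>1) = a 0 - k (of_real (\<rho>1 0) * cis \<alpha>1)"
    proof (rule torus_lift_unique[where S = "{0..e}"])
      show "continuous_on {0..e} a" by (rule continuous_on_subset[OF a(1)]) (use e in auto)
      show "torus_cover (a s) = torus_cover (k (of_real (\<rho>1 s) * cis \<alpha>1))" if "s \<in> {0..e}" for s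
        using a(2)[of s] germ[of s] k(2)[OF small(1)[OF that, of \<alpha>1]] that e by simp
    qed (use contk s e in auto)
    then show ?thesis using a(3) \<rho>(3) by simp
  qed
  moreover have "a (1 - s) = k (of_real (\<rho>2 s) * cis \<alpha>2) + (of_int p, of_int q)" if s: "0 \<le> s" "s \<le> e" for s
  proof -
    have "a (1 - s) - k (of_real (\<rho>2 s) * cis \<alpha>2) = a (1 - 0) - k (of_real (\<rho>2 0) * cis \<alpha>2)"
    proof (rule torus_lift_unique[where S = "{0..e}"])
      show "continuous_on {0..e} (\<lambda>s. a (1 - s))"
        by (rule continuous_on_compose2[OF a(1)]) (use e in \<open>auto intro!: continuous_intros\<close>)
      show "torus_cover (a (1 - s)) = torus_cover (k (of_real (\<rho>2 s) * cis \<alpha>2))" if "s \<in> {0..e}" for s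
        using a(2)[of "1 - s"] germ[of s] k(2)[OF small(2)[OF that, of \<alpha>2]] that e by simp
    qed (use contk s e in auto)
    then show ?thesis using pq \<rho>(4) by (simp add: prod_eq_iff algebra_simps)
  qed
  moreover have "a 1 = k 0 + (of_int p, of_int q)" using pq by (simp add: prod_eq_iff algebra_simps)
  ultimately have "radial_loop k a p q e \<rho>1 \<alpha>1 \<rho>2 \<alpha>2"
    unfolding radial_loop_def using a(1,3) e \<rho> pos by auto
  then show thesis using ang a(2) that by metis
qed

section \<open>Homology classes of realized loops\<close>

text \<open>The body of \<open>realizable_on_torus\<close> with its witnesses as parameters, so that
  single components of a drawing can be replaced.\<close>

definition torus_realization ::
  "'a list \<Rightarrow> complex \<times> complex \<Rightarrow> ('a \<Rightarrow> real \<Rightarrow> complex \<times> complex) \<Rightarrow> (complex \<times> complex) set \<Rightarrow>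
    (complex \<Rightarrow> complex \<times> complex) \<Rightarrow> (complex \<times> complex \<Rightarrow> complex) \<Rightarrow> (nat \<Rightarrow> real) \<Rightarrow> bool" where
  "torus_realization w v \<gamma> D h h' \<theta> \<longleftrightarrow>
      v \<in> torus
      \<and> (\<forall>a\<in>set w. simple_path (\<gamma> a) \<and> path_image (\<gamma> a) \<subseteq> torus
                    \<and> pathstart (\<gamma> a) = v \<and> pathfinish (\<gamma> a) = v)
      \<and> (\<forall>a\<in>set w. \<forall>b\<in>set w. a \<noteq> b \<longrightarrow> path_image (\<gamma> a) \<inter> path_image (\<gamma> b) = {v})
      \<and> D \<subseteq> torus \<and> homeomorphism (cball 0 1) D h h'
      \<and> openin (top_of_set torus) (h ` ball 0 1) \<and> h 0 = v
      \<and> strict_mono_on {..<length w} \<theta> \<and> \<theta> ` {..<length w} \<subseteq> {0..<2 * pi}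
      \<and> (\<forall>a\<in>set w. path_image (\<gamma> a) \<inter> D
            = h ` (\<Union>i\<in>{i. i < length w \<and> w ! i = a}. closed_segment 0 (cis (\<theta> i))))"

lemma realizable_on_torus_iff:
  "realizable_on_torus w \<longleftrightarrow> (\<exists>v \<gamma> D h h' \<theta>. torus_realization w v \<gamma> D h h' \<theta>)"
  unfolding realizable_on_torus_def torus_realization_def ..

text \<open>\<open>P\<close> and \<open>Q\<close> are the coordinates of the homology classes. The
  two positions of a letter may be named in any order, since a path may leave the vertex along
  either of its rays.\<close>

lemma realizable_intersection_parity:
  assumes H: "hieroglyph w" and R: "realizable_on_torus w"
  obtains P Q :: "'a \<Rightarrow> int" where
    "\<And>a b i j k l. a \<in> set w \<Longrightarrow> b \<in> set w \<Longrightarrow> a \<noteq> b \<Longrightarrow>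
       {n. n < length w \<and> w ! n = a} = {i, j} \<Longrightarrow> {n. n < length w \<and> w ! n = b} = {k, l} \<Longrightarrow>
       odd (Q a * P b - Q b * P a) \<longleftrightarrow> odd (of_bool (i < k) + of_bool (j < l) - of_bool (i < l) - of_bool (j < k) :: int)"
proof -
  obtain v \<gamma> D h h' \<theta> where R': "torus_realization w v \<gamma> D h h' \<theta>"
    using R unfolding realizable_on_torus_iff by blast
  then have v: "v \<in> torus"
    and \<gamma>: "\<And>a. a \<in> set w \<Longrightarrow> simple_path (\<gamma> a) \<and> path_image (\<gamma> a) \<subseteq> torus \<and> pathstart (\<gamma> a) = v \<and> pathfinish (\<gamma> a) = v"
    and meet: "\<And>a b. a \<in> set w \<Longrightarrow> b \<in> set w \<Longrightarrow> a \<noteq> b \<Longrightarrow> path_image (\<gamma> a) \<inter> path_image (\<gamma> b) = {v}"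
    and D: "D \<subseteq> torus" and hom: "homeomorphism (cball 0 1) D h h'"
    and op: "openin (top_of_set torus) (h ` ball 0 1)" and h0: "h 0 = v"
    and \<theta>: "strict_mono_on {..<length w} \<theta>" "\<theta> ` {..<length w} \<subseteq> {0..<2 * pi}"
    and rad: "\<And>a. a \<in> set w \<Longrightarrow> path_image (\<gamma> a) \<inter> D
            = h ` (\<Union>i\<in>{i. i < length w \<and> w ! i = a}. closed_segment 0 (cis (\<theta> i)))"
    unfolding torus_realization_def by simp_all
  obtain p where p: "torus_cover p = h 0" using torus_cover_surj[OF v] h0 by metis
  have hD: "h ` cball 0 1 = D" and h'h: "\<And>z. z \<in> cball 0 1 \<Longrightarrow> h' (h z) = z"
    and conth: "continuous_on (cball 0 1) h" using hom by (auto simp: homeomorphism_def)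
  obtain k where k: "continuous_on (cball 0 1) k" "\<And>z. z \<in> cball 0 1 \<Longrightarrow> h z = torus_cover (k z)"
    by (rule torus_lift[OF conth convex_imp_contractible[OF convex_cball] _ _ p]) (use hD D in auto)
  have ld: "lifted_disc k" unfolding lifted_disc_def
    using k h'h by (metis torus_cover_eq_iff)
  let ?idx = "\<lambda>a. {n. n < length w \<and> w ! n = a}"
  have two: "\<exists>i j. ?idx a = {i, j} \<and> i \<noteq> j" if "a \<in> set w" for a
    using positions(1,2)[OF H that] by (metis less_imp_neq)
  have inj: "\<theta> i = \<theta> j \<longleftrightarrow> i = j" "\<theta> i < \<theta> j \<longleftrightarrow> i < j" if "i < length w" "j < length w" for i j
    using \<theta>(1) that by (auto simp: strict_mono_on_eqD strict_mono_on_less)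
  have \<theta>in: "\<theta> i \<in> {0..<2 * pi}" if "i < length w" for i using \<theta>(2) that by blast
  define G where "G a c p q \<longleftrightarrow>
      (\<exists>e \<rho>1 \<alpha>1 \<rho>2 \<alpha>2. radial_loop k c p q e \<rho>1 \<alpha>1 \<rho>2 \<alpha>2 \<and> {\<alpha>1, \<alpha>2} = \<theta> ` ?idx a) \<and>
      (\<forall>s\<in>{0..1}. torus_cover (c s) = \<gamma> a s)" for a c p q
  have "\<exists>c p q. G a c p q" if a: "a \<in> set w" for a
  proof -
    obtain i j where ij: "?idx a = {i, j}" "i \<noteq> j" using two[OF a] by blast
    then have l: "i < length w" "j < length w" by auto
    have ne: "cis (\<theta> i) \<noteq> cis (\<theta> j)"
      using cis_inj_on_period[OF \<theta>in \<theta>in] inj(1)[OF l] ij(2) l by blast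
    have rad': "path_image (\<gamma> a) \<inter> D = h ` (closed_segment 0 (cis (\<theta> i)) \<union> closed_segment 0 (cis (\<theta> j)))"
      using rad[OF a] unfolding ij(1) by simp
    have loop: "simple_path (\<gamma> a)" "pathstart (\<gamma> a) = h 0" "pathfinish (\<gamma> a) = h 0" "path_image (\<gamma> a) \<subseteq> torus"
      using \<gamma>[OF a] h0 by simp_all
    obtain c p q e \<rho>1 \<alpha>1 \<rho>2 \<alpha>2 where "radial_loop k c p q e \<rho>1 \<alpha>1 \<rho>2 \<alpha>2" "{\<alpha>1, \<alpha>2} = {\<theta> i, \<theta> j}"
      "\<And>s. s \<in> {0..1} \<Longrightarrow> torus_cover (c s) = \<gamma> a s"
      by (rule radial_loop_of_simple_loop[OF loop hom op rad' ne k]) (blast intro: that)+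
    moreover have "\<theta> ` ?idx a = {\<theta> i, \<theta> j}" unfolding ij(1) by simp
    ultimately show ?thesis unfolding G_def by metis
  qed
  then obtain c P Q where G: "\<And>a. a \<in> set w \<Longrightarrow> G a (c a) (P a) (Q a)" by metis
  then have c: "\<And>a. a \<in> set w \<Longrightarrow> \<exists>e \<rho>1 \<alpha>1 \<rho>2 \<alpha>2. radial_loop k (c a) (P a) (Q a) e \<rho>1 \<alpha>1 \<rho>2 \<alpha>2 \<and> {\<alpha>1, \<alpha>2} = \<theta> ` ?idx a"
    and cc: "\<And>a s. a \<in> set w \<Longrightarrow> s \<in> {0..1} \<Longrightarrow> torus_cover (c a s) = \<gamma> a s"
    unfolding G_def by blast+
  show thesis
  proof (rule that[of Q P])
    fix a b i j k' l
    assume ab: "a \<in> set w" "b \<in> set w" "a \<noteq> b" and ia: "?idx a = {i, j}" and ib: "?idx b = {k', l}"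
    obtain e1 \<rho>1 \<alpha>1 \<rho>2 \<alpha>2 where A: "radial_loop k (c a) (P a) (Q a) e1 \<rho>1 \<alpha>1 \<rho>2 \<alpha>2" "{\<alpha>1, \<alpha>2} = {\<theta> i, \<theta> j}"
      using c[OF ab(1)] unfolding ia by auto
    obtain e2 \<sigma>1 \<beta>1 \<sigma>2 \<beta>2 where B: "radial_loop k (c b) (P b) (Q b) e2 \<sigma>1 \<beta>1 \<sigma>2 \<beta>2" "{\<beta>1, \<beta>2} = {\<theta> k', \<theta> l}"
      using c[OF ab(2)] unfolding ib by auto
    define e where "e = min e1 e2"
    have "0 < e1" "0 < e2" using A B by (auto simp: radial_loop_def)
    then have A': "radial_loop k (c a) (P a) (Q a) e \<rho>1 \<alpha>1 \<rho>2 \<alpha>2" and B': "radial_loop k (c b) (P b) (Q b) e \<sigma>1 \<beta>1 \<sigma>2 \<beta>2"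
      using radial_loop_mono[OF A(1), of e] radial_loop_mono[OF B(1), of e] by (auto simp: e_def)
    have lt: "i < length w" "j < length w" "k' < length w" "l < length w" using ia ib by auto
    have "?idx a \<inter> ?idx b = {}" using ab(3) by auto
    then have disj: "{i, j} \<inter> {k', l} = {}" unfolding ia ib .
    have ends: "s \<in> {0, 1}" if "x \<in> set w" "s \<in> {0..1}" "\<gamma> x s = v" for x s
      using \<gamma>[OF that(1)] that unfolding simple_path_def loop_free_def pathstart_def
      by (metis atLeastAtMost_iff insertCI order_refl zero_le_one)
    have "odd (Q a * P b - Q b * P a) \<longleftrightarrow>
        odd (of_bool (\<alpha>1 < \<beta>1) + of_bool (\<alpha>2 < \<beta>2) - of_bool (\<alpha>1 < \<beta>2) - of_bool (\<alpha>2 < \<beta>1) :: int)"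
    proof (rule radial_loops_intersection[OF ld A' B'])
      fix s t :: real assume st: "s \<in> {0..1}" "t \<in> {0..1}"
        "fst (c a s - c b t) \<in> \<int>" "snd (c a s - c b t) \<in> \<int>"
      then have "\<gamma> a s = \<gamma> b t" using cc ab by (metis torus_cover_eq_iff)
      then have "\<gamma> a s \<in> path_image (\<gamma> a) \<inter> path_image (\<gamma> b)"
        using st(1,2) unfolding path_image_def by (metis IntI imageI)
      then have "\<gamma> a s = v" "\<gamma> b t = v" using meet[OF ab] \<open>\<gamma> a s = \<gamma> b t\<close> by auto
      then show "s \<in> {0, 1} \<and> t \<in> {0, 1}" using ends ab st by blast
    next
      show "{\<alpha>1, \<alpha>2, \<beta>1, \<beta>2} \<subseteq> {0..<2 * pi}" using A(2) B(2) \<theta>in[OF lt(1)] \<theta>in[OF lt(2)] \<theta>in[OF lt(3)] \<theta>in[OF lt(4)] by (auto simp: doubleton_eq_iff)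
      have "\<theta> x \<noteq> \<theta> y" if "x \<in> {i, j}" "y \<in> {k', l}" for x y
        using inj(1)[of x y] that lt disj by blast
      then show "{\<alpha>1, \<alpha>2} \<inter> {\<beta>1, \<beta>2} = {}" unfolding A(2) B(2) by auto
    qed
    \<comment> \<open>Exchanging the two rays of one loop changes the sign of the number on the
      right and so keeps its parity.\<close>
    also have "\<dots> \<longleftrightarrow> odd (of_bool (\<theta> i < \<theta> k') + of_bool (\<theta> j < \<theta> l) - of_bool (\<theta> i < \<theta> l) - of_bool (\<theta> j < \<theta> k') :: int)"
      using A(2) B(2) by (auto simp: doubleton_eq_iff)
    finally show "odd (Q a * P b - Q b * P a) \<longleftrightarrow> odd (of_bool (i < k') + of_bool (j < l) - of_bool (i < l) - of_bool (j < k') :: int)"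
      using inj(2) lt by simp
  qed
qed

text \<open>The label is the class modulo 2 written in binary. Over the field with two elements the
  determinant of two vectors is nonzero iff both are nonzero and they are distinct.\<close>

lemma realizable_crossing_labels:
  assumes H: "hieroglyph w" and R: "realizable_on_torus w"
  shows "\<exists>l. crossing_labels w l"
proof -
  obtain P Q :: "'a \<Rightarrow> int" where PQ: "\<And>a b i j k l. a \<in> set w \<Longrightarrow> b \<in> set w \<Longrightarrow> a \<noteq> b \<Longrightarrow>
       {n. n < length w \<and> w ! n = a} = {i, j} \<Longrightarrow> {n. n < length w \<and> w ! n = b} = {k, l} \<Longrightarrow>
       odd (Q a * P b - Q b * P a) \<longleftrightarrow> odd (of_bool (i < k) + of_bool (j < l) - of_bool (i < l) - of_bool (j < k) :: int)"
    by (rule realizable_intersection_parity[OF H R]) (blast intro: that)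
  let ?p = "first_pos w" and ?q = "last_pos w"
  have cross: "loops_cross w a b \<longleftrightarrow> odd (Q a * P b - Q b * P a)" if ab: "a \<in> set w" "b \<in> set w" "a \<noteq> b" for a b
  proof -
    note A = positions[OF H ab(1)] and B = positions[OF H ab(2)]
    have "odd (Q a * P b - Q b * P a) \<longleftrightarrow>
        odd (of_bool (?p a < ?p b) + of_bool (?q a < ?q b) - of_bool (?p a < ?q b) - of_bool (?q a < ?p b) :: int)"
      by (rule PQ[OF ab A(1) B(1)])
    also have "\<dots> \<longleftrightarrow> loops_cross w a b"
      unfolding loops_cross_positions[OF H ab]
      using A(2) B(2) positions_distinct[OF H ab]
      by (cases "?p a < ?p b"; cases "?q a < ?q b"; cases "?p a < ?q b"; cases "?q a < ?p b") auto
    finally show ?thesis by simp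
  qed
  define l :: "'a \<Rightarrow> nat" where "l a = of_bool (odd (P a)) + 2 * of_bool (odd (Q a))" for a
  have "loops_cross w a b \<longleftrightarrow> l a \<noteq> 0 \<and> l b \<noteq> 0 \<and> l a \<noteq> l b" if "a \<in> set w" "b \<in> set w" for a b
  proof (cases "a = b")
    case True
    then show ?thesis by (simp add: loops_cross_def)
  next
    case False
    show ?thesis unfolding cross[OF that False]
      by (cases "odd (P a)"; cases "odd (Q a)"; cases "odd (P b)"; cases "odd (Q b)") (simp_all add: l_def)
  qed
  moreover have "l a < 4" for a by (simp add: l_def)
  ultimately show ?thesis unfolding crossing_labels_def by blast
qed

section \<open>Drawing loops on the torus\<close>

lemma in_ray_iff: "z \<in> closed_segment 0 (cis x) \<longleftrightarrow> (\<exists>t. 0 \<le> t \<and> t \<le> 1 \<and> z = of_real t * cis x)"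
  by (auto simp: in_segment scaleR_conv_of_real)

lemma rays_eq_iff:
  assumes "0 \<le> r" "0 \<le> s" "x \<in> {0..<2 * pi}" "y \<in> {0..<2 * pi}"
  shows "of_real r * cis x = of_real s * cis y \<longleftrightarrow> r = s \<and> (r = 0 \<or> x = y)"
proof
  assume eq: "of_real r * cis x = of_real s * cis y"
  then have "norm (of_real r * cis x) = norm (of_real s * cis y)" by (rule arg_cong)
  then have rs: "r = s" using assms(1,2) by (simp add: norm_mult)
  moreover have "x = y" if "r \<noteq> 0" using eq that rs cis_inj_on_period[OF assms(3,4)] by simp
  ultimately show "r = s \<and> (r = 0 \<or> x = y)" by blast
qed auto

text \<open>Only the chart changes: turning it by \<open>\<theta> 1\<close> makes the second ray the
  new ray of angle 0, and the former first ray becomes the last one after adding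
  \<open>2 * pi\<close>. The map \<sigma> relates the indices of the rays.\<close>

lemma realizable_rotate1:
  assumes "realizable_on_torus w"
  shows "realizable_on_torus (rotate1 w)"
proof (cases "length w \<le> 1")
  case True
  then have "rotate1 w = w" by (cases w rule: remdups_adj.cases) auto
  with assms show ?thesis by simp
next
  case False
  define N where "N = length w"
  have N: "1 < N" using False by (simp add: N_def)
  obtain v \<gamma> D h h' \<theta> where R: "torus_realization w v \<gamma> D h h' \<theta>"
    using assms unfolding realizable_on_torus_iff by blast
  then have hom: "homeomorphism (cball 0 1) D h h'"
    and op: "openin (top_of_set torus) (h ` ball 0 1)" and h0: "h 0 = v"
    and \<theta>: "strict_mono_on {..<N} \<theta>" "\<theta> ` {..<N} \<subseteq> {0..<2 * pi}"
    and rad: "\<And>a. a \<in> set w \<Longrightarrow> path_image (\<gamma> a) \<inter> D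
            = h ` (\<Union>i\<in>{i. i < N \<and> w ! i = a}. closed_segment 0 (cis (\<theta> i)))"
    unfolding torus_realization_def N_def by simp_all
  have \<theta>less: "\<theta> i < \<theta> j" if "i < j" "j < N" for i j
    using strict_mono_onD[OF \<theta>(1), of i j] that by simp
  have \<theta>in: "0 \<le> \<theta> i" "\<theta> i < 2 * pi" if "i < N" for i using \<theta>(2) that by (auto simp: image_subset_iff)
  define s where "s = \<theta> 1"
  define \<theta>' where "\<theta>' i = (if i < N - 1 then \<theta> (i + 1) - s else \<theta> 0 - s + 2 * pi)" for i
  define g where "g = (\<lambda>z. h (cis s * z))"
  have mult: "(\<lambda>z. cis s * z) ` cball 0 1 = cball 0 1" "(\<lambda>z. cis s * z) ` ball 0 1 = ball 0 1"
  proof -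
    have "z = cis s * (cis (- s) * z)" for z by (simp add: mult.assoc[symmetric] cis_mult)
    then show "(\<lambda>z. cis s * z) ` cball 0 1 = cball 0 1" "(\<lambda>z. cis s * z) ` ball 0 1 = ball 0 1"
      by (auto simp: norm_mult intro!: image_eqI[of _ "\<lambda>z. cis s * z" "cis (- s) * _"])
  qed
  have "homeomorphism (cball 0 1) (cball 0 1) (\<lambda>z. cis s * z) (\<lambda>z. cis (- s) * z)"
    by (rule homeomorphismI) (auto simp: norm_mult mult.assoc[symmetric] cis_mult intro!: continuous_intros)
  from homeomorphism_compose[OF this hom]
  have hom': "homeomorphism (cball 0 1) D g ((\<lambda>z. cis (- s) * z) \<circ> h')" by (simp add: g_def o_def)
  have gball: "g ` ball 0 1 = h ` ball 0 1" unfolding g_def by (metis mult(2) image_image)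
  have ray: "g ` closed_segment 0 (cis x) = h ` closed_segment 0 (cis (s + x))" for x
  proof -
    have "linear (\<lambda>z. cis s * z)" by (intro linearI) (auto simp: algebra_simps)
    from closed_segment_linear_image[OF this, of 0 "cis x"] show ?thesis
      unfolding g_def by (simp add: cis_mult image_image)
  qed
  define \<sigma> where "\<sigma> i = (if i < N - 1 then i + 1 else 0)" for i
  have \<sigma>: "cis (s + \<theta>' i) = cis (\<theta> (\<sigma> i))" for i
  proof (cases "i < N - 1")
    case False
    have "cis (\<theta> 0 + 2 * pi) = cis (\<theta> 0)" by (simp add: cis_mult[symmetric])
    with False show ?thesis by (simp add: \<theta>'_def \<sigma>_def)
  qed (simp add: \<theta>'_def \<sigma>_def)
  have nth: "rotate1 w ! i = w ! \<sigma> i" if "i < N" for i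
  proof -
    have "rotate1 w ! i = w ! (Suc i mod N)" using that by (simp add: nth_rotate1 N_def)
    moreover have "Suc i mod N = \<sigma> i"
    proof (cases "i < N - 1")
      case False
      with that have "Suc i = N" by simp
      then show ?thesis using False by (simp add: \<sigma>_def)
    qed (simp add: \<sigma>_def)
    ultimately show ?thesis by simp
  qed
  have img: "\<sigma> ` {i. i < N \<and> rotate1 w ! i = a} = {i. i < N \<and> w ! i = a}" for a
  proof (intro equalityI subsetI)
    fix j assume j: "j \<in> {i. i < N \<and> w ! i = a}"
    define i where "i = (if j = 0 then N - 1 else j - 1)"
    have "\<sigma> i = j" "i < N" using j N by (auto simp: \<sigma>_def i_def)
    then show "j \<in> \<sigma> ` {i. i < N \<and> rotate1 w ! i = a}" using j nth[of i] by (intro image_eqI[of _ _ i]) auto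
  qed (use N nth in \<open>auto simp: \<sigma>_def\<close>)
  have "torus_realization (rotate1 w) v \<gamma> D g ((\<lambda>z. cis (- s) * z) \<circ> h') \<theta>'"
  proof -
    have "strict_mono_on {..<N} \<theta>'"
    proof (rule strict_mono_onI)
      fix i j assume "i \<in> {..<N}" "j \<in> {..<N}" "i < j"
      then show "\<theta>' i < \<theta>' j"
        using \<theta>less[of "i + 1" "j + 1"] \<theta>in[of "i + 1"] \<theta>in[of 0] by (auto simp: \<theta>'_def)
    qed
    moreover have "\<theta>' ` {..<N} \<subseteq> {0..<2 * pi}"
    proof -
      have "0 \<le> \<theta>' i \<and> \<theta>' i < 2 * pi" if "i < N" for i
      proof (cases "i < N - 1")
        case True
        then have "s \<le> \<theta> (i + 1)" using less_imp_le[OF \<theta>less[of 1 "i + 1"]] by (cases "i = 0") (auto simp: s_def)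
        moreover have "i + 1 < N" using True by simp
        ultimately show ?thesis using True \<theta>in(2)[of "i + 1"] \<theta>in(1)[of 1] N by (auto simp: \<theta>'_def s_def)
      next
        case False
        then show ?thesis using \<theta>less[of 0 1] \<theta>in[of 0] \<theta>in[of 1] N by (auto simp: \<theta>'_def s_def)
      qed
      then show ?thesis by auto
    qed
    moreover have "g ` (\<Union>i\<in>{i. i < N \<and> rotate1 w ! i = a}. closed_segment 0 (cis (\<theta>' i))) =
        h ` (\<Union>i\<in>{i. i < N \<and> w ! i = a}. closed_segment 0 (cis (\<theta> i)))" for a
    proof -
      have "g ` (\<Union>i\<in>{i. i < N \<and> rotate1 w ! i = a}. closed_segment 0 (cis (\<theta>' i))) =
          h ` (\<Union>i\<in>\<sigma> ` {i. i < N \<and> rotate1 w ! i = a}. closed_segment 0 (cis (\<theta> i)))"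
        by (simp add: image_UN ray \<sigma> image_image)
      then show ?thesis unfolding img .
    qed
    ultimately show ?thesis
      using R hom' unfolding torus_realization_def by (simp add: N_def[symmetric] gball) (simp add: g_def)
  qed
  then show ?thesis unfolding realizable_on_torus_iff by blast
qed

lemma realizable_rotate:
  assumes "realizable_on_torus w"
  shows "realizable_on_torus (rotate n w)"
  using assms by (induction n) (auto simp: realizable_rotate1)

lemma realizable_rotate_iff: "realizable_on_torus (rotate n w) \<longleftrightarrow> realizable_on_torus w"
proof
  assume R: "realizable_on_torus (rotate n w)"
  obtain k where "rotate k (rotate n w) = w" using rotate_inverse by blast
  then show "realizable_on_torus w" using realizable_rotate[OF R] by metis
qed (rule realizable_rotate)

text \<open>A radius, an arc and a radius back. The radius 3/4 of the arc lies between that of the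
  old disc, 1, and that of the new disc, 1/2, so the new disc sees only the two radii.\<close>

definition sector_loop :: "real \<Rightarrow> real \<Rightarrow> real \<Rightarrow> complex" where
  "sector_loop \<alpha> \<beta> = linepath 0 (of_real (3/4) * cis \<alpha>) +++
     ((\<lambda>t. of_real (3/4) * cis (\<alpha> + t * (\<beta> - \<alpha>))) +++ linepath (of_real (3/4) * cis \<beta>) 0)"

lemma sector_loop:
  assumes ab: "0 \<le> \<alpha>" "\<alpha> < \<beta>" "\<beta> < 2 * pi"
  shows "simple_path (sector_loop \<alpha> \<beta>)"
    and "pathstart (sector_loop \<alpha> \<beta>) = 0" and "pathfinish (sector_loop \<alpha> \<beta>) = 0"
    and "path_image (sector_loop \<alpha> \<beta>) \<subseteq> {of_real r * cis x |r x. 0 \<le> r \<and> r \<le> 3/4 \<and> \<alpha> \<le> x \<and> x \<le> \<beta>}"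
    and "path_image (sector_loop \<alpha> \<beta>) \<inter> cball 0 (1/2) =
      {of_real r * cis x |r x. 0 \<le> r \<and> r \<le> 1/2 \<and> (x = \<alpha> \<or> x = \<beta>)}"
proof -
  let ?c = "\<lambda>t. of_real (3/4) * cis (\<alpha> + t * (\<beta> - \<alpha>))"
  let ?l = "linepath 0 (of_real (3/4) * cis \<alpha>)" and ?m = "linepath (of_real (3/4) * cis \<beta>) 0"
  have seg: "closed_segment 0 (of_real (3/4) * cis x) = {of_real r * cis x |r. 0 \<le> r \<and> r \<le> 3/4}" for x
  proof (intro equalityI subsetI)
    fix z assume "z \<in> closed_segment 0 (of_real (3/4) * cis x)"
    then obtain u where "z = of_real (u * (3/4)) * cis x" "0 \<le> u" "u \<le> 1"
      by (auto simp: in_segment scaleR_conv_of_real)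
    then show "z \<in> {of_real r * cis x |r. 0 \<le> r \<and> r \<le> 3/4}" by (intro CollectI exI[of _ "u * (3/4)"]) auto
  next
    fix z assume "z \<in> {of_real r * cis x |r. 0 \<le> r \<and> r \<le> 3/4}"
    then obtain r where r: "z = of_real r * cis x" "0 \<le> r" "r \<le> 3/4" by auto
    then show "z \<in> closed_segment 0 (of_real (3/4) * cis x)"
      by (auto simp: in_segment scaleR_conv_of_real intro!: exI[of _ "r * (4/3)"])
  qed
  have rng: "\<alpha> \<le> \<alpha> + t * (\<beta> - \<alpha>) \<and> \<alpha> + t * (\<beta> - \<alpha>) \<le> \<beta>" if "0 \<le> t" "t \<le> 1" for t
  proof -
    have "0 \<le> t * (\<beta> - \<alpha>)" "t * (\<beta> - \<alpha>) \<le> 1 * (\<beta> - \<alpha>)"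
      using that ab by (simp, intro mult_right_mono) auto
    then show ?thesis by simp
  qed
  have im_l: "path_image ?l = {of_real r * cis \<alpha> |r. 0 \<le> r \<and> r \<le> 3/4}" by (simp only: path_image_linepath seg)
  have im_m: "path_image ?m = {of_real r * cis \<beta> |r. 0 \<le> r \<and> r \<le> 3/4}"
    by (simp only: path_image_linepath closed_segment_commute[of _ 0] seg)
  have im_c: "path_image ?c \<subseteq> {of_real (3/4) * cis x |x. \<alpha> \<le> x \<and> x \<le> \<beta>}"
    using rng unfolding path_image_def by fastforce
  have per: "x \<in> {0..<2 * pi}" if "\<alpha> \<le> x" "x \<le> \<beta>" for x using that ab by auto
  note eqs = rays_eq_iff[OF _ _ per per]
  have arc_c: "arc ?c" unfolding arc_def
  proof
    show "path ?c" unfolding path_def by (intro continuous_intros)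
    show "inj_on ?c {0..1}"
    proof (rule inj_onI)
      fix s t :: real assume "s \<in> {0..1}" "t \<in> {0..1}" "?c s = ?c t"
      then have "\<alpha> + s * (\<beta> - \<alpha>) = \<alpha> + t * (\<beta> - \<alpha>)"
        using rng[of s] rng[of t] eqs[of "3/4" "3/4" "\<alpha> + s * (\<beta> - \<alpha>)" "\<alpha> + t * (\<beta> - \<alpha>)"] by auto
      then show "s = t" using ab by simp
    qed
  qed
  have arc_cm: "arc (?c +++ ?m)"
  proof (rule arc_join[OF arc_c])
    show "arc ?m" by (intro arc_linepath) simp
    show "path_image ?c \<inter> path_image ?m \<subseteq> {pathstart ?m}"
    proof
      fix z assume "z \<in> path_image ?c \<inter> path_image ?m"
      then obtain x r where "z = of_real (3/4) * cis x" "\<alpha> \<le> x" "x \<le> \<beta>" "z = of_real r * cis \<beta>" "0 \<le> r"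
        using im_c unfolding im_m by blast
      then show "z \<in> {pathstart ?m}" using eqs[of "3/4" r x \<beta>] ab by auto
    qed
  qed (simp add: pathfinish_def)
  have im_cm: "path_image (?c +++ ?m) = path_image ?c \<union> path_image ?m"
    by (rule path_image_join) (simp add: pathfinish_def)
  have im: "path_image (sector_loop \<alpha> \<beta>) = path_image ?l \<union> (path_image ?c \<union> path_image ?m)"
    unfolding sector_loop_def im_cm[symmetric] by (rule path_image_join) (simp add: pathstart_def joinpaths_def)
  show "pathstart (sector_loop \<alpha> \<beta>) = 0" "pathfinish (sector_loop \<alpha> \<beta>) = 0" by (simp_all add: sector_loop_def)
  show "simple_path (sector_loop \<alpha> \<beta>)" unfolding sector_loop_def
  proof (rule simple_path_join_loop[OF _ arc_cm])
    show "arc ?l" by (intro arc_linepath) simp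
    show "path_image ?l \<inter> path_image (?c +++ ?m) \<subseteq> {pathstart ?l, pathstart (?c +++ ?m)}"
    proof
      fix z assume z: "z \<in> path_image ?l \<inter> path_image (?c +++ ?m)"
      then obtain r where r: "z = of_real r * cis \<alpha>" "0 \<le> r" "r \<le> 3/4" unfolding im_l by blast
      have s: "pathstart (?c +++ ?m) = of_real (3/4) * cis \<alpha>" by (simp add: pathstart_def joinpaths_def)
      from z consider "z \<in> path_image ?c" | "z \<in> path_image ?m" unfolding im_cm by blast
      then show "z \<in> {pathstart ?l, pathstart (?c +++ ?m)}"
      proof cases
        case 1
        then obtain x where "z = of_real (3/4) * cis x" "\<alpha> \<le> x" "x \<le> \<beta>" using im_c by blast
        then have "z = of_real (3/4) * cis \<alpha>" using eqs[of "3/4" r x \<alpha>] ab r by auto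
        then show ?thesis unfolding s by simp
      next
        case 2
        then obtain t where "z = of_real t * cis \<beta>" "0 \<le> t" unfolding im_m by blast
        then have "r = 0" using eqs[of r t \<alpha> \<beta>] ab r by auto
        then show ?thesis using r by simp
      qed
    qed
  qed (simp_all add: pathstart_def pathfinish_def joinpaths_def linepath_def)
  show "path_image (sector_loop \<alpha> \<beta>) \<subseteq> {of_real r * cis x |r x. 0 \<le> r \<and> r \<le> 3/4 \<and> \<alpha> \<le> x \<and> x \<le> \<beta>}"
  proof -
    have "path_image ?l \<subseteq> {of_real r * cis x |r x. 0 \<le> r \<and> r \<le> 3/4 \<and> \<alpha> \<le> x \<and> x \<le> \<beta>}"
      unfolding im_l using ab less_imp_le[OF ab(2)] by blast
    moreover have "path_image ?m \<subseteq> {of_real r * cis x |r x. 0 \<le> r \<and> r \<le> 3/4 \<and> \<alpha> \<le> x \<and> x \<le> \<beta>}"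
      unfolding im_m using ab less_imp_le[OF ab(2)] by blast
    moreover have "{of_real (3/4) * cis x |x. \<alpha> \<le> x \<and> x \<le> \<beta>} \<subseteq>
        {of_real r * cis x |r x. 0 \<le> r \<and> r \<le> 3/4 \<and> \<alpha> \<le> x \<and> x \<le> \<beta>}"
    proof
      fix z assume "z \<in> {of_real (3/4) * cis x |x. \<alpha> \<le> x \<and> x \<le> \<beta>}"
      then obtain x where "z = of_real (3/4) * cis x" "\<alpha> \<le> x" "x \<le> \<beta>" by blast
      then show "z \<in> {of_real r * cis x |r x. 0 \<le> r \<and> r \<le> 3/4 \<and> \<alpha> \<le> x \<and> x \<le> \<beta>}"
        by (intro CollectI exI[of _ "3/4"] exI[of _ x]) auto
    qed
    ultimately show ?thesis unfolding im using im_c by blast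
  qed
  show "path_image (sector_loop \<alpha> \<beta>) \<inter> cball 0 (1/2) =
      {of_real r * cis x |r x. 0 \<le> r \<and> r \<le> 1/2 \<and> (x = \<alpha> \<or> x = \<beta>)}"
  proof (intro equalityI subsetI)
    fix z assume z: "z \<in> path_image (sector_loop \<alpha> \<beta>) \<inter> cball 0 (1/2)"
    then have "norm z \<le> 1/2" by simp
    moreover have "norm y = 3/4" if "y \<in> path_image ?c" for y
    proof -
      from that im_c obtain x where "y = of_real (3/4) * cis x" by blast
      then show ?thesis by (simp only: norm_mult norm_cis norm_of_real)
    qed
    ultimately have "z \<in> path_image ?l \<union> path_image ?m" using z unfolding im by fastforce
    then obtain r x where "z = of_real r * cis x" "0 \<le> r" "x = \<alpha> \<or> x = \<beta>" unfolding im_l im_m by blast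
    with \<open>norm z \<le> 1/2\<close> show "z \<in> {of_real r * cis x |r x. 0 \<le> r \<and> r \<le> 1/2 \<and> (x = \<alpha> \<or> x = \<beta>)}"
      by (auto simp: norm_mult)
  next
    fix z assume "z \<in> {of_real r * cis x |r x. 0 \<le> r \<and> r \<le> 1/2 \<and> (x = \<alpha> \<or> x = \<beta>)}"
    then obtain r x where r: "z = of_real r * cis x" "0 \<le> r" "r \<le> 1/2" "x = \<alpha> \<or> x = \<beta>" by blast
    then have "z \<in> path_image ?l \<union> path_image ?m" unfolding im_l im_m by auto
    then show "z \<in> path_image (sector_loop \<alpha> \<beta>) \<inter> cball 0 (1/2)"
      using r unfolding im by (auto simp: norm_mult)
  qed
qed


text \<open>
  The new loop runs inside the old disc, in a sector that contains no ray; the new disc has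
  half the radius.
\<close>

lemma realizable_append_isolated:
  assumes "realizable_on_torus u" and a: "a \<notin> set u"
  shows "realizable_on_torus (u @ [a, a])"
proof -
  define N where "N = length u"
  obtain v \<gamma> D h h' \<theta> where R: "torus_realization u v \<gamma> D h h' \<theta>"
    using assms unfolding realizable_on_torus_iff by blast
  then have v: "v \<in> torus" and \<gamma>: "\<And>b. b \<in> set u \<Longrightarrow> simple_path (\<gamma> b) \<and> path_image (\<gamma> b) \<subseteq> torus \<and> pathstart (\<gamma> b) = v \<and> pathfinish (\<gamma> b) = v"
    and meet: "\<And>b c. b \<in> set u \<Longrightarrow> c \<in> set u \<Longrightarrow> b \<noteq> c \<Longrightarrow> path_image (\<gamma> b) \<inter> path_image (\<gamma> c) = {v}"
    and D: "D \<subseteq> torus" and hom: "homeomorphism (cball 0 1) D h h'"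
    and op: "openin (top_of_set torus) (h ` ball 0 1)" and h0: "h 0 = v"
    and \<theta>: "strict_mono_on {..<N} \<theta>" "\<theta> ` {..<N} \<subseteq> {0..<2 * pi}"
    and rad: "\<And>b. b \<in> set u \<Longrightarrow> path_image (\<gamma> b) \<inter> D
            = h ` (\<Union>i\<in>{i. i < N \<and> u ! i = b}. closed_segment 0 (cis (\<theta> i)))"
    unfolding torus_realization_def N_def by simp_all
  have hD: "h ` cball 0 1 = D" and h'h: "\<And>z. z \<in> cball 0 1 \<Longrightarrow> h' (h z) = z"
    and conth: "continuous_on (cball 0 1) h" and conth': "continuous_on D h'"
    using hom by (auto simp: homeomorphism_def)
  have injh: "inj_on h (cball 0 1)" by (rule inj_on_inverseI[of _ h']) (rule h'h)
  have \<theta>in: "0 \<le> \<theta> i" "\<theta> i < 2 * pi" if "i < N" for i using \<theta>(2) that by (auto simp: image_subset_iff)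
  define m where "m = (if N = 0 then 0 else \<theta> (N - 1))"
  have m: "0 \<le> m" "m < 2 * pi" using \<theta>in[of "N - 1"] by (auto simp: m_def)
  have \<theta>m: "\<theta> i \<le> m" if "i < N" for i
  proof (cases "i = N - 1")
    case False
    with that have "\<theta> i < \<theta> (N - 1)" by (intro strict_mono_onD[OF \<theta>(1)]) auto
    with that show ?thesis by (simp add: m_def)
  qed (use that in \<open>auto simp: m_def\<close>)
  \<comment> \<open>The free sector between the last ray and the full angle is divided into thirds;
    without loops it starts at the default \<open>m = 0\<close>.\<close>
  define \<alpha> \<beta> where "\<alpha> = m + (2 * pi - m) / 3" and "\<beta> = m + 2 * (2 * pi - m) / 3"
  have \<alpha>\<beta>: "m < \<alpha>" "\<alpha> < \<beta>" "\<beta> < 2 * pi" "0 \<le> \<alpha>" using m by (auto simp: \<alpha>_def \<beta>_def field_simps)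
  define \<theta>' where "\<theta>' i = (if i < N then \<theta> i else if i = N then \<alpha> else \<beta>)" for i
  note L = sector_loop[OF \<alpha>\<beta>(4,2,3)]
  let ?L = "sector_loop \<alpha> \<beta>"
  define \<gamma>' where "\<gamma>' = \<gamma>(a := h \<circ> ?L)"
  define g where "g = (\<lambda>z. h (z / 2))"
  define E where "E = h ` cball 0 (1/2)"
  have Lball: "path_image ?L \<subseteq> cball 0 1" using L(4) by (force simp: norm_mult)
  have half: "(\<lambda>z::complex. z / 2) ` cball 0 1 = cball 0 (1/2)" "(\<lambda>z::complex. z / 2) ` ball 0 1 = ball 0 (1/2)"
    by (auto simp: norm_divide image_iff intro!: bexI[of _ "2 * _"])
  have gE: "g ` cball 0 1 = E" unfolding g_def E_def half(1)[symmetric] image_image ..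
  have ED: "E \<subseteq> D" unfolding E_def hD[symmetric] by (intro image_mono) auto
  have hom': "homeomorphism (cball 0 1) E g (\<lambda>y. 2 * h' y)"
  proof (rule homeomorphismI)
    show "continuous_on (cball 0 1) g" unfolding g_def
      by (rule continuous_on_compose2[OF conth]) (auto intro!: continuous_intros simp: norm_divide)
    show "continuous_on E (\<lambda>y. 2 * h' y)"
      by (intro continuous_intros continuous_on_subset[OF conth' ED])
    show "g ` cball 0 1 \<subseteq> E" using gE by simp
    show inv: "2 * h' (g z) = z" if "z \<in> cball 0 1" for z
      using h'h[of "z / 2"] that by (simp add: g_def norm_divide mult.commute)
    show "g (2 * h' y) = y" if "y \<in> E" for y using that inv unfolding gE[symmetric] by auto
    show "(\<lambda>y. 2 * h' y) ` E \<subseteq> cball 0 1" using inv unfolding gE[symmetric] by auto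
  qed
  have op': "openin (top_of_set torus) (g ` ball 0 1)"
    using openin_smaller_disc[OF hom op, of "1/2"] unfolding g_def half(2)[symmetric] image_image by simp
  have gray: "g ` closed_segment 0 (cis x) = h ` {of_real r * cis x |r. 0 \<le> r \<and> r \<le> 1/2}" for x
  proof -
    have "(\<lambda>z. z / 2) ` closed_segment 0 (cis x) = {of_real r * cis x |r. 0 \<le> r \<and> r \<le> 1/2}"
    proof (intro equalityI subsetI)
      fix z assume "z \<in> {of_real r * cis x |r. 0 \<le> r \<and> r \<le> 1/2}"
      then obtain r where "z = of_real r * cis x" "0 \<le> r" "r \<le> 1/2" by blast
      then show "z \<in> (\<lambda>z. z / 2) ` closed_segment 0 (cis x)"
        by (intro image_eqI[of _ _ "2 * z"]) (auto simp: in_ray_iff intro!: exI[of _ "2 * r"])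
    next
      fix z assume "z \<in> (\<lambda>z. z / 2) ` closed_segment 0 (cis x)"
      then obtain t where "0 \<le> t" "t \<le> 1" "z = of_real t * cis x / 2" by (auto simp: in_ray_iff)
      then show "z \<in> {of_real r * cis x |r. 0 \<le> r \<and> r \<le> 1/2}" by (auto intro!: exI[of _ "t / 2"])
    qed
    then show ?thesis unfolding g_def by (metis image_image)
  qed
  have meet_new: "path_image (h \<circ> ?L) \<inter> path_image (\<gamma> b) = {v}" if b: "b \<in> set u" for b
  proof (intro equalityI subsetI)
    fix y assume y: "y \<in> path_image (h \<circ> ?L) \<inter> path_image (\<gamma> b)"
    then obtain z where z: "z \<in> path_image ?L" "y = h z" by (auto simp: path_image_compose)
    have "y \<in> D" using z Lball hD by blast
    then have "y \<in> h ` (\<Union>i\<in>{i. i < N \<and> u ! i = b}. closed_segment 0 (cis (\<theta> i)))" using rad[OF b] y by blast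
    then obtain i t where i: "i < N" "0 \<le> t" "t \<le> 1" "y = h (of_real t * cis (\<theta> i))"
      by (auto simp: in_ray_iff)
    have "of_real t * cis (\<theta> i) \<in> cball 0 1" using i by (simp add: norm_mult)
    then have eq: "z = of_real t * cis (\<theta> i)" using injh z i Lball by (metis inj_onD subsetD)
    obtain r x where rx: "z = of_real r * cis x" "0 \<le> r" "\<alpha> \<le> x" "x \<le> \<beta>" using L(4) z(1) by blast
    have "t = 0"
      using rays_eq_iff[of t r "\<theta> i" x] eq rx i \<theta>in[OF i(1)] \<theta>m[OF i(1)] \<alpha>\<beta> by auto
    then show "y \<in> {v}" using eq z h0 by simp
  next
    fix y assume "y \<in> {v}"
    moreover have "v \<in> path_image (h \<circ> ?L)" using L(2) h0 by (metis pathstart_compose pathstart_in_path_image)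
    moreover have "v \<in> path_image (\<gamma> b)" using \<gamma>[OF b] by (metis pathstart_in_path_image)
    ultimately show "y \<in> path_image (h \<circ> ?L) \<inter> path_image (\<gamma> b)" by blast
  qed
  have "torus_realization (u @ [a, a]) v \<gamma>' E g (\<lambda>y. 2 * h' y) \<theta>'"
    unfolding torus_realization_def
  proof (intro conjI ballI impI)
    show "v \<in> torus" "E \<subseteq> torus" using v ED D by auto
    show "g 0 = v" using h0 by (simp add: g_def)
    fix b assume b: "b \<in> set (u @ [a, a])"
    have "simple_path (h \<circ> ?L)"
      by (intro simple_path_continuous_image L(1) continuous_on_subset[OF conth Lball] inj_on_subset[OF injh Lball])
    moreover have "path_image (h \<circ> ?L) \<subseteq> torus" using Lball hD D unfolding path_image_compose by blast
    moreover have "pathstart (h \<circ> ?L) = v" "pathfinish (h \<circ> ?L) = v"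
      using L(2,3) h0 by (simp_all add: pathstart_compose pathfinish_compose)
    ultimately show "simple_path (\<gamma>' b)" "path_image (\<gamma>' b) \<subseteq> torus" "pathstart (\<gamma>' b) = v" "pathfinish (\<gamma>' b) = v"
      using b \<gamma>[of b] by (auto simp: \<gamma>'_def)
    fix c assume c: "c \<in> set (u @ [a, a])" and "b \<noteq> c"
    then show "path_image (\<gamma>' b) \<inter> path_image (\<gamma>' c) = {v}"
      using b meet[of b c] meet_new[of b] meet_new[of c] by (auto simp: \<gamma>'_def Int_commute)
  next
    show "strict_mono_on {..<length (u @ [a, a])} \<theta>'"
    proof (rule strict_mono_onI)
      fix i j assume "i \<in> {..<length (u @ [a, a])}" "j \<in> {..<length (u @ [a, a])}" "i < j"
      then show "\<theta>' i < \<theta>' j"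
        using strict_mono_onD[OF \<theta>(1), of i j] \<theta>m[of i] \<alpha>\<beta> by (auto simp: \<theta>'_def N_def)
    qed
    show "\<theta>' ` {..<length (u @ [a, a])} \<subseteq> {0..<2 * pi}" using \<theta>in \<alpha>\<beta> by (auto simp: \<theta>'_def)
  next
    fix b assume b: "b \<in> set (u @ [a, a])"
    show "path_image (\<gamma>' b) \<inter> E = g ` (\<Union>i\<in>{i. i < length (u @ [a, a]) \<and> (u @ [a, a]) ! i = b}. closed_segment 0 (cis (\<theta>' i)))"
    proof (cases "b = a")
      case True
      have "{i. i < length (u @ [a, a]) \<and> (u @ [a, a]) ! i = b} = {N, N + 1}"
        using a True by (auto simp: N_def nth_append less_Suc_eq dest: nth_mem split: if_splits)
      then have "g ` (\<Union>i\<in>{i. i < length (u @ [a, a]) \<and> (u @ [a, a]) ! i = b}. closed_segment 0 (cis (\<theta>' i))) =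
          g ` closed_segment 0 (cis \<alpha>) \<union> g ` closed_segment 0 (cis \<beta>)"
        by (simp add: \<theta>'_def image_Un)
      also have "\<dots> = h ` {of_real r * cis x |r x. 0 \<le> r \<and> r \<le> 1/2 \<and> (x = \<alpha> \<or> x = \<beta>)}"
        unfolding gray image_Un[symmetric] by (intro arg_cong[of _ _ "(`) h"]) blast
      also have "\<dots> = h ` (path_image ?L \<inter> cball 0 (1/2))" unfolding L(5) ..
      also have "\<dots> = h ` path_image ?L \<inter> E"
        unfolding E_def by (rule inj_on_image_Int[OF injh Lball]) auto
      finally show ?thesis using True by (simp add: \<gamma>'_def path_image_compose)
    next
      case False
      then have bu: "b \<in> set u" using b by auto
      let ?I = "{i. i < N \<and> u ! i = b}"
      have "{i. i < length (u @ [a, a]) \<and> (u @ [a, a]) ! i = b} = ?I"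
        using False by (auto simp: N_def nth_append less_Suc_eq split: if_splits)
      then have "g ` (\<Union>i\<in>{i. i < length (u @ [a, a]) \<and> (u @ [a, a]) ! i = b}. closed_segment 0 (cis (\<theta>' i))) =
          (\<Union>i\<in>?I. g ` closed_segment 0 (cis (\<theta> i)))"
        by (simp add: \<theta>'_def image_UN)
      also have "\<dots> = h ` (\<Union>i\<in>?I. {of_real r * cis (\<theta> i) |r. 0 \<le> r \<and> r \<le> 1/2})"
        unfolding gray image_UN ..
      also have "(\<Union>i\<in>?I. {of_real r * cis (\<theta> i) |r. 0 \<le> r \<and> r \<le> 1/2}) =
          (\<Union>i\<in>?I. closed_segment 0 (cis (\<theta> i))) \<inter> cball 0 (1/2)"
        by (fastforce simp: in_ray_iff norm_mult)
      also have "h ` \<dots> = h ` (\<Union>i\<in>?I. closed_segment 0 (cis (\<theta> i))) \<inter> E"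
        unfolding E_def by (rule inj_on_image_Int[OF injh]) (auto simp: in_ray_iff norm_mult)
      also have "\<dots> = path_image (\<gamma> b) \<inter> E" unfolding rad[OF bu, symmetric] using ED by blast
      finally show ?thesis using False by (simp add: \<gamma>'_def)
    qed
  qed (use hom' op' in auto)
  then show ?thesis unfolding realizable_on_torus_iff by blast
qed

text \<open>
  The torus as a brick of a brick wall, i.e. as a degenerate hexagon with opposite sides identified:
  left and right side, left half of the top and right half of the bottom, right half of the top and
  left half of the bottom. A loop is a pair of segments from the centre to identified boundary points.
\<close>

definition brick_proj :: "complex \<Rightarrow> complex \<times> complex" where
  "brick_proj z = torus_cover (Re z - Im z / 2, Im z)"

definition brick :: "complex set" where
  "brick = {z. \<bar>Re z\<bar> \<le> 1/2 \<and> \<bar>Im z\<bar> \<le> 1/2}"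

definition brick_interior :: "complex set" where
  "brick_interior = {z. \<bar>Re z\<bar> < 1/2 \<and> \<bar>Im z\<bar> < 1/2}"

lemma continuous_brick_proj: "continuous_on S brick_proj"
  unfolding brick_proj_def torus_cover_def by (intro continuous_intros) simp_all

lemma brick_proj_in_torus: "brick_proj z \<in> torus"
  by (simp add: brick_proj_def torus_cover_def torus_def)

text \<open>The shear in \<open>brick_proj\<close> makes 1 and 1/2 + \<i> generators of the lattice
  of identifications. Passing through the top leads to the bottom displaced by half a width, which
  gives the rectangle the combinatorics of a hexagon.\<close>

lemma brick_proj_eq_iff:
  "brick_proj z = brick_proj y \<longleftrightarrow> Re z - Re y - (Im z - Im y) / 2 \<in> \<int> \<and> Im z - Im y \<in> \<int>"
proof -
  have "Re z - Im z / 2 - (Re y - Im y / 2) = Re z - Re y - (Im z - Im y) / 2"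
    by (simp add: diff_divide_distrib)
  then show ?thesis by (simp only: brick_proj_def torus_cover_eq_iff fst_diff snd_diff fst_conv snd_conv)
qed

text \<open>A coordinate difference of an interior point and a point of the closed brick is below 1
  in absolute value. The imaginary parts come first, since the shear drops out once they
  agree.\<close>

lemma brick_proj_inj:
  assumes "brick_proj z = brick_proj y" "z \<in> brick_interior" "y \<in> brick"
  shows "z = y"
proof -
  have "Im z - Im y \<in> \<int>" using assms(1) by (simp add: brick_proj_eq_iff)
  moreover have "\<bar>Im z - Im y\<bar> < 1" using assms(2,3) unfolding brick_def brick_interior_def mem_Collect_eq by linarith
  ultimately have im: "Im z - Im y = 0" using Ints_nonzero_abs_less1 by blast
  have "Re z - Re y \<in> \<int>" using assms(1) im by (simp add: brick_proj_eq_iff)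
  moreover have "\<bar>Re z - Re y\<bar> < 1" using assms(2,3) unfolding brick_def brick_interior_def mem_Collect_eq by linarith
  ultimately have "Re z - Re y = 0" using Ints_nonzero_abs_less1 by blast
  with im show ?thesis by (simp add: complex_eq_iff)
qed

lemma brick_proj_surj: "brick_proj ` brick = torus"
proof (intro equalityI subsetI)
  fix v assume "v \<in> torus"
  then obtain p where p: "torus_cover p = v" by (rule torus_cover_surj)
  \<comment> \<open>Rounding moves both coordinates into [-1/2, 1/2]; the first one is rounded after
    undoing the shear.\<close>
  define y where "y = snd p - of_int (round (snd p))"
  define x where "x = fst p + y / 2 - of_int (round (fst p + y / 2))"
  have "Complex x y \<in> brick"
    using of_int_round_abs_le[of "snd p"] of_int_round_abs_le[of "fst p + y / 2"]
    by (simp add: brick_def x_def y_def abs_minus_commute)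
  moreover have "brick_proj (Complex x y) = v"
    unfolding p[symmetric] brick_proj_def torus_cover_eq_iff by (simp add: x_def y_def)
  ultimately show "v \<in> brick_proj ` brick" by blast
qed (auto simp: brick_proj_in_torus)

lemma compact_brick: "compact brick"
proof -
  have "brick = cbox (Complex (-1/2) (-1/2)) (Complex (1/2) (1/2))"
    by (auto simp: brick_def in_cbox_complex_iff abs_le_iff)
  then show ?thesis using compact_cbox by metis
qed

lemma cball_brick_interior: "cball 0 (1/4) \<subseteq> brick_interior"
proof
  fix z :: complex assume "z \<in> cball 0 (1/4)"
  then show "z \<in> brick_interior"
    using abs_Re_le_cmod[of z] abs_Im_le_cmod[of z] by (simp add: brick_interior_def)
qed

text \<open>Points of the ball are identified with no other point of the brick, so the complement of
  the image is the image of the compact rest of the brick.\<close>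

lemma openin_brick_proj_ball: "openin (top_of_set torus) (brick_proj ` ball 0 (1/4))"
proof -
  have sub: "ball 0 (1/4) \<subseteq> brick_interior" using cball_brick_interior ball_subset_cball by blast
  have "compact (brick_proj ` (brick - ball 0 (1/4)))"
    by (intro compact_continuous_image continuous_brick_proj compact_diff compact_brick open_ball)
  then have "closed (brick_proj ` (brick - ball 0 (1/4)))" by (rule compact_imp_closed)
  moreover have "brick_proj ` ball 0 (1/4) = torus - brick_proj ` (brick - ball 0 (1/4))"
  proof (intro equalityI subsetI)
    fix v assume "v \<in> brick_proj ` ball 0 (1/4)"
    then obtain z where z: "z \<in> ball 0 (1/4)" "v = brick_proj z" by (metis imageE)
    have "v \<notin> brick_proj ` (brick - ball 0 (1/4))"
    proof
      assume "v \<in> brick_proj ` (brick - ball 0 (1/4))"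
      then obtain y where y: "y \<in> brick - ball 0 (1/4)" "v = brick_proj y" by (rule imageE)
      have "z = y"
      proof (rule brick_proj_inj)
        show "brick_proj z = brick_proj y" using z(2) y(2) by simp
        show "z \<in> brick_interior" using z(1) by (rule subsetD[OF sub])
        show "y \<in> brick" using y(1) by (rule DiffD1)
      qed
      then show False using y(1) z(1) by (metis DiffD2)
    qed
    then show "v \<in> torus - brick_proj ` (brick - ball 0 (1/4))" using z(2) brick_proj_in_torus by (metis DiffI)
  next
    fix v assume v: "v \<in> torus - brick_proj ` (brick - ball 0 (1/4))"
    then obtain z where "z \<in> brick" "v = brick_proj z" using brick_proj_surj by (metis DiffD1 imageE)
    with v show "v \<in> brick_proj ` ball 0 (1/4)" by (metis DiffD2 DiffI imageI)
  qed
  ultimately show ?thesis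
    by (metis Diff_eq openin_open open_Compl)
qed

section \<open>Stars in the brick\<close>

lemma arc_inj_on_compose:
  assumes "arc g" "continuous_on (path_image g) f" "inj_on f (path_image g)"
  shows "arc (f \<circ> g)"
  using assms path_continuous_image[of g f] comp_inj_on[of g "{0..1}" f]
  unfolding arc_def by (simp add: path_image_def)

text \<open>An entry consists of a loop, the end on the boundary of one of its two segments, and the
  argument of this end. \<open>T\<close> gives for each loop the point of the torus in which its two
  ends are glued.\<close>

definition star_end :: "('a \<Rightarrow> complex \<times> complex) \<Rightarrow> 'a \<times> complex \<times> real \<Rightarrow> bool" where
  "star_end T x \<longleftrightarrow> (case x of (a, p, \<psi>) \<Rightarrow> p \<in> brick - brick_interior \<and> p = of_real (norm p) * cis \<psi> \<and>
     \<psi> \<in> {0..<2 * pi} \<and> brick_proj p = T a)"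

text \<open>Segments with distinct directions meet in the centre only, and the injectivity of
  \<open>T\<close> keeps the far ends of different loops apart on the torus.\<close>

lemma star_realizable:
  fixes E :: "('a \<times> complex \<times> real) list"
  assumes H: "hieroglyph (map fst E)"
    and E: "\<And>x. x \<in> set E \<Longrightarrow> star_end T x"
    and inj: "inj_on T (fst ` set E)"
    and sorted: "sorted_wrt (\<lambda>x y. snd (snd x) < snd (snd y)) E"
  shows "realizable_on_torus (map fst E)"
proof -
  define w where "w = map fst E"
  define N where "N = length E"
  define pt where "pt i = fst (snd (E ! i))" for i
  define \<theta> where "\<theta> i = snd (snd (E ! i))" for i
  have Nw: "length w = N" by (simp add: w_def N_def)
  have pt: "pt i \<in> brick" "pt i \<notin> brick_interior" "pt i = of_real (norm (pt i)) * cis (\<theta> i)"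
    "\<theta> i \<in> {0..<2 * pi}" "brick_proj (pt i) = T (w ! i)" if "i < N" for i
    using E[of "E ! i"] that by (auto simp: star_end_def pt_def \<theta>_def w_def N_def split: prod.splits)
  have \<theta>: "strict_mono_on {..<N} \<theta>"
    using sorted by (intro strict_mono_onI) (simp add: \<theta>_def N_def sorted_wrt_iff_nth_less)
  have \<theta>inj: "\<theta> i = \<theta> j \<longleftrightarrow> i = j" if "i < N" "j < N" for i j
    using strict_mono_on_eq[OF \<theta>] that by simp
  have injT: "w ! i = w ! j" if "i < N" "j < N" "T (w ! i) = T (w ! j)" for i j
    using inj that by (auto simp: inj_on_def w_def N_def)
  have big: "1/4 < norm (pt i)" if "i < N" for i
    using cball_brick_interior pt(2)[OF that] by (auto simp: subset_iff not_le)
  define ray where "ray i = brick_proj ` closed_segment 0 (pt i)" for i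
  have int: "of_real t * pt i \<in> brick_interior" if "i < N" "0 \<le> t" "t < 1" for i t
  proof -
    have "t * \<bar>x\<bar> < 1/2" if "\<bar>x\<bar> \<le> 1/2" for x
      using mult_mono[of t t "\<bar>x\<bar>" "1/2"] that \<open>0 \<le> t\<close> \<open>t < 1\<close> by simp
    then show ?thesis using pt(1)[OF that(1)] that by (simp add: brick_def brick_interior_def abs_mult)
  qed
  have inb: "of_real t * pt i \<in> brick" if "i < N" "0 \<le> t" "t \<le> 1" for i t
    using int[of i t] pt(1)[of i] that by (cases "t = 1") (auto simp: brick_def brick_interior_def)
  have in_seg: "z \<in> closed_segment 0 (pt i) \<longleftrightarrow> (\<exists>t. 0 \<le> t \<and> t \<le> 1 \<and> z = of_real t * pt i)" for z i
    by (auto simp: in_segment scaleR_conv_of_real)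
  have pteq: "of_real t * pt i = of_real s * pt j \<longleftrightarrow> t * norm (pt i) = s * norm (pt j) \<and> (t = 0 \<or> i = j)"
    if "i < N" "j < N" "0 \<le> t" "0 \<le> s" for i j s t
  proof -
    have *: "of_real u * pt k = of_real (u * norm (pt k)) * cis (\<theta> k)" if "k < N" for u k
      by (subst pt(3)[OF that]) simp
    have "norm (pt i) \<noteq> 0" using big[OF that(1)] by auto
    then show ?thesis unfolding *[OF that(1)] *[OF that(2)]
      using rays_eq_iff[of "t * norm (pt i)" "s * norm (pt j)" "\<theta> i" "\<theta> j"] pt(4) \<theta>inj that by simp
  qed
  \<comment> \<open>All coincidences on the torus: the centre, one and the same point, or the glued
    ends of a loop. If one parameter is below 1, its point is interior, where the projection is
    injective.\<close>
  have key: "(t = 0 \<and> s = 0) \<or> (i = j \<and> t = s) \<or> (w ! i = w ! j \<and> t = 1 \<and> s = 1)"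
    if "i < N" "j < N" "0 \<le> t" "t \<le> 1" "0 \<le> s" "s \<le> 1"
      "brick_proj (of_real t * pt i) = brick_proj (of_real s * pt j)" for i j s t
  proof (cases "t < 1 \<or> s < 1")
    case True
    then have "of_real t * pt i = of_real s * pt j"
      using brick_proj_inj[OF that(7)] brick_proj_inj[OF that(7)[symmetric]] int inb that by metis
    then have *: "t * norm (pt i) = s * norm (pt j)" "t = 0 \<or> i = j" using pteq that by auto
    moreover have "norm (pt i) \<noteq> 0" "norm (pt j) \<noteq> 0" using big[OF that(1)] big[OF that(2)] by auto
    ultimately show ?thesis by auto
  next
    case False
    then have "t = 1" "s = 1" using that by auto
    then show ?thesis using that pt(5)[of i] pt(5)[of j] injT[of i j] by simp
  qed
  let ?idx = "\<lambda>a. {i. i < N \<and> w ! i = a}"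
  have "\<exists>ij. ?idx a = {fst ij, snd ij} \<and> fst ij \<noteq> snd ij" if "a \<in> set w" for a
  proof -
    have "hieroglyph w" using H by (simp only: w_def)
    from positions(1,2)[OF this that] show ?thesis unfolding Nw
      by (intro exI[of _ "(first_pos w a, last_pos w a)"]) auto
  qed
  then obtain ij where ij: "\<And>a. a \<in> set w \<Longrightarrow> ?idx a = {fst (ij a), snd (ij a)} \<and> fst (ij a) \<noteq> snd (ij a)" by metis
  define \<gamma> where "\<gamma> a = (brick_proj \<circ> linepath 0 (pt (fst (ij a)))) +++ (brick_proj \<circ> linepath (pt (snd (ij a))) 0)" for a
  define v where "v = brick_proj 0"
  \<comment> \<open>The disc of radius 1/4 lies in the interior of the brick, while all ends have
    larger norm, so each segment traverses a full radius of it.\<close>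
  define h where "h z = brick_proj (z / 4)" for z
  have ijN: "fst (ij a) < N" "snd (ij a) < N" "w ! fst (ij a) = a" "w ! snd (ij a) = a" "fst (ij a) \<noteq> snd (ij a)" if "a \<in> set w" for a
    using ij[OF that] by auto
  have v_ray: "v \<in> ray i" for i unfolding v_def ray_def by auto
  have im_\<gamma>: "path_image (\<gamma> a) = ray (fst (ij a)) \<union> ray (snd (ij a))" if "a \<in> set w" for a
    unfolding \<gamma>_def ray_def using pt(5) ijN[OF that]
    by (subst path_image_join)
      (simp_all add: path_image_compose pathfinish_compose pathstart_compose closed_segment_commute)
  have arcs: "arc (brick_proj \<circ> linepath 0 (pt i))" "arc (brick_proj \<circ> linepath (pt i) 0)" if i: "i < N" for i
  proof -
    have *: "inj_on brick_proj (closed_segment 0 (pt i))"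
    proof (rule inj_onI)
      fix x y assume "x \<in> closed_segment 0 (pt i)" "y \<in> closed_segment 0 (pt i)" and eq: "brick_proj x = brick_proj y"
      then obtain t s where "0 \<le> t" "t \<le> 1" "x = of_real t * pt i" "0 \<le> s" "s \<le> 1" "y = of_real s * pt i"
        unfolding in_seg by blast
      with key[OF i i, of t s] eq show "x = y" by auto
    qed
    have nz: "pt i \<noteq> 0" using big[OF i] by auto
    show "arc (brick_proj \<circ> linepath 0 (pt i))" "arc (brick_proj \<circ> linepath (pt i) 0)"
      by (rule arc_inj_on_compose; use * nz continuous_brick_proj in
          \<open>simp only: arc_linepath path_image_linepath closed_segment_commute[of _ 0] not_False_eq_True\<close>)+
  qed
  have ray_meet: "ray i \<inter> ray j \<subseteq> {v} \<union> (if w ! i = w ! j then {T (w ! i)} else {})" if "i < N" "j < N" "i \<noteq> j" for i j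
  proof
    fix y assume "y \<in> ray i \<inter> ray j"
    then obtain t s where ts: "0 \<le> t" "t \<le> 1" "0 \<le> s" "s \<le> 1" "y = brick_proj (of_real t * pt i)"
      "y = brick_proj (of_real s * pt j)" by (auto simp: ray_def in_seg)
    from key[OF that(1,2) ts(1-4)] ts(5,6) that(3)
    consider "t = 0" | "w ! i = w ! j" "t = 1" by auto
    then show "y \<in> {v} \<union> (if w ! i = w ! j then {T (w ! i)} else {})"
      using ts(5) pt(5)[OF that(1)] by cases (simp_all add: v_def)
  qed
  have simple: "simple_path (\<gamma> a)" if a: "a \<in> set w" for a
    unfolding \<gamma>_def
  proof (rule simple_path_join_loop[OF arcs(1) arcs(2)])
    note I = ijN[OF a]
    show "fst (ij a) < N" "snd (ij a) < N" using I by auto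
    have "path_image (brick_proj \<circ> linepath 0 (pt (fst (ij a)))) = ray (fst (ij a))"
      "path_image (brick_proj \<circ> linepath (pt (snd (ij a))) 0) = ray (snd (ij a))"
      by (simp_all add: ray_def path_image_compose closed_segment_commute)
    then show "path_image (brick_proj \<circ> linepath 0 (pt (fst (ij a)))) \<inter> path_image (brick_proj \<circ> linepath (pt (snd (ij a))) 0)
        \<subseteq> {pathstart (brick_proj \<circ> linepath 0 (pt (fst (ij a)))), pathstart (brick_proj \<circ> linepath (pt (snd (ij a))) 0)}"
      using ray_meet[OF I(1,2,5)] I(3,4) pt(5)[OF I(2)] by (auto simp: pathstart_compose v_def)
  qed (use ijN[OF a] pt(5) in \<open>simp_all add: pathstart_compose pathfinish_compose\<close>)
  obtain h' where hom: "homeomorphism (cball 0 1) (h ` cball 0 1) h h'"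
  proof -
    have "continuous_on (cball 0 1) h" unfolding h_def
      by (intro continuous_on_compose2[OF continuous_brick_proj[of UNIV]] continuous_intros) auto
    moreover have "inj_on h (cball 0 1)"
    proof (rule inj_onI)
      fix x y assume "x \<in> cball (0::complex) 1" "y \<in> cball (0::complex) 1" and eq: "h x = h y"
      then have "x / 4 \<in> brick_interior" "y / 4 \<in> brick_interior"
        using cball_brick_interior by (auto simp: norm_divide subset_iff)
      then have "x / 4 = y / 4" using brick_proj_inj[of "x / 4" "y / 4"] eq
        by (auto simp: h_def brick_def brick_interior_def)
      then show "x = y" by simp
    qed
    ultimately show ?thesis using homeomorphism_compact[of "cball 0 1" h "h ` cball 0 1"] that by auto
  qed
  have quarter: "(\<lambda>z::complex. z / 4) ` ball 0 1 = ball 0 (1/4)"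
    by (auto simp: norm_divide image_iff intro!: bexI[of _ "4 * _"])
  have ray_disc: "ray i \<inter> h ` cball 0 1 = h ` closed_segment 0 (cis (\<theta> i))" if i: "i < N" for i
  proof (intro equalityI subsetI)
    fix y assume "y \<in> ray i \<inter> h ` cball 0 1"
    then obtain t z where tz: "0 \<le> t" "t \<le> 1" "y = brick_proj (of_real t * pt i)" "z \<in> cball 0 1" "y = brick_proj (z / 4)"
      by (auto simp: ray_def in_seg h_def)
    have "z / 4 \<in> brick_interior" using tz(4) cball_brick_interior by (auto simp: norm_divide subset_iff)
    then have "z / 4 = of_real t * pt i" using brick_proj_inj[of "z / 4"] tz(3,5) inb[OF i tz(1,2)] by metis
    then have z: "z = of_real (4 * t * norm (pt i)) * cis (\<theta> i)" by (subst (asm) pt(3)[OF i]) (simp add: field_simps)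
    then have "norm z = 4 * t * norm (pt i)" using tz(1) by (simp only: norm_mult norm_of_real norm_cis) simp
    then have "4 * t * norm (pt i) \<le> 1" using tz(4) by simp
    then have "z \<in> closed_segment 0 (cis (\<theta> i))" unfolding in_ray_iff using z tz(1)
      by (intro exI[of _ "4 * t * norm (pt i)"]) auto
    then show "y \<in> h ` closed_segment 0 (cis (\<theta> i))" using tz(5) by (auto simp: h_def)
  next
    fix y assume "y \<in> h ` closed_segment 0 (cis (\<theta> i))"
    then obtain r where r: "0 \<le> r" "r \<le> 1" "y = h (of_real r * cis (\<theta> i))" by (auto simp: in_ray_iff)
    define t where "t = r / (4 * norm (pt i))"
    have n: "1/4 < norm (pt i)" by (rule big[OF i])
    have "0 \<le> t" "t \<le> 1" using r n by (auto simp: t_def divide_le_eq)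
    moreover have "of_real t * pt i = of_real r * cis (\<theta> i) / 4"
      using n by (subst pt(3)[OF i]) (auto simp: t_def)
    moreover from this have "y = brick_proj (of_real t * pt i)" using r(3) by (simp only: h_def)
    ultimately have "y \<in> ray i" unfolding ray_def in_seg image_iff Bex_def by blast
    moreover have "of_real r * cis (\<theta> i) \<in> cball 0 1" using r by (simp add: norm_mult)
    ultimately show "y \<in> ray i \<inter> h ` cball 0 1" using r(3) by blast
  qed
  have "torus_realization w v \<gamma> (h ` cball 0 1) h h' \<theta>"
    unfolding torus_realization_def Nw
  proof (intro conjI ballI impI)
    show "v \<in> torus" "h ` cball 0 1 \<subseteq> torus" by (auto simp: v_def h_def brick_proj_in_torus)
    show "h 0 = v" by (simp add: h_def v_def)
    show "openin (top_of_set torus) (h ` ball 0 1)"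
      using openin_brick_proj_ball unfolding quarter[symmetric] image_image h_def .
    show "\<theta> ` {..<N} \<subseteq> {0..<2 * pi}" using pt(4) by blast
  next
    fix a assume a: "a \<in> set w"
    show "simple_path (\<gamma> a)" by (rule simple[OF a])
    show "path_image (\<gamma> a) \<subseteq> torus" unfolding im_\<gamma>[OF a] by (auto simp: ray_def brick_proj_in_torus)
    show "pathstart (\<gamma> a) = v" "pathfinish (\<gamma> a) = v"
      by (simp_all add: \<gamma>_def v_def pathstart_compose pathfinish_compose)
    show "path_image (\<gamma> a) \<inter> h ` cball 0 1 = h ` (\<Union>i\<in>?idx a. closed_segment 0 (cis (\<theta> i)))"
      unfolding im_\<gamma>[OF a] Int_Un_distrib2 using ray_disc ijN[OF a] ij[OF a] by (simp add: image_Un)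
    fix b assume b: "b \<in> set w" and "a \<noteq> b"
    have "ray i \<inter> ray j = {v}" if "i \<in> {fst (ij a), snd (ij a)}" "j \<in> {fst (ij b), snd (ij b)}" for i j
    proof -
      have "i < N" "j < N" "w ! i \<noteq> w ! j" using that ijN[OF a] ijN[OF b] \<open>a \<noteq> b\<close> by auto
      then show ?thesis using ray_meet[of i j] v_ray by auto
    qed
    then show "path_image (\<gamma> a) \<inter> path_image (\<gamma> b) = {v}" unfolding im_\<gamma>[OF a] im_\<gamma>[OF b] by blast
  qed (use hom \<theta> in auto)
  then show ?thesis unfolding realizable_on_torus_iff w_def by blast
qed


lemma boundary_point_polar:
  fixes t :: real
  defines "R \<equiv> sqrt (1 + t\<^sup>2) / 2"
  shows "Complex (1/2) (t/2) = of_real R * cis (arctan t)"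
    and "Complex (t/2) (1/2) = of_real R * cis (pi/2 - arctan t)"
    and "Complex (-1/2) (t/2) = of_real R * cis (pi - arctan t)"
    and "Complex (t/2) (-1/2) = of_real R * cis (3 * pi/2 + arctan t)"
proof -
  have nz: "sqrt (1 + t\<^sup>2) \<noteq> 0" by (metis add_pos_nonneg less_irrefl real_sqrt_eq_zero_cancel_iff zero_le_power2 zero_less_one)
  have "cis (3 * pi/2 + arctan t) = cis pi * (cis (pi/2) * cis (arctan t))"
    unfolding cis_mult by (rule arg_cong[of _ _ cis]) simp
  then have "cis (3 * pi/2 + arctan t) = - \<i> * cis (arctan t)" by simp
  then show "Complex (t/2) (-1/2) = of_real R * cis (3 * pi/2 + arctan t)"
    using nz by (simp add: complex_eq_iff R_def cos_arctan sin_arctan)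
  show "Complex (1/2) (t/2) = of_real R * cis (arctan t)"
    using nz by (simp add: complex_eq_iff R_def cos_arctan sin_arctan)
  show "Complex (t/2) (1/2) = of_real R * cis (pi/2 - arctan t)"
    using nz by (simp add: complex_eq_iff R_def cos_arctan sin_arctan cos_diff sin_diff)
  show "Complex (-1/2) (t/2) = of_real R * cis (pi - arctan t)"
    using nz by (simp add: complex_eq_iff R_def cos_arctan sin_arctan cos_diff sin_diff)
qed

lemma arctan_quarter_bounds:
  assumes "\<bar>t\<bar> < 1"
  shows "- (pi/4) < arctan t" "arctan t < pi/4"
  using assms arctan_less_iff[of t 1] arctan_less_iff[of "-1" t] by (auto simp: arctan_one arctan_minus)

text \<open>\<open>t / 2\<close> is the offset from the midpoint of a side and
  \<open>arctan t\<close> the angle seen from the centre. On the right side \<open>0 \<le> t\<close>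
  is required, as the lower half would have a negative angle.\<close>

lemma boundary_star_ends:
  assumes t: "\<bar>t\<bar> < 1"
  shows "brick_proj (Complex (1/2) (t/2)) = T a \<Longrightarrow> 0 \<le> t \<Longrightarrow> star_end T (a, Complex (1/2) (t/2), arctan t)"
    and "brick_proj (Complex (t/2) (1/2)) = T a \<Longrightarrow> star_end T (a, Complex (t/2) (1/2), pi/2 - arctan t)"
    and "brick_proj (Complex (-1/2) (t/2)) = T a \<Longrightarrow> star_end T (a, Complex (-1/2) (t/2), pi - arctan t)"
    and "brick_proj (Complex (t/2) (-1/2)) = T a \<Longrightarrow> star_end T (a, Complex (t/2) (-1/2), 3 * pi/2 + arctan t)"
proof -
  have norm: "of_real r * cis x = of_real (norm (of_real r * cis x)) * cis x" if "0 \<le> r" for r x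
    using that by (simp add: norm_mult)
  have R: "0 \<le> sqrt (1 + t\<^sup>2) / 2" by simp
  note b = arctan_quarter_bounds[OF t] boundary_point_polar[of t]
  have n: "Complex (1/2) (t/2) = of_real (norm (Complex (1/2) (t/2))) * cis (arctan t)"
    "Complex (t/2) (1/2) = of_real (norm (Complex (t/2) (1/2))) * cis (pi/2 - arctan t)"
    "Complex (-1/2) (t/2) = of_real (norm (Complex (-1/2) (t/2))) * cis (pi - arctan t)"
    "Complex (t/2) (-1/2) = of_real (norm (Complex (t/2) (-1/2))) * cis (3 * pi/2 + arctan t)"
    unfolding b(3-6) by (rule norm[OF R])+
  have p: "0 < pi" by simp
  have brick: "Complex (1/2) (t/2) \<in> brick - brick_interior" "Complex (t/2) (1/2) \<in> brick - brick_interior"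
    "Complex (-1/2) (t/2) \<in> brick - brick_interior" "Complex (t/2) (-1/2) \<in> brick - brick_interior"
    using t by (auto simp: brick_def brick_interior_def)
  show "star_end T (a, Complex (1/2) (t/2), arctan t)" if "brick_proj (Complex (1/2) (t/2)) = T a" "0 \<le> t"
    unfolding star_end_def case_prod_conv
    using that brick(1) n(1) b(1,2) p zero_le_arctan_iff[of t] unfolding atLeastLessThan_iff by (intro conjI) (assumption | linarith)+
  show "star_end T (a, Complex (t/2) (1/2), pi/2 - arctan t)" if "brick_proj (Complex (t/2) (1/2)) = T a"
    unfolding star_end_def case_prod_conv
    using that brick(2) n(2) b(1,2) p unfolding atLeastLessThan_iff by (intro conjI) (assumption | linarith)+
  show "star_end T (a, Complex (-1/2) (t/2), pi - arctan t)" if "brick_proj (Complex (-1/2) (t/2)) = T a"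
    unfolding star_end_def case_prod_conv
    using that brick(3) n(3) b(1,2) p unfolding atLeastLessThan_iff by (intro conjI) (assumption | linarith)+
  show "star_end T (a, Complex (t/2) (-1/2), 3 * pi/2 + arctan t)" if "brick_proj (Complex (t/2) (-1/2)) = T a"
    unfolding star_end_def case_prod_conv
    using that brick(4) n(4) b(1,2) p unfolding atLeastLessThan_iff by (intro conjI) (assumption | linarith)+
qed

text \<open>Earlier values are squeezed into (1/2, 1) and the new first letter is put at 1/4. The
  values serve as coordinates of the ends of a block along a side of the brick.\<close>

lemma distinct_increasing_values:
  assumes "distinct xs"
  shows "\<exists>f :: 'a \<Rightarrow> real. (\<forall>x. 0 < f x \<and> f x < 1) \<and> sorted_wrt (\<lambda>a b. f a < f b) xs"
  using assms
proof (induction xs)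
  case Nil
  show ?case by (intro exI[of _ "\<lambda>_. 1/2"]) simp
next
  case (Cons x xs)
  then obtain f :: "'a \<Rightarrow> real" where f: "\<forall>x. 0 < f x \<and> f x < 1" "sorted_wrt (\<lambda>a b. f a < f b) xs" by auto
  define g where "g y = (if y = x then 1/4 else (f y + 1) / 2)" for y
  have "0 < g y \<and> g y < 1" for y
  proof -
    have "0 < f y" "f y < 1" using f(1) by auto
    then show ?thesis by (simp add: g_def)
  qed
  moreover have "1/4 < g y" if "y \<in> set xs" for y using that Cons.prems spec[OF f(1), of y] by (auto simp: g_def)
  moreover have "sorted_wrt (\<lambda>a b. g a < g b) xs"
    by (rule sorted_wrt_mono_rel[OF _ f(2)]) (use Cons.prems in \<open>auto simp: g_def\<close>)
  ultimately show ?case by (intro exI[of _ g]) (simp add: g_def)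
qed

lemma sorted_wrt_less_inj_on:
  fixes f :: "'a \<Rightarrow> 'b::linorder"
  shows "sorted_wrt (\<lambda>a b. f a < f b) xs \<Longrightarrow> inj_on f (set xs)"
proof (induction xs)
  case (Cons x xs)
  then have "f x \<notin> f ` set xs" by auto
  moreover from this have "x \<notin> set xs" by blast
  ultimately show ?case using Cons by simp
qed simp

lemma count_list_distinct: "distinct xs \<Longrightarrow> count_list xs a = of_bool (a \<in> set xs)"
  by (induction xs) auto

lemma hieroglyph_normal_form:
  assumes "distinct (A @ B @ C)"
  shows "hieroglyph (A @ B @ C @ rev A @ rev B @ rev C)"
  using assms by (auto simp: hieroglyph_def count_list_distinct)

text \<open>Counterclockwise, \<open>A\<close> occupies the upper half of the right side,
  \<open>B\<close> and \<open>C\<close> the right and left halves of the top, and the glued sides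
  follow in the same order. Opposite sides are glued by translations, hence traversed in opposite
  directions, which reverses each block. Heights on the right increase along \<open>A\<close>, while
  abscissas on the top decrease along \<open>B\<close> and \<open>C\<close>.\<close>

lemma realizable_normal_form:
  fixes A B C :: "'a list"
  assumes dist: "distinct (A @ B @ C)"
  shows "realizable_on_torus (A @ B @ C @ rev A @ rev B @ rev C)"
proof -
  obtain f :: "'a \<Rightarrow> real" where f: "\<And>x. 0 < f x \<and> f x < 1" "sorted_wrt (\<lambda>a b. f a < f b) A"
    using distinct_increasing_values[of A] dist by auto
  obtain g :: "'a \<Rightarrow> real" where g: "\<And>x. 0 < g x \<and> g x < 1" "sorted_wrt (\<lambda>a b. g b < g a) B"
    using distinct_increasing_values[of "rev B"] dist by (auto simp: sorted_wrt_rev)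
  obtain k :: "'a \<Rightarrow> real" where k: "\<And>x. 0 < k x \<and> k x < 1" "sorted_wrt (\<lambda>a b. k b < k a) C"
    using distinct_increasing_values[of "rev C"] dist by (auto simp: sorted_wrt_rev)
  define EA where "EA a = (a, Complex (1/2) (f a / 2), arctan (f a))" for a
  define EA' where "EA' a = (a, Complex (-1/2) (f a / 2), pi - arctan (f a))" for a
  define EB where "EB a = (a, Complex (g a / 2) (1/2), pi/2 - arctan (g a))" for a
  define EB' where "EB' a = (a, Complex ((g a - 1) / 2) (-1/2), 3 * pi/2 + arctan (g a - 1))" for a
  define EC where "EC a = (a, Complex ((k a - 1) / 2) (1/2), pi/2 - arctan (k a - 1))" for a
  define EC' where "EC' a = (a, Complex (k a / 2) (-1/2), 3 * pi/2 + arctan (k a))" for a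
  define E where "E = map EA A @ map EB B @ map EC C @ map EA' (rev A) @ map EB' (rev B) @ map EC' (rev C)"
  define T where "T a = (if a \<in> set A then brick_proj (Complex (1/2) (f a / 2))
      else if a \<in> set B then brick_proj (Complex (g a / 2) (1/2)) else brick_proj (Complex ((k a - 1) / 2) (1/2)))" for a
  have fstE: "map fst E = A @ B @ C @ rev A @ rev B @ rev C"
    by (simp add: E_def EA_def EA'_def EB_def EB'_def EC_def EC'_def o_def)
  have TA: "T a = brick_proj (Complex (1/2) (f a / 2))" "T a = brick_proj (Complex (-1/2) (f a / 2))" if "a \<in> set A" for a
    using that by (auto simp: T_def brick_proj_eq_iff)
  have TB: "T a = brick_proj (Complex (g a / 2) (1/2))" "T a = brick_proj (Complex ((g a - 1) / 2) (-1/2))" if "a \<in> set B" for a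
    using that dist by (auto simp: T_def brick_proj_eq_iff diff_divide_distrib)
  have TC: "T a = brick_proj (Complex ((k a - 1) / 2) (1/2))" "T a = brick_proj (Complex (k a / 2) (-1/2))" if "a \<in> set C" for a
    using that dist by (auto simp: T_def brick_proj_eq_iff diff_divide_distrib)
  have ends: "star_end T x" if "x \<in> set E" for x
  proof -
    have "\<bar>f a\<bar> < 1" "0 \<le> f a" "\<bar>g a\<bar> < 1" "\<bar>k a\<bar> < 1" "\<bar>g a - 1\<bar> < 1" "\<bar>k a - 1\<bar> < 1" for a
      using f(1)[of a] g(1)[of a] k(1)[of a] by auto
    note st = boundary_star_ends[OF this(1)] boundary_star_ends[OF this(3)] boundary_star_ends[OF this(4)]
      boundary_star_ends[OF this(5)] boundary_star_ends[OF this(6)] this(2)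
    from that consider a where "a \<in> set A" "x = EA a \<or> x = EA' a" | a where "a \<in> set B" "x = EB a \<or> x = EB' a"
      | a where "a \<in> set C" "x = EC a \<or> x = EC' a" by (auto simp: E_def)
    then show ?thesis
    proof cases
      case 1
      then show ?thesis unfolding EA_def EA'_def using st TA[OF 1(1)] by metis
    next
      case 2
      then show ?thesis unfolding EB_def EB'_def using st TB[OF 2(1)] by metis
    next
      case 3
      then show ?thesis unfolding EC_def EC'_def using st TC[OF 3(1)] by metis
    qed
  qed
  have "inj_on T (set (A @ B @ C))"
  proof (rule inj_onI)
    have zero: "x = 0" if "x \<in> \<int>" "\<bar>x\<bar> < 1" for x :: real using that Ints_nonzero_abs_less1 by blast
    note v = f(1) g(1) k(1)
    have inj_A: "a = b" if "a \<in> set A" "b \<in> set A" "T a = T b" for a b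
    proof -
      have "(f a - f b) / 2 \<in> \<int>" using that by (simp add: TA(1) brick_proj_eq_iff diff_divide_distrib)
      moreover have "\<bar>(f a - f b) / 2\<bar> < 1" using v(1)[of a] v(1)[of b] by (simp add: abs_if)
      ultimately have "f a = f b" using zero by fastforce
      then show ?thesis using sorted_wrt_less_inj_on[OF f(2)] that by (auto dest: inj_onD)
    qed
    have inj_B: "a = b" if "a \<in> set B" "b \<in> set B" "T a = T b" for a b
    proof -
      have "(g a - g b) / 2 \<in> \<int>" using that by (simp add: TB(1) brick_proj_eq_iff diff_divide_distrib)
      moreover have "\<bar>(g a - g b) / 2\<bar> < 1" using v(2)[of a] v(2)[of b] by (simp add: abs_if)
      ultimately have "g a = g b" using zero by fastforce
      then show ?thesis using sorted_wrt_less_inj_on[of "\<lambda>x. - g x" B] g(2) that by (simp add: inj_on_def)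
    qed
    have inj_C: "a = b" if "a \<in> set C" "b \<in> set C" "T a = T b" for a b
    proof -
      have "(k a - k b) / 2 \<in> \<int>" using that by (simp add: TC(1) brick_proj_eq_iff diff_divide_distrib)
      moreover have "\<bar>(k a - k b) / 2\<bar> < 1" using v(3)[of a] v(3)[of b] by (simp add: abs_if)
      ultimately have "k a = k b" using zero by fastforce
      then show ?thesis using sorted_wrt_less_inj_on[of "\<lambda>x. - k x" C] k(2) that by (simp add: inj_on_def)
    qed
    \<comment> \<open>The heights of a point on the right side and of one on the top differ by a
      non-integer.\<close>
    have AB: "T a \<noteq> T b" if "a \<in> set A" "b \<in> set B \<union> set C" for a b
    proof
      assume eq: "T a = T b"
      have "f a / 2 - 1/2 \<in> \<int>"
      proof (cases "b \<in> set B")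
        case True
        then show ?thesis using eq that by (simp add: TA(1) TB(1) brick_proj_eq_iff)
      next
        case False
        then have "b \<in> set C" using that by blast
        then show ?thesis using eq that by (simp add: TA(1) TC(1) brick_proj_eq_iff)
      qed
      moreover have "\<bar>f a / 2 - 1/2\<bar> < 1" using v(1)[of a] by (simp add: abs_if)
      ultimately have "f a / 2 - 1/2 = 0" by (rule zero)
      then show False using v(1)[of a] by simp
    qed
    \<comment> \<open>Points of \<open>B\<close> and \<open>C\<close> on the top lie on different
      sides of its midpoint, at distance less than 1.\<close>
    have BC: "T a \<noteq> T b" if "a \<in> set B" "b \<in> set C" for a b
    proof
      assume "T a = T b"
      then have "g a / 2 - (k b - 1) / 2 \<in> \<int>" using that by (simp add: TB(1) TC(1) brick_proj_eq_iff)
      moreover have "\<bar>g a / 2 - (k b - 1) / 2\<bar> < 1" using v(2)[of a] v(3)[of b] by (simp add: abs_if field_simps)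
      ultimately have "g a / 2 - (k b - 1) / 2 = 0" by (rule zero)
      then show False using v(2)[of a] v(3)[of b] by (simp add: field_simps)
    qed
    fix a b assume ab: "a \<in> set (A @ B @ C)" "b \<in> set (A @ B @ C)" "T a = T b"
    then show "a = b" using inj_A[of a b] inj_B[of a b] inj_C[of a b] AB[of a b] AB[of b a] BC[of a b] BC[of b a] by auto
  qed
  then have inj: "inj_on T (fst ` set E)"
    unfolding set_map[symmetric] fstE by (simp add: Un_ac)
  have sorted: "sorted_wrt (\<lambda>x y. snd (snd x) < snd (snd y)) E"
  proof -
    have bd: "0 < arctan (f a)" "arctan (f a) < pi/4" "0 < arctan (g a)" "arctan (g a) < pi/4"
      "0 < arctan (k a)" "arctan (k a) < pi/4" "- (pi/4) < arctan (g a - 1)" "arctan (g a - 1) < 0"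
      "- (pi/4) < arctan (k a - 1)" "arctan (k a - 1) < 0" for a
      using arctan_quarter_bounds[of "f a"] arctan_quarter_bounds[of "g a"] arctan_quarter_bounds[of "k a"]
        arctan_quarter_bounds[of "g a - 1"] arctan_quarter_bounds[of "k a - 1"] f(1)[of a] g(1)[of a] k(1)[of a]
      by auto
    \<comment> \<open>The six blocks lie in consecutive disjoint ranges of angles, separated at
      \<open>pi/4\<close>, \<open>pi/2\<close>, \<open>3 * pi/4\<close>, between \<open>pi\<close>
      and \<open>5 * pi/4\<close>, and at \<open>3 * pi/2\<close>.\<close>
    have bd2: "arctan (f a) < pi/2 - arctan (g b)" "arctan (f a) < pi/2 - arctan (k b - 1)"
      "arctan (f a) < pi - arctan (f b)" "arctan (f a) < 3 * pi/2 + arctan (g b - 1)" "arctan (f a) < 3 * pi/2 + arctan (k b)"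
      "pi/2 - arctan (g a) < pi/2 - arctan (k b - 1)" "pi/2 - arctan (g a) < pi - arctan (f b)"
      "pi/2 - arctan (g a) < 3 * pi/2 + arctan (g b - 1)" "pi/2 - arctan (g a) < 3 * pi/2 + arctan (k b)"
      "pi/2 - arctan (k a - 1) < pi - arctan (f b)" "pi/2 - arctan (k a - 1) < 3 * pi/2 + arctan (g b - 1)"
      "pi/2 - arctan (k a - 1) < 3 * pi/2 + arctan (k b)" "pi - arctan (f a) < 3 * pi/2 + arctan (g b - 1)"
      "pi - arctan (f a) < 3 * pi/2 + arctan (k b)" "3 * pi/2 + arctan (g a - 1) < 3 * pi/2 + arctan (k b)" for a b
      using bd[of a] bd[of b] by linarith+
    show ?thesis
      unfolding E_def sorted_wrt_append sorted_wrt_map sorted_wrt_rev EA_def EA'_def EB_def EB'_def EC_def EC'_def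
      using f(2) g(2) k(2) bd2 by (auto simp: arctan_less_iff)
  qed
  show ?thesis using star_realizable[OF _ ends inj sorted] hieroglyph_normal_form[OF dist] unfolding fstE by blast
qed

text \<open>The deleted isolated loops are restored in reverse order. A new pair is always drawn
  behind the last ray, and invariance under rotation moves it to the place where it was
  deleted.\<close>

lemma crossing_labels_realizable:
  assumes "hieroglyph w" "crossing_labels w l"
  shows "realizable_on_torus w"
proof -
  obtain u n A B C where u: "isolated_step\<^sup>*\<^sup>* w u" and nf: "rotate n u = A @ B @ C @ rev A @ rev B @ rev C" "distinct (A @ B @ C)"
    using reduces_to_normal_form[OF assms] by blast
  have "realizable_on_torus u" using realizable_normal_form[OF nf(2)] nf(1) realizable_rotate_iff[of n u] by simp
  with u assms(1) show ?thesis
  proof (induction rule: converse_rtranclp_induct)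
    case (step w v)
    from step(1) obtain m a where m: "rotate m w = [a, a] @ v" unfolding isolated_step_def by blast
    have H: "hieroglyph ([a, a] @ v)" using step.prems(1) hieroglyph_rotate[of m w] m by simp
    have "realizable_on_torus v" by (rule step.IH[OF hieroglyph_isolated(1)[OF H] step.prems(2)])
    then have "realizable_on_torus (v @ [a, a])" by (rule realizable_append_isolated[OF _ hieroglyph_isolated(2)[OF H]])
    moreover have "rotate (length v) (v @ [a, a]) = [a, a] @ v" by (rule rotate_append)
    ultimately show ?case using realizable_rotate_iff m by metis
  qed
qed

section \<open>The equivalences\<close>

theorem theorem1:
  fixes H :: "'a list"
  assumes "hieroglyph H"
  shows "(realizable_on_torus H \<longleftrightarrow>
            (\<forall>K\<in>{[0,1,0,1,2,3,2,3], [0,1,2,3,0,1,2,3], [0,1,0,2,3,2,1,3],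
                  [0,1,2,0,3,1,3,2 :: nat]}. \<not> contains_hieroglyph H K))
       \<and> (realizable_on_torus H \<longleftrightarrow>
            isolated_plus_complete_partite 2 (set H) (loops_cross H)
          \<or> isolated_plus_complete_partite 3 (set H) (loops_cross H))
       \<and> (realizable_on_torus H \<longleftrightarrow>
            (\<exists>K\<in>{[], [0,1,0,1], [0,1,2,0,1,2 :: nat]}. reduces_to H K))"
proof -
  have A: "realizable_on_torus H \<longleftrightarrow> (\<exists>l. crossing_labels H l)"
    using realizable_crossing_labels[OF assms] crossing_labels_realizable[OF assms] by blast
  have B: "(\<exists>l. crossing_labels H l) \<longleftrightarrow>
      (\<forall>K\<in>{[0,1,0,1,2,3,2,3], [0,1,2,3,0,1,2,3], [0,1,0,2,3,2,1,3], [0,1,2,0,3,1,3,2 :: nat]}. \<not> contains_hieroglyph H K)"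
    using crossing_labels_exist[OF assms] crossing_labels_not_contains[of H] by blast
  have D: "(\<exists>l. crossing_labels H l) \<longleftrightarrow> (\<exists>K\<in>{[], [0,1,0,1], [0,1,2,0,1,2 :: nat]}. reduces_to H K)"
    using reduces_to_crossing_labels[OF assms] crossing_labels_reduces_to[OF assms] by blast
  show ?thesis unfolding A B[symmetric] D[symmetric] crossing_labels_complete_partite[symmetric] by blast
qed

end
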